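(* Let $\rho>0$, $V\in\bar{\mathcal{V}}^{4}_{\delta_4}$ for some integer $1/\delta_4\in[4,+\infty)$, and let $w:\mathbb{R}^d\to[0,\infty)$ be continuous with $$\mathcal{L}V^{\rho}(x)\le -w(x)\qquad\forall x\in\mathbb{R}^d .$$ Assume that $V(\epsilon x)\le V(x)$ for all $x\in\mathbb{R}^d$, $0<\epsilon\le1$, that $$\sup_{0<|x|\le u}\frac{|f(x)|^2\vee|g(x)|^2}{\Lambda_\rho(x)V^{2\delta_4}(x)}<+\infty\qquad\forall u>0,\qquad \Lambda_\rho(x):=1\wedge\frac{w(x)}{V^\rho(x)} ,$$ and that $w(x)\ge\mu V^\rho(x)$ for all $x\in\mathbb{R}^d$, where $\mu>0$ is a constant. Then for any $\varrho\in(0,\mu)$ there is a constant $\Delta^{**}\in(0,\Delta^*]$ such that for any $\Delta\in(0,\Delta^{**}]$ the truncated Euler--Maruyama scheme $\{Z_k\}$ defined in the context satisfies $$\limsup_{k\to\infty}\frac{\log\big(\mathbb{E}V^\rho(Z_k)\big)}{k\Delta}\le-(\mu-\varrho)<0$$ and $$\limsup_{k\to\infty}\frac{\log\big(V(Z_k)\big)}{k\Delta}\le-\frac{\mu-\varrho}{\rho}\qquad\text{a.s.}$$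
   Context: **SDE.** $|\cdot|$ is the Euclidean norm on $\mathbb{R}^d$ and the trace (Frobenius) norm on matrices; $\mathbb{R}_+=(0,\infty)$, $\bar{\mathbb{R}}_+=[0,\infty)$; $a\vee b=\max\{a,b\}$, $a\wedge b=\min\{a,b\}$; $\log 0=-\infty$. On a complete filtered probability space $(\Omega,\mathcal{F},\{\mathcal{F}_t\}_{t\ge0},\mathbb{P})$ satisfying the usual conditions, $B(t)$ is an $m$-dimensional $\mathcal{F}_t$-Brownian motion. Consider $\mathrm{d}X(t)=f(X(t))\mathrm{d}t+g(X(t))\mathrm{d}B(t)$, $X(0)=x_0\in\mathbb{R}^d$, where $f:\mathbb{R}^d\to\mathbb{R}^d$, $g:\mathbb{R}^d\to\mathbb{R}^{d\times m}$ are locally Lipschitz continuous with $f(\mathbf{0})=\mathbf{0}$ and $g(\mathbf{0})=\mathbf{0}$. **Lyapunov functions.** $\mathcal{C}^p_\infty(\mathbb{R}^d;\bar{\mathbb{R}}_+)$ is the set of nonnegative $p$-times continuously differentiable functions on $\mathbb{R}^d$ tending to $\infty$ as $|x|\to\infty$. For a multiindex $\alpha$, $D^\alpha V$ is the usual partial derivative; $|D^{(n)}V(x)|=\big(\sum_{|\alpha|=n}|D^\alpha V(x)|^2\big)^{1/2}$; $D^{(1)}V$ is the gradient (row vector), $D^{(2)}V$ the Hessian (Frobenius norm). $\mathrm{Ker}(h)=\{x\in\mathbb{R}^d:h(x)=0\}$. For integers $p\ge2$ and $1/\delta_p\ge p$, $$\bar{\mathcal{V}}^{p}_{\delta_p}=\{V\in\mathcal{C}^p_\infty(\mathbb{R}^d;\bar{\mathbb{R}}_+):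 \mathrm{Ker}(V)=\{\mathbf{0}\},\ \exists c>0,\ |D^{(n)}V|\le cV^{1-n\delta_p},\ n=1,\dots,p\}.$$ $\mathcal{L}V(x)=\langle D^{(1)}V(x),f(x)\rangle+\frac12\mathrm{tr}[g^T(x)D^{(2)}V(x)g(x)]$, and $\mathcal{L}V^\rho(x)=\frac{\rho}{2}V^{\rho-2}(x)\big[2V(x)\mathcal{L}V(x)+(\rho-1)|D^{(1)}V(x)g(x)|^2\big]$ (read as $0$ at $x=\mathbf{0}$, where $f$ and $g$ vanish). **Scheme.** Choose a strictly increasing continuous $\bar\varphi:\mathbb{R}_+\to\mathbb{R}_+$ with $\bar\varphi(u)\to\infty$ as $u\to\infty$ and $$\sup_{0<|x|\le u}\left[\frac{|f(x)|}{\Lambda_\rho^{1/2}(x)V^{\delta_4}(x)}\vee\frac{|g(x)|^2}{\Lambda_\rho(x)V^{2\delta_4}(x)}\right]\le\bar\varphi(u)\qquad\forall u\ge1,$$ with inverse $\bar\varphi^{-1}:[\bar\varphi(1),\infty)\to\mathbb{R}_+$. Choose $0<\bar\theta<1/2$ and constants $\Delta^*\in(0,1)$, $K>0$ with $K(\Delta^* )^{-\bar\theta}\ge\bar\varphi(|x_0|\vee1)$ ($K$ independent of $\Delta$). For $\Delta\in(0,\Delta^*]$ put $\bar\pi_\Delta(x)=\big(|x|\wedge\bar\varphi^{-1}(K\Delta^{-\bar\theta})\big)\frac{x}{|x|}$ (with $x/|x|=\mathbf{0}$ for $x=\mathbf{0}$), $t_k=k\Delta$, $\Delta B_k=B(t_{k+1})-B(t_k)$,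 and for integers $k\ge0$ $$Z_0=x_0,\quad\tilde Z_{k+1}=Z_k+f(Z_k)\Delta+g(Z_k)\Delta B_k,\quad Z_{k+1}=\bar\pi_\Delta(\tilde Z_{k+1}).$$ *)

theory Defs
  imports "HOL-Probability.Probability"
begin

section \<open>Filtered probability space and Brownian motion\<close>

locale usual_filtered_space = prob_space M + complete_measure M
  for M :: "'a measure" +
  fixes F :: "real \<Rightarrow> 'a measure"
  assumes subalgebra_F: "\<And>t. 0 \<le> t \<Longrightarrow> subalgebra M (F t)"
    and F_mono: "\<And>s t. 0 \<le> s \<Longrightarrow> s \<le> t \<Longrightarrow> sets (F s) \<subseteq> sets (F t)"
    and null_sets_F: "null_sets M \<subseteq> sets (F 0)"
    and F_right_continuous: "\<And>t. 0 \<le> t \<Longrightarrow> sets (F t) = (\<Inter>s\<in>{t<..}. sets (F s))"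

text \<open>The law of an increment is \<open>N(0, (t - s) I)\<close>, given by its Lebesgue density.\<close>

locale filtered_brownian_motion = usual_filtered_space M F
  for M :: "'a measure" and F :: "real \<Rightarrow> 'a measure" +
  fixes B :: "real \<Rightarrow> 'a \<Rightarrow> real ^ 'm"
  assumes B_adapted: "\<And>t. 0 \<le> t \<Longrightarrow> B t \<in> borel_measurable (F t)"
    and B_zero: "AE \<omega> in M. B 0 \<omega> = 0"
    and B_increment_indep: "\<And>s t. 0 \<le> s \<Longrightarrow> s < t \<Longrightarrow>
      indep_set (sets (F s))
        (sets (vimage_algebra (space M) (\<lambda>\<omega>. B t \<omega> - B s \<omega>) borel))"
    and B_increment_normal: "\<And>s t. 0 \<le> s \<Longrightarrow> s < t \<Longrightarrow>
      distributed M lborel (\<lambda>\<omega>. B t \<omega> - B s \<omega>)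
        (\<lambda>y. ennreal (\<Prod>i\<in>UNIV. normal_density 0 (sqrt (t - s)) (y $ i)))"
    and B_continuous: "AE \<omega> in M. continuous_on {0..} (\<lambda>t. B t \<omega>)"

section \<open>Partial derivatives and Lyapunov functions\<close>

definition partial :: "'d \<Rightarrow> (real ^ 'd \<Rightarrow> real) \<Rightarrow> real ^ 'd \<Rightarrow> real" where
  "partial i h x = deriv (\<lambda>t. h (x + t *\<^sub>R axis i 1)) 0"

primrec Ck :: "nat \<Rightarrow> (real ^ 'd \<Rightarrow> real) \<Rightarrow> bool" where
  "Ck 0 h \<longleftrightarrow> continuous_on UNIV h"
| "Ck (Suc n) h \<longleftrightarrow> (\<forall>x. h differentiable (at x)) \<and> (\<forall>i. Ck n (partial i h))"

text \<open>A multiindex is a function \<open>\<alpha>\<close> on the index type. The partial derivatives are taken in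
  an arbitrary order, since the index type carries none; for functions that are \<open>|\<alpha>|\<close>
  times continuously differentiable the order is immaterial.\<close>

definition multi_partial :: "('d \<Rightarrow> nat) \<Rightarrow> (real ^ 'd \<Rightarrow> real) \<Rightarrow> real ^ 'd \<Rightarrow> real" where
  "multi_partial \<alpha> h = foldr partial (SOME is. \<forall>i. count_list is i = \<alpha> i) h"

definition norm_D :: "nat \<Rightarrow> (real ^ 'd \<Rightarrow> real) \<Rightarrow> real ^ 'd \<Rightarrow> real" where
  "norm_D n h x =
    sqrt (\<Sum>\<alpha> | (\<Sum>i\<in>UNIV. \<alpha> i) = n. \<bar>multi_partial \<alpha> h x\<bar>\<^sup>2)"

definition gradient :: "(real ^ 'd \<Rightarrow> real) \<Rightarrow> real ^ 'd \<Rightarrow> real ^ 'd" where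
  "gradient h x = (\<chi> i. partial i h x)"

definition hessian :: "(real ^ 'd \<Rightarrow> real) \<Rightarrow> real ^ 'd \<Rightarrow> real ^ 'd ^ 'd" where
  "hessian h x = (\<chi> i j. partial i (partial j h) x)"

text \<open>Powers of nonnegative reals with \<open>0\<^sup>0 = 1\<close>; the library has \<open>0 powr 0 = 0\<close>.
  The difference matters for the exponent \<open>1 - n * \<delta> = 0\<close> at the origin.\<close>

definition rpow :: "real \<Rightarrow> real \<Rightarrow> real" where
  "rpow v a = (if a = 0 then 1 else v powr a)"

definition lyapunov_class :: "nat \<Rightarrow> real \<Rightarrow> (real ^ 'd \<Rightarrow> real) set" where
  "lyapunov_class p \<delta> = {V. (\<forall>x. 0 \<le> V x) \<and> Ck p V \<and> filterlim V at_top at_infinity \<and>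
     {x. V x = 0} = {0} \<and>
     (\<exists>c>0. \<forall>n\<in>{1..p}. \<forall>x. norm_D n V x \<le> c * rpow (V x) (1 - real n * \<delta>))}"

definition generator ::
  "(real ^ 'd \<Rightarrow> real ^ 'd) \<Rightarrow> (real ^ 'd \<Rightarrow> real ^ 'm ^ 'd) \<Rightarrow>
    (real ^ 'd \<Rightarrow> real) \<Rightarrow> real ^ 'd \<Rightarrow> real" where
  "generator f g V x =
    gradient V x \<bullet> f x + 1 / 2 * trace (transpose (g x) ** hessian V x ** g x)"

text \<open>The generator applied to \<open>V\<^sup>\<rho>\<close>, in the expanded form that also makes sense where
  \<open>V\<^sup>\<rho>\<close> is not twice differentiable; it is read as \<open>0\<close> at the origin.\<close>

definition generator_pow ::
  "(real ^ 'd \<Rightarrow> real ^ 'd) \<Rightarrow> (real ^ 'd \<Rightarrow> real ^ 'm ^ 'd) \<Rightarrow>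
    (real ^ 'd \<Rightarrow> real) \<Rightarrow> real \<Rightarrow> real ^ 'd \<Rightarrow> real" where
  "generator_pow f g V \<rho> x = (if x = 0 then 0 else
    \<rho> / 2 * V x powr (\<rho> - 2) *
      (2 * V x * generator f g V x + (\<rho> - 1) * (norm (gradient V x v* g x))\<^sup>2))"

definition Lam :: "(real ^ 'd \<Rightarrow> real) \<Rightarrow> (real ^ 'd \<Rightarrow> real) \<Rightarrow> real \<Rightarrow> real ^ 'd \<Rightarrow> real" where
  "Lam V w \<rho> x = min 1 (w x / V x powr \<rho>)"

section \<open>Truncated Euler--Maruyama scheme\<close>

text \<open>\<open>sgn x\<close> is \<open>x / |x|\<close>, and \<open>0\<close> at \<open>x = 0\<close>.\<close>

definition truncation :: "(real \<Rightarrow> real) \<Rightarrow> real \<Rightarrow> real \<Rightarrow> real \<Rightarrow> real ^ 'd \<Rightarrow> real ^ 'd" where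
  "truncation \<phi> K \<theta> \<Delta> x =
    min (norm x) (inv_into {0<..} \<phi> (K * \<Delta> powr (- \<theta>))) *\<^sub>R sgn x"

primrec truncated_EM ::
  "(real ^ 'd \<Rightarrow> real ^ 'd) \<Rightarrow> (real ^ 'd \<Rightarrow> real ^ 'm ^ 'd) \<Rightarrow> (real \<Rightarrow> 'a \<Rightarrow> real ^ 'm) \<Rightarrow>
    (real \<Rightarrow> real) \<Rightarrow> real \<Rightarrow> real \<Rightarrow> real ^ 'd \<Rightarrow> real \<Rightarrow> nat \<Rightarrow> 'a \<Rightarrow> real ^ 'd" where
  "truncated_EM f g B \<phi> K \<theta> x0 \<Delta> 0 \<omega> = x0"
| "truncated_EM f g B \<phi> K \<theta> x0 \<Delta> (Suc k) \<omega> =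
    (let z = truncated_EM f g B \<phi> K \<theta> x0 \<Delta> k \<omega>
     in truncation \<phi> K \<theta> \<Delta>
          (z + \<Delta> *\<^sub>R f z + g z *v (B (real (Suc k) * \<Delta>) \<omega> - B (real k * \<Delta>) \<omega>)))"

text \<open>Logarithm of a nonnegative real with \<open>log 0 = -\<infinity>\<close>.\<close>

definition elog :: "real \<Rightarrow> ereal" where
  "elog y = (if y \<le> 0 then -\<infinity> else ereal (ln y))"

end

theory Submission
  imports Defs
begin

text \<open>
  Write \<open>W = V\<^sup>\<rho>\<close> and let \<open>x\<close> be the current state of the scheme. One step before truncation
  leads to \<open>x + a + s\<close> with \<open>a = \<Delta> f(x)\<close> and \<open>s = g(x) \<Delta>B\<close>. The core is the one-step bound
  \<open>\<E> W(x + a + s) \<le> (1 - \<mu> \<Delta> + C (h \<Delta>)\<^sup>2) W(x)\<close> with \<open>h = K \<Delta>\<^sup>-\<^sup>\<theta>\<close>, where \<open>C\<close> depends on neither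
  \<open>x\<close> nor \<open>\<Delta>\<close>. As \<open>h\<^sup>2 \<Delta>\<^sup>2 = K\<^sup>2 \<Delta>\<^sup>2\<^sup>-\<^sup>2\<^sup>\<theta>\<close> and \<open>\<theta> < 1/2\<close>, the error is \<open>o(\<Delta>)\<close>.

  The class of \<open>V\<close> singles out \<open>r = V(x)\<^sup>\<delta>\<close> as the length scale at \<open>x\<close>: the bounds on the derivatives
  read \<open>|D\<^sup>(\<^sup>n\<^sup>)V| \<le> c V / r\<^sup>n\<close>, and the one with \<open>n = 1\<close> makes \<open>V\<^sup>\<delta>\<close> globally Lipschitz
  (\<open>V_powr_lipschitz\<close>). So \<open>V\<close> is comparable to \<open>V(x)\<close> on a ball of radius proportional to \<open>r\<close>,
  where \<open>W\<close> is four times differentiable although it may be singular at the origin. The truncation keeps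
  \<open>x\<close> in the region where \<open>|f(x)| \<le> h r\<close> and \<open>|g(x)|\<^sup>2 \<le> h r\<^sup>2\<close>, so that the relative sizes
  \<open>\<alpha> = |a| / r\<close> and \<open>\<kappa> = |s| / r\<close> are at most \<open>h \<Delta>\<close> and \<open>\<surd>h |\<Delta>B|\<close>.

  The Gaussian increment is symmetric, hence \<open>W(x + a + s)\<close> may be replaced by the mean of
  \<open>W(x + a + s)\<close> and \<open>W(x + a - s)\<close>, from which all odd derivatives along \<open>s\<close> cancel. Expanding
  along \<open>s\<close> to fourth order and along \<open>a\<close> to second order gives, for every value of \<open>s\<close>,
  the upper bound \<open>W + DW[a] + D\<^sup>2W[s,s]/2 + C W (\<alpha>\<^sup>2 + \<alpha> \<kappa>\<^sup>2 + \<kappa>\<^sup>4 + \<kappa>\<^sup>N)\<close>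
  (\<open>symmetrized_increment\<close>); the last term covers increments larger than the ball of comparability,
  for which the polynomial growth of \<open>W\<close> suffices. Taking expectations turns the first three terms
  into \<open>W + \<Delta> \<L>W\<close> exactly and the others into \<open>O((h \<Delta>)\<^sup>2) W\<close> (\<open>one_step_moment\<close>). An
  expansion with a third-order remainder would leave \<open>(h \<Delta>)\<^sup>3\<^sup>/\<^sup>2\<close>, which is \<open>o(\<Delta>)\<close> only for
  \<open>\<theta> < 1/3\<close>; this is where four derivatives of \<open>V\<close> and the symmetry enter.

  With \<open>\<L>W \<le> -w \<le> -\<mu> W\<close>, and since the truncation does not increase \<open>V\<close>, the moments satisfy
  \<open>\<E> W(Z\<^sub>k\<^sub>+\<^sub>1) \<le> exp(-\<beta> \<Delta>) \<E> W(Z\<^sub>k)\<close> with \<open>\<beta>\<close> slightly below \<open>\<mu>\<close>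
  (\<open>truncated_EM_moment_decay\<close>). The first growth rate is immediate, and the second follows because
  \<open>\<Sum>\<^sub>k exp(\<gamma> k \<Delta>) W(Z\<^sub>k)\<close> has finite expectation for every \<open>\<gamma> < \<beta>\<close>.
\<close>

section \<open>Taylor expansion of a power of a positive function of one variable\<close>

text \<open>The value at a point of the \<open>n\<close>-th derivative of \<open>u\<^sup>p\<close> (\<open>n \<le> 4\<close>), in terms of the
  derivatives \<open>y 0, y 1, \<dots>\<close> of \<open>u\<close> there: the formula of Faa di Bruno for a power.\<close>

definition pow_jet :: "real \<Rightarrow> (nat \<Rightarrow> real) \<Rightarrow> nat \<Rightarrow> real" where
  "pow_jet p y n =
    (if n = 0 then y 0 powr p
     else if n = 1 then p * y 0 powr (p - 1) * y 1
     else if n = 2 then p * (p - 1) * y 0 powr (p - 2) * (y 1)^2 + p * y 0 powr (p - 1) * y 2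
     else if n = 3 then p * (p - 1) * (p - 2) * y 0 powr (p - 3) * (y 1)^3
       + 3 * p * (p - 1) * y 0 powr (p - 2) * (y 1 * y 2) + p * y 0 powr (p - 1) * y 3
     else p * (p - 1) * (p - 2) * (p - 3) * y 0 powr (p - 4) * (y 1)^4
       + 6 * p * (p - 1) * (p - 2) * y 0 powr (p - 3) * (y 1)^2 * y 2
       + p * (p - 1) * y 0 powr (p - 2) * (3 * (y 2)^2 + 4 * y 1 * y 3)
       + p * y 0 powr (p - 1) * y 4)"

lemma DERIV_powr_fun:
  fixes u :: "real \<Rightarrow> real"
  assumes "(u has_real_derivative u') (at t)" "u t > 0"
  shows "((\<lambda>t. u t powr p) has_real_derivative p * u t powr (p - 1) * u') (at t)"
  by (rule DERIV_chain2[where f = "\<lambda>z. z powr p", OF has_real_derivative_powr[OF assms(2)] assms(1)])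

lemma DERIV_pow_jet:
  fixes U :: "nat \<Rightarrow> real \<Rightarrow> real"
  assumes d: "\<And>k. k \<le> n \<Longrightarrow> (U k has_real_derivative U (Suc k) t) (at t)"
    and pos: "U 0 t > 0" and n: "n \<le> 3"
  shows "((\<lambda>t. pow_jet p (\<lambda>k. U k t) n) has_real_derivative pow_jet p (\<lambda>k. U k t) (Suc n)) (at t)"
proof -
  have d0: "(U 0 has_real_derivative U 1 t) (at t)" using d[of 0] by simp
  have dp: "((\<lambda>t. U 0 t powr q) has_real_derivative q * U 0 t powr (q - 1) * U 1 t) (at t)" for q
    by (rule DERIV_powr_fun[OF d0 pos])
  have d1: "(U 1 has_real_derivative U 2 t) (at t)" if "n \<ge> 1"
    using d[of 1] that by (simp add: numeral_2_eq_2)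
  have d2: "(U 2 has_real_derivative U 3 t) (at t)" if "n \<ge> 2"
    using d[of 2] that by (simp add: eval_nat_numeral)
  have d3: "(U 3 has_real_derivative U 4 t) (at t)" if "n \<ge> 3"
    using d[of 3] that by (simp add: eval_nat_numeral)
  have mono: "((\<lambda>t. c * U 0 t powr q * X t) has_real_derivative
      c * q * U 0 t powr (q - 1) * U 1 t * X t + c * U 0 t powr q * X') (at t)"
    if "(X has_real_derivative X') (at t)" for c q X X'
    by (rule DERIV_cong[OF DERIV_mult[OF DERIV_cmult[OF dp] that]]) (simp add: algebra_simps)
  consider "n = 0" | "n = 1" | "n = 2" | "n = 3" using n by linarith
  then show ?thesis
  proof cases
    case 1 then show ?thesis using dp by (simp add: pow_jet_def)
  next
    case 2
    have "((\<lambda>t. p * U 0 t powr (p - 1) * U 1 t) has_real_derivative pow_jet p (\<lambda>k. U k t) 2) (at t)"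
      by (rule DERIV_cong[OF mono[OF d1]])
        (use 2 in \<open>simp_all del: One_nat_def add: pow_jet_def algebra_simps power2_eq_square\<close>)
    then show ?thesis using 2 by (simp add: pow_jet_def flip: numeral_2_eq_2)
  next
    case 3
    have "((\<lambda>t. p * (p - 1) * U 0 t powr (p - 2) * (U 1 t)^2 + p * U 0 t powr (p - 1) * U 2 t)
        has_real_derivative pow_jet p (\<lambda>k. U k t) 3) (at t)"
      by (rule DERIV_cong[OF DERIV_add[OF mono[OF DERIV_power[OF d1]] mono[OF d2]]])
        (use 3 in \<open>simp_all del: One_nat_def add: pow_jet_def algebra_simps power2_eq_square power3_eq_cube\<close>)
    then show ?thesis using 3 by (simp add: pow_jet_def)
  next
    case 4
    have "((\<lambda>t. p * (p - 1) * (p - 2) * U 0 t powr (p - 3) * (U 1 t)^3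
        + 3 * p * (p - 1) * U 0 t powr (p - 2) * (U 1 t * U 2 t) + p * U 0 t powr (p - 1) * U 3 t)
        has_real_derivative pow_jet p (\<lambda>k. U k t) 4) (at t)"
      by (rule DERIV_cong[OF DERIV_add[OF DERIV_add[OF mono[OF DERIV_power[OF d1]]
            mono[OF DERIV_mult[OF d1 d2]]] mono[OF d3]]])
        (use 4 in \<open>simp_all del: One_nat_def add: pow_jet_def algebra_simps power2_eq_square power3_eq_cube power4_eq_xxxx\<close>)
    then show ?thesis using 4 by (simp add: pow_jet_def)
  qed
qed

lemma powr_le_endpoints:
  fixes y :: real
  assumes "0 < l" "l \<le> y" "y \<le> h"
  shows "y powr p \<le> l powr p + h powr p"
proof (cases "p \<ge> 0")
  case True
  then have "y powr p \<le> h powr p" using assms by (intro powr_mono2) auto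
  then show ?thesis by (smt (verit) powr_ge_zero)
next
  case False
  then have "y powr p \<le> l powr p" using assms by (intro powr_mono2') auto
  then show ?thesis by (smt (verit) powr_ge_zero)
qed

lemma powr_uniform_bound:
  fixes l h p :: real
  assumes l: "0 < l"
  obtains E where "E \<ge> 0" "\<And>y k. l \<le> y \<Longrightarrow> y \<le> h \<Longrightarrow> k \<le> 4 \<Longrightarrow> y powr (p - real k) \<le> E"
proof
  let ?e = "\<lambda>k. l powr (p - real k) + h powr (p - real k)"
  show "(\<Sum>k\<le>4. ?e k) \<ge> 0" by (intro sum_nonneg) simp
  fix y k assume y: "l \<le> y" "y \<le> h" and k: "k \<le> (4 :: nat)"
  have "y powr (p - real k) \<le> ?e k" by (rule powr_le_endpoints[OF l y])
  also have "\<dots> \<le> (\<Sum>k\<le>4. ?e k)" using k by (intro member_le_sum) auto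
  finally show "y powr (p - real k) \<le> (\<Sum>k\<le>4. ?e k)" .
qed

text \<open>Each summand of the \<open>n\<close>-th derivative contains derivatives of \<open>u\<close> of total order \<open>n\<close>,
  so bounds of the form \<open>D \<kappa>\<^sup>k\<close> on the derivatives of \<open>u\<close> are inherited with the same homogeneity in \<open>\<kappa>\<close>.
  The constant must not depend on \<open>\<kappa>\<close>, which is the relative step size later on.\<close>

lemma pow_jet_bound:
  assumes l: "0 < l" and D: "D \<ge> 0"
  obtains C where "C \<ge> 0"
    "\<And>y \<kappa> n. l \<le> y 0 \<Longrightarrow> y 0 \<le> h \<Longrightarrow> 0 \<le> \<kappa> \<Longrightarrow> n \<le> 4 \<Longrightarrow> (\<And>k. 1 \<le> k \<Longrightarrow> k \<le> n \<Longrightarrow> \<bar>y k\<bar> \<le> D * \<kappa> ^ k)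
      \<Longrightarrow> \<bar>pow_jet p y n\<bar> \<le> C * \<kappa> ^ n"
proof -
  obtain E where E0: "E \<ge> 0"
    and E: "\<And>y k. l \<le> y \<Longrightarrow> y \<le> h \<Longrightarrow> k \<le> 4 \<Longrightarrow> y powr (p - real k) \<le> E"
    using powr_uniform_bound[OF l, of h p] by metis
  define P where "P = 1 + \<bar>p\<bar> + \<bar>p * (p - 1)\<bar> + \<bar>p * (p - 1) * (p - 2)\<bar> + \<bar>p * (p - 1) * (p - 2) * (p - 3)\<bar>"
  define D' where "D' = 1 + D + D^2 + D^3 + D^4"
  have P: "\<bar>p\<bar> \<le> P" "\<bar>p * (p - 1)\<bar> \<le> P" "\<bar>p * (p - 1) * (p - 2)\<bar> \<le> P" "\<bar>p * (p - 1) * (p - 2) * (p - 3)\<bar> \<le> P" "1 \<le> P"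
    unfolding P_def by linarith+
  have Dk: "D ^ k \<le> D'" if "k \<le> 4" for k
  proof -
    have "k = 0 \<or> k = 1 \<or> k = 2 \<or> k = 3 \<or> k = 4" using that by linarith
    moreover have "D^2 \<ge> 0" "D^3 \<ge> 0" "D^4 \<ge> 0" using D by simp_all
    ultimately show ?thesis using D unfolding D'_def by auto
  qed
  have D'0: "D' \<ge> 0" using Dk[of 0] by simp
  show thesis
  proof (rule that[of "15 * (P * E * D')"])
    show "15 * (P * E * D') \<ge> 0" using P E0 D'0 by simp
    fix y :: "nat \<Rightarrow> real" and \<kappa> :: real and n :: nat
    assume y: "l \<le> y 0" "y 0 \<le> h" and lam: "0 \<le> \<kappa>" and n: "n \<le> 4"
      and yb: "\<And>k. 1 \<le> k \<Longrightarrow> k \<le> n \<Longrightarrow> \<bar>y k\<bar> \<le> D * \<kappa> ^ k"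
    have tm: "\<bar>c * y 0 powr (p - real k) * m\<bar> \<le> (P * E * D') * \<kappa> ^ n"
      if "\<bar>c\<bar> \<le> P" "k \<le> 4" "\<bar>m\<bar> \<le> D ^ j * \<kappa> ^ n" "j \<le> 4" for c k m j
    proof -
      have "\<bar>m\<bar> \<le> D' * \<kappa> ^ n"
        using that(3) Dk[OF that(4)] lam by (meson mult_right_mono order_trans zero_le_power)
      then have "\<bar>c\<bar> * y 0 powr (p - real k) * \<bar>m\<bar> \<le> P * E * (D' * \<kappa> ^ n)"
        using that(1) E[OF y that(2)] P(5) E0 by (intro mult_mono) auto
      then show ?thesis by (simp add: abs_mult mult.assoc)
    qed
    have prod2: "\<bar>a * b\<bar> \<le> D ^ (i + j) * \<kappa> ^ (r + s)"
      if "\<bar>a\<bar> \<le> D ^ i * \<kappa> ^ r" "\<bar>b\<bar> \<le> D ^ j * \<kappa> ^ s" for a b i j r s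
    proof -
      have "\<bar>a\<bar> * \<bar>b\<bar> \<le> (D ^ i * \<kappa> ^ r) * (D ^ j * \<kappa> ^ s)"
        using that D lam by (intro mult_mono) auto
      then show ?thesis by (simp add: abs_mult power_add algebra_simps)
    qed
    have y1: "\<bar>y 1\<bar> \<le> D ^ 1 * \<kappa> ^ 1" if "n \<ge> 1" using yb[of 1] that by simp
    have y2: "\<bar>y 2\<bar> \<le> D ^ 1 * \<kappa> ^ 2" if "n \<ge> 2" using yb[of 2] that by simp
    have y3: "\<bar>y 3\<bar> \<le> D ^ 1 * \<kappa> ^ 3" if "n \<ge> 3" using yb[of 3] that by simp
    have y4: "\<bar>y 4\<bar> \<le> D ^ 1 * \<kappa> ^ 4" if "n \<ge> 4" using yb[of 4] that by simp
    have y11: "\<bar>(y 1)^2\<bar> \<le> D ^ 2 * \<kappa> ^ 2" if "n \<ge> 1"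
      using prod2[OF y1 y1] that by (simp add: power2_eq_square)
    have y111: "\<bar>(y 1)^3\<bar> \<le> D ^ 3 * \<kappa> ^ 3" if "n \<ge> 1"
      using prod2[OF y11 y1] that by (simp add: power2_eq_square power3_eq_cube)
    have y1111: "\<bar>(y 1)^4\<bar> \<le> D ^ 4 * \<kappa> ^ 4" if "n \<ge> 1"
      using prod2[OF y11 y11] that by (simp flip: power_add)
    have y12: "\<bar>y 1 * y 2\<bar> \<le> D ^ 2 * \<kappa> ^ 3" if "n \<ge> 2"
      using prod2[OF y1 y2] that by (simp add: eval_nat_numeral)
    have y13: "\<bar>y 1 * y 3\<bar> \<le> D ^ 2 * \<kappa> ^ 4" if "n \<ge> 3"
      using prod2[OF y1 y3] that by (simp add: eval_nat_numeral)
    have y22: "\<bar>(y 2)^2\<bar> \<le> D ^ 2 * \<kappa> ^ 4" if "n \<ge> 3"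
      using prod2[OF y2 y2] that by (simp add: power2_eq_square eval_nat_numeral)
    have y112: "\<bar>(y 1)^2 * y 2\<bar> \<le> D ^ 3 * \<kappa> ^ 4" if "n \<ge> 2"
      using prod2[OF y11 y2] that by (simp add: eval_nat_numeral)
    define T where "T = (P * E * D') * \<kappa> ^ n"
    have T0: "T \<ge> 0" unfolding T_def using P E0 D'0 lam by simp
    note tt = tm[folded T_def]
    \<comment> \<open>The coefficients of the fourth derivative add up to \<open>1 + 6 + 3 + 4 + 1 = 15\<close>; lower orders have fewer terms.\<close>
    consider "n = 0" | "n = 1" | "n = 2" | "n = 3" | "n = 4" using n by linarith
    then have "\<bar>pow_jet p y n\<bar> \<le> 15 * T"
    proof cases
      case 1
      have "\<bar>1 * y 0 powr (p - real 0) * 1\<bar> \<le> T" by (rule tt[of _ _ _ 0]) (use 1 P in simp_all)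
      then show ?thesis using 1 T0 by (simp add: pow_jet_def)
    next
      case 2
      have "\<bar>p * y 0 powr (p - real 1) * y 1\<bar> \<le> T" by (rule tt[of _ _ _ 1]) (use 2 P y1 in simp_all)
      then show ?thesis using 2 T0 by (simp add: pow_jet_def)
    next
      case 3
      have "\<bar>p * (p - 1) * y 0 powr (p - real 2) * (y 1)^2\<bar> \<le> T"
        by (rule tt[of _ _ _ 2]) (use 3 P y11 in simp_all)
      moreover have "\<bar>p * y 0 powr (p - real 1) * y 2\<bar> \<le> T"
        by (rule tt[of _ _ _ 1]) (use 3 P y2 in simp_all)
      ultimately show ?thesis using 3 T0 by (simp add: pow_jet_def)
    next
      case 4
      have "\<bar>p * (p - 1) * (p - 2) * y 0 powr (p - real 3) * (y 1)^3\<bar> \<le> T"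
        by (rule tt[of _ _ _ 3]) (use 4 P y111 in simp_all)
      moreover have "\<bar>p * (p - 1) * y 0 powr (p - real 2) * (y 1 * y 2)\<bar> \<le> T"
        by (rule tt[of _ _ _ 2]) (use 4 P y12 in simp_all)
      moreover have "\<bar>p * y 0 powr (p - real 1) * y 3\<bar> \<le> T"
        by (rule tt[of _ _ _ 1]) (use 4 P y3 in simp_all)
      moreover have "pow_jet p y n = p * (p - 1) * (p - 2) * y 0 powr (p - real 3) * (y 1)^3
        + 3 * (p * (p - 1) * y 0 powr (p - real 2) * (y 1 * y 2)) + p * y 0 powr (p - real 1) * y 3"
        using 4 by (simp add: pow_jet_def)
      ultimately show ?thesis using T0 by linarith
    next
      case 5
      have "\<bar>p * (p - 1) * (p - 2) * (p - 3) * y 0 powr (p - real 4) * (y 1)^4\<bar> \<le> T"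
        by (rule tt[of _ _ _ 4]) (use 5 P y1111 in simp_all)
      moreover have "\<bar>p * (p - 1) * (p - 2) * y 0 powr (p - real 3) * ((y 1)^2 * y 2)\<bar> \<le> T"
        by (rule tt[of _ _ _ 3]) (use 5 P y112 in simp_all)
      moreover have "\<bar>p * (p - 1) * y 0 powr (p - real 2) * ((y 2)^2)\<bar> \<le> T"
        by (rule tt[of _ _ _ 2]) (use 5 P y22 in simp_all)
      moreover have "\<bar>p * (p - 1) * y 0 powr (p - real 2) * (y 1 * y 3)\<bar> \<le> T"
        by (rule tt[of _ _ _ 2]) (use 5 P y13 in simp_all)
      moreover have "\<bar>p * y 0 powr (p - real 1) * y 4\<bar> \<le> T"
        by (rule tt[of _ _ _ 1]) (use 5 P y4 in simp_all)
      moreover have "pow_jet p y n = p * (p - 1) * (p - 2) * (p - 3) * y 0 powr (p - real 4) * (y 1)^4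
        + 6 * (p * (p - 1) * (p - 2) * y 0 powr (p - real 3) * ((y 1)^2 * y 2))
        + 3 * (p * (p - 1) * y 0 powr (p - real 2) * ((y 2)^2))
        + 4 * (p * (p - 1) * y 0 powr (p - real 2) * (y 1 * y 3)) + p * y 0 powr (p - real 1) * y 4"
        using 5 by (simp add: pow_jet_def algebra_simps)
      ultimately show ?thesis using T0 by linarith
    qed
    moreover have "15 * T = 15 * (P * E * D') * \<kappa> ^ n" unfolding T_def by simp
    ultimately show "\<bar>pow_jet p y n\<bar> \<le> 15 * (P * E * D') * \<kappa> ^ n" by simp
  qed
qed

text \<open>The mean of the values at \<open>1\<close> and \<open>-1\<close> has no odd terms in its expansion, so a second-order
  expansion already has an error of order four.\<close>

lemma even_pow_taylor:
  assumes l: "0 < l" and D: "D \<ge> 0"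
  obtains C where "C \<ge> 0"
    "\<And>U \<kappa>. 0 \<le> \<kappa> \<Longrightarrow>
      (\<And>k t. k \<le> 3 \<Longrightarrow> \<bar>t\<bar> \<le> 1 \<Longrightarrow> (U k has_real_derivative U (Suc k) t) (at t)) \<Longrightarrow>
      (\<And>t. \<bar>t\<bar> \<le> 1 \<Longrightarrow> l \<le> U 0 t \<and> U 0 t \<le> h) \<Longrightarrow>
      (\<And>k t. 1 \<le> k \<Longrightarrow> k \<le> 4 \<Longrightarrow> \<bar>t\<bar> \<le> 1 \<Longrightarrow> \<bar>U k t\<bar> \<le> D * \<kappa> ^ k) \<Longrightarrow>
      \<bar>(U 0 1 powr p + U 0 (- 1) powr p) / 2 - U 0 0 powr p - pow_jet p (\<lambda>k. U k 0) 2 / 2\<bar> \<le> C * \<kappa> ^ 4"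
proof -
  obtain C where C0: "C \<ge> 0" and C: "\<And>y \<kappa> n. l \<le> y 0 \<Longrightarrow> y 0 \<le> h \<Longrightarrow> 0 \<le> \<kappa> \<Longrightarrow> n \<le> 4 \<Longrightarrow>
      (\<And>k. 1 \<le> k \<Longrightarrow> k \<le> n \<Longrightarrow> \<bar>y k\<bar> \<le> D * \<kappa> ^ k) \<Longrightarrow> \<bar>pow_jet p y n\<bar> \<le> C * \<kappa> ^ n"
    using pow_jet_bound[OF assms] by metis
  show thesis
  proof (rule that[of "C / 24"])
    show "C / 24 \<ge> 0" using C0 by simp
    fix U :: "nat \<Rightarrow> real \<Rightarrow> real" and \<kappa> :: real
    assume k0: "0 \<le> \<kappa>"
      and dU: "\<And>k t. k \<le> 3 \<Longrightarrow> \<bar>t\<bar> \<le> 1 \<Longrightarrow> (U k has_real_derivative U (Suc k) t) (at t)"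
      and lh: "\<And>t. \<bar>t\<bar> \<le> 1 \<Longrightarrow> l \<le> U 0 t \<and> U 0 t \<le> h"
      and bd: "\<And>k t. 1 \<le> k \<Longrightarrow> k \<le> 4 \<Longrightarrow> \<bar>t\<bar> \<le> 1 \<Longrightarrow> \<bar>U k t\<bar> \<le> D * \<kappa> ^ k"
    let ?q = "\<lambda>n t. pow_jet p (\<lambda>k. U k t) n"
    have der: "\<forall>m t. m < 4 \<and> \<bar>t\<bar> \<le> \<bar>x\<bar> \<longrightarrow> DERIV (?q m) t :> ?q (Suc m) t" if "\<bar>x\<bar> = 1" for x :: real
    proof (intro allI impI)
      fix m :: nat and t :: real assume "m < 4 \<and> \<bar>t\<bar> \<le> \<bar>x\<bar>"
      then have "m \<le> 3" "\<bar>t\<bar> \<le> 1" using that by auto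
      then show "DERIV (?q m) t :> ?q (Suc m) t"
        using lh[of t] l by (intro DERIV_pow_jet dU) auto
    qed
    obtain t1 where t1: "\<bar>t1\<bar> \<le> 1" "?q 0 1 = (\<Sum>m<4. ?q m 0 / fact m * 1 ^ m) + ?q 4 t1 / fact 4 * 1 ^ 4"
      using Maclaurin_bi_le[OF refl der[of 1]] by auto
    obtain t2 where t2: "\<bar>t2\<bar> \<le> 1"
      "?q 0 (- 1) = (\<Sum>m<4. ?q m 0 / fact m * (- 1) ^ m) + ?q 4 t2 / fact 4 * (- 1) ^ 4"
      using Maclaurin_bi_le[OF refl der[of "-1"]] by auto
    have b: "\<bar>?q 4 t\<bar> \<le> C * \<kappa> ^ 4" if "\<bar>t\<bar> \<le> 1" for t
      using lh[OF that] bd that k0 by (intro C) auto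
    have q0: "?q 0 t = U 0 t powr p" for t by (simp add: pow_jet_def)
    have "(?q 0 1 + ?q 0 (- 1)) / 2 - ?q 0 0 - ?q 2 0 / 2 = (?q 4 t1 + ?q 4 t2) / 48"
      unfolding t1(2) t2(2) by (simp add: eval_nat_numeral fact_numeral field_simps)
    moreover have "\<bar>(?q 4 t1 + ?q 4 t2) / 48\<bar> \<le> C / 24 * \<kappa> ^ 4"
      using b[OF t1(1)] b[OF t2(1)] by (simp add: abs_le_iff)
    ultimately show "\<bar>(U 0 1 powr p + U 0 (- 1) powr p) / 2 - U 0 0 powr p - pow_jet p (\<lambda>k. U k 0) 2 / 2\<bar> \<le> C / 24 * \<kappa> ^ 4"
      unfolding q0 by (simp only:)
  qed
qed

lemma pow_taylor2:
  assumes l: "0 < l" and D: "D \<ge> 0"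
  obtains C where "C \<ge> 0"
    "\<And>U \<kappa>. 0 \<le> \<kappa> \<Longrightarrow>
      (\<And>k t. k \<le> 1 \<Longrightarrow> \<bar>t\<bar> \<le> 1 \<Longrightarrow> (U k has_real_derivative U (Suc k) t) (at t)) \<Longrightarrow>
      (\<And>t. \<bar>t\<bar> \<le> 1 \<Longrightarrow> l \<le> U 0 t \<and> U 0 t \<le> h) \<Longrightarrow>
      (\<And>k t. 1 \<le> k \<Longrightarrow> k \<le> 2 \<Longrightarrow> \<bar>t\<bar> \<le> 1 \<Longrightarrow> \<bar>U k t\<bar> \<le> D * \<kappa> ^ k) \<Longrightarrow>
      \<bar>U 0 1 powr p - U 0 0 powr p - pow_jet p (\<lambda>k. U k 0) 1\<bar> \<le> C * \<kappa> ^ 2"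
proof -
  obtain C where C0: "C \<ge> 0" and C: "\<And>y \<kappa> n. l \<le> y 0 \<Longrightarrow> y 0 \<le> h \<Longrightarrow> 0 \<le> \<kappa> \<Longrightarrow> n \<le> 4 \<Longrightarrow>
      (\<And>k. 1 \<le> k \<Longrightarrow> k \<le> n \<Longrightarrow> \<bar>y k\<bar> \<le> D * \<kappa> ^ k) \<Longrightarrow> \<bar>pow_jet p y n\<bar> \<le> C * \<kappa> ^ n"
    using pow_jet_bound[OF assms] by metis
  show thesis
  proof (rule that[of C])
    fix U :: "nat \<Rightarrow> real \<Rightarrow> real" and \<kappa> :: real
    assume k0: "0 \<le> \<kappa>"
      and dU: "\<And>k t. k \<le> 1 \<Longrightarrow> \<bar>t\<bar> \<le> 1 \<Longrightarrow> (U k has_real_derivative U (Suc k) t) (at t)"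
      and lh: "\<And>t. \<bar>t\<bar> \<le> 1 \<Longrightarrow> l \<le> U 0 t \<and> U 0 t \<le> h"
      and bd: "\<And>k t. 1 \<le> k \<Longrightarrow> k \<le> 2 \<Longrightarrow> \<bar>t\<bar> \<le> 1 \<Longrightarrow> \<bar>U k t\<bar> \<le> D * \<kappa> ^ k"
    let ?q = "\<lambda>n t. pow_jet p (\<lambda>k. U k t) n"
    have der: "\<forall>m t. m < 2 \<and> \<bar>t\<bar> \<le> \<bar>1\<bar> \<longrightarrow> DERIV (?q m) t :> ?q (Suc m) t"
    proof (intro allI impI)
      fix m :: nat and t :: real assume "m < 2 \<and> \<bar>t\<bar> \<le> \<bar>1\<bar>"
      then have "m \<le> 1" "\<bar>t\<bar> \<le> 1" by auto
      then show "DERIV (?q m) t :> ?q (Suc m) t"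
        using lh[of t] l by (intro DERIV_pow_jet dU) auto
    qed
    obtain t1 where t1: "\<bar>t1\<bar> \<le> 1" "?q 0 1 = (\<Sum>m<2. ?q m 0 / fact m * 1 ^ m) + ?q 2 t1 / fact 2 * 1 ^ 2"
      using Maclaurin_bi_le[OF refl der] by auto
    have b: "\<bar>?q 2 t1\<bar> \<le> C * \<kappa> ^ 2"
      using lh[OF t1(1)] bd t1(1) k0 by (intro C) auto
    have "?q 0 1 - ?q 0 0 - ?q 1 0 = ?q 2 t1 / 2"
      unfolding t1(2) by (simp add: eval_nat_numeral)
    moreover have "\<bar>?q 2 t1 / 2\<bar> \<le> C * \<kappa> ^ 2"
      using b by simp
    ultimately show "\<bar>U 0 1 powr p - U 0 0 powr p - ?q 1 0\<bar> \<le> C * \<kappa> ^ 2"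
      by (simp add: pow_jet_def[of _ _ 0])
  qed (rule C0)
qed

text \<open>Here \<open>b\<close> and \<open>c\<close> stand for the first and second derivative of \<open>u\<close> in one direction, and the
  path parameter \<open>t\<close> moves the base point in another direction. The expression is the second derivative of \<open>u\<^sup>p\<close> in
  the first direction, and the estimate says how far it changes when the base point is moved.\<close>

lemma pow_jet2_drift:
  assumes l: "0 < l" and D: "D \<ge> 0"
  obtains C where "C \<ge> 0"
    "\<And>u b c u' b' c' \<alpha> \<kappa>. 0 \<le> \<alpha> \<Longrightarrow> 0 \<le> \<kappa> \<Longrightarrow>
      (\<And>t. 0 \<le> t \<Longrightarrow> t \<le> 1 \<Longrightarrow> (u has_real_derivative u' t) (at t) \<and> (b has_real_derivative b' t) (at t)
         \<and> (c has_real_derivative c' t) (at t) \<and> l \<le> u t \<and> u t \<le> h \<and> \<bar>b t\<bar> \<le> D * \<kappa> \<and> \<bar>c t\<bar> \<le> D * \<kappa>^2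
         \<and> \<bar>u' t\<bar> \<le> D * \<alpha> \<and> \<bar>b' t\<bar> \<le> D * \<kappa> * \<alpha> \<and> \<bar>c' t\<bar> \<le> D * \<kappa>^2 * \<alpha>) \<Longrightarrow>
      \<bar>(p * (p - 1) * u 1 powr (p - 2) * (b 1)^2 + p * u 1 powr (p - 1) * c 1)
        - (p * (p - 1) * u 0 powr (p - 2) * (b 0)^2 + p * u 0 powr (p - 1) * c 0)\<bar> \<le> C * \<kappa>^2 * \<alpha>"
proof -
  obtain E where E0: "E \<ge> 0"
    and E: "\<And>y k. l \<le> y \<Longrightarrow> y \<le> h \<Longrightarrow> k \<le> 4 \<Longrightarrow> y powr (p - real k) \<le> E"
    using powr_uniform_bound[OF l, of h p] by metis
  define P where "P = 1 + \<bar>p\<bar> + \<bar>p * (p - 1)\<bar> + \<bar>p * (p - 1) * (p - 2)\<bar>"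
  have P: "\<bar>p\<bar> \<le> P" "\<bar>p * (p - 1)\<bar> \<le> P" "\<bar>p * (p - 1) * (p - 2)\<bar> \<le> P" "1 \<le> P"
    unfolding P_def by linarith+
  define D' where "D' = D + D^2 + D^3"
  have D': "D \<le> D'" "D * D \<le> D'" "D * D * D \<le> D'" "0 \<le> D'"
    unfolding D'_def using D by (auto simp: power2_eq_square power3_eq_cube)
  show thesis
  proof (rule that[of "5 * (P * E * D')"])
    show "5 * (P * E * D') \<ge> 0" using P E0 D' by simp
    fix u b c u' b' c' :: "real \<Rightarrow> real" and \<alpha> \<kappa> :: real
    assume a0: "0 \<le> \<alpha>" and k0: "0 \<le> \<kappa>"
      and H: "\<And>t. 0 \<le> t \<Longrightarrow> t \<le> 1 \<Longrightarrow> (u has_real_derivative u' t) (at t) \<and> (b has_real_derivative b' t) (at t)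
         \<and> (c has_real_derivative c' t) (at t) \<and> l \<le> u t \<and> u t \<le> h \<and> \<bar>b t\<bar> \<le> D * \<kappa> \<and> \<bar>c t\<bar> \<le> D * \<kappa>^2
         \<and> \<bar>u' t\<bar> \<le> D * \<alpha> \<and> \<bar>b' t\<bar> \<le> D * \<kappa> * \<alpha> \<and> \<bar>c' t\<bar> \<le> D * \<kappa>^2 * \<alpha>"
    let ?Q = "\<lambda>t. p * (p - 1) * u t powr (p - 2) * (b t)^2 + p * u t powr (p - 1) * c t"
    let ?Q' = "\<lambda>t. p * (p - 1) * (p - 2) * u t powr (p - real 3) * (u' t * (b t * b t))
       + 2 * (p * (p - 1) * u t powr (p - real 2) * (b t * b' t))
       + p * (p - 1) * u t powr (p - real 2) * (u' t * c t) + p * u t powr (p - real 1) * c' t"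
    have d: "(?Q has_real_derivative ?Q' t) (at t)" if t: "0 \<le> t" "t \<le> 1" for t
    proof -
      note h = H[OF t]
      have up: "((\<lambda>t. u t powr q) has_real_derivative q * u t powr (q - 1) * u' t) (at t)" for q
        by (rule DERIV_powr_fun) (use h l in auto)
      have mono: "((\<lambda>t. c * u t powr q * X t) has_real_derivative
          c * q * u t powr (q - 1) * u' t * X t + c * u t powr q * X') (at t)"
        if "(X has_real_derivative X') (at t)" for c q X X'
        by (rule DERIV_cong[OF DERIV_mult[OF DERIV_cmult[OF up] that]]) (simp add: algebra_simps)
      have b: "(b has_real_derivative b' t) (at t)" and c: "(c has_real_derivative c' t) (at t)"
        using h by auto
      show ?thesis
        by (rule DERIV_cong[OF DERIV_add[OF mono[OF DERIV_power[OF b]] mono[OF c]]])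
          (simp add: algebra_simps power2_eq_square)
    qed
    obtain t where t: "0 < t" "t < 1" "?Q 1 - ?Q 0 = (1 - 0) * ?Q' t"
      using MVT2[of 0 1 ?Q ?Q'] d by auto
    have t3: "?Q 1 - ?Q 0 = ?Q' t" using t(3) by simp
    note h = H[OF less_imp_le[OF t(1)] less_imp_le[OF t(2)]]
    define T where "T = (P * E * D') * (\<kappa>^2 * \<alpha>)"
    have tm: "\<bar>e * u t powr (p - real k) * m\<bar> \<le> T"
      if "\<bar>e\<bar> \<le> P" "k \<le> 4" "\<bar>m\<bar> \<le> X * (\<kappa>^2 * \<alpha>)" "X \<le> D'" for e k m X
    proof -
      have "\<bar>m\<bar> \<le> D' * (\<kappa>^2 * \<alpha>)"
        using that(3) mult_right_mono[OF that(4), of "\<kappa>^2 * \<alpha>"] a0 by (auto intro: order_trans)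
      then have "\<bar>e\<bar> * u t powr (p - real k) * \<bar>m\<bar> \<le> P * E * (D' * (\<kappa>^2 * \<alpha>))"
        using that(1) E[OF _ _ that(2)] P(4) E0 h by (intro mult_mono) auto
      then show ?thesis by (simp add: abs_mult mult.assoc T_def)
    qed
    have pr: "\<bar>x * y\<bar> \<le> X * Y" if "\<bar>x\<bar> \<le> X" "\<bar>y\<bar> \<le> Y" for x y X Y :: real
      unfolding abs_mult using that by (intro mult_mono) auto
    have "\<bar>p * (p - 1) * (p - 2) * u t powr (p - real 3) * (u' t * (b t * b t))\<bar> \<le> T"
      using pr[of "u' t" "D * \<alpha>", OF _ pr[of "b t" "D * \<kappa>" "b t" "D * \<kappa>"]] h P D'
      by (intro tm[of _ _ _ "D * D * D"]) (auto simp: algebra_simps power2_eq_square)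
    moreover have "\<bar>p * (p - 1) * u t powr (p - real 2) * (b t * b' t)\<bar> \<le> T"
      using pr[of "b t" "D * \<kappa>" "b' t" "D * \<kappa> * \<alpha>"] h P D'
      by (intro tm[of _ _ _ "D * D"]) (auto simp: algebra_simps power2_eq_square)
    moreover have "\<bar>p * (p - 1) * u t powr (p - real 2) * (u' t * c t)\<bar> \<le> T"
      using pr[of "u' t" "D * \<alpha>" "c t" "D * \<kappa>^2"] h P D'
      by (intro tm[of _ _ _ "D * D"]) (auto simp: algebra_simps power2_eq_square)
    moreover have "\<bar>p * u t powr (p - real 1) * c' t\<bar> \<le> T"
      using h P D'
      by (intro tm[of _ _ _ "D"]) (auto simp: algebra_simps power2_eq_square)
    ultimately have "\<bar>?Q 1 - ?Q 0\<bar> \<le> 5 * T"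
      unfolding t3 by linarith
    then show "\<bar>?Q 1 - ?Q 0\<bar> \<le> 5 * (P * E * D') * \<kappa>^2 * \<alpha>" unfolding T_def by (simp add: algebra_simps)
  qed
qed

section \<open>Directional derivatives of functions of class C^k\<close>

text \<open>For differentiable \<open>h\<close>, the derivative in the direction \<open>v\<close>, as an operator that can be iterated with
  different directions; \<open>foldr DD vs h\<close> is a mixed directional derivative.\<close>

definition DD :: "real ^ 'd \<Rightarrow> (real ^ 'd \<Rightarrow> real) \<Rightarrow> real ^ 'd \<Rightarrow> real" where
  "DD v h x = (\<Sum>i\<in>UNIV. v $ i * partial i h x)"

lemma partial_eq_derivative:
  assumes "(h has_derivative D) (at x)"
  shows "partial i h x = D (axis i 1)"
proof -
  have lin: "linear D" using assms by (rule has_derivative_linear)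
  have "((\<lambda>t::real. x + t *\<^sub>R axis i 1) has_derivative (\<lambda>t. t *\<^sub>R axis i 1)) (at 0)"
    by (auto intro!: derivative_eq_intros)
  then have "((\<lambda>t::real. h (x + t *\<^sub>R axis i 1)) has_derivative (\<lambda>t. D (t *\<^sub>R axis i 1))) (at 0)"
    by (rule has_derivative_compose) (use assms in simp)
  then have "((\<lambda>t::real. h (x + t *\<^sub>R axis i 1)) has_real_derivative D (axis i 1)) (at 0)"
    by (simp add: has_field_derivative_def linear_scale[OF lin] mult_commute_abs mult.commute)
  then show ?thesis unfolding partial_def by (rule DERIV_imp_deriv)
qed

lemma DD_eq_derivative:
  assumes "(h has_derivative D) (at x)"
  shows "DD v h x = D v"
proof -
  have lin: "linear D" using assms by (rule has_derivative_linear)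
  have "D v = D (\<Sum>i\<in>UNIV. v $ i *\<^sub>R axis i 1)"
    by (simp add: basis_expansion flip: scalar_mult_eq_scaleR)
  also have "\<dots> = DD v h x"
    by (simp add: DD_def partial_eq_derivative[OF assms] linear_sum[OF lin] linear_scale[OF lin])
  finally show ?thesis by simp
qed

lemma partial_eq_DD: "partial i h = DD (axis i 1) h"
  by (rule ext) (simp add: DD_def axis_def if_distrib[of "\<lambda>a. a * _"] cong: if_cong)

lemma DERIV_along_line:
  assumes "h differentiable (at (x + t *\<^sub>R v))"
  shows "((\<lambda>t. h (x + t *\<^sub>R v)) has_real_derivative DD v h (x + t *\<^sub>R v)) (at t)"
proof -
  obtain D where D: "(h has_derivative D) (at (x + t *\<^sub>R v))"
    using assms by (auto simp: differentiable_def)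
  have lin: "linear D" using D by (rule has_derivative_linear)
  have "((\<lambda>t::real. x + t *\<^sub>R v) has_derivative (\<lambda>t. t *\<^sub>R v)) (at t)"
    by (auto intro!: derivative_eq_intros)
  then have "((\<lambda>t::real. h (x + t *\<^sub>R v)) has_derivative (\<lambda>t. D (t *\<^sub>R v))) (at t)"
    by (rule has_derivative_compose[where f = "\<lambda>t. x + t *\<^sub>R v" and g = h and g' = D, OF _ D])
  then show ?thesis
    by (simp add: has_field_derivative_def linear_scale[OF lin] DD_eq_derivative[OF D] mult_commute_abs mult.commute)
qed

lemma Ck_Suc_imp_Ck: "Ck (Suc n) h \<Longrightarrow> Ck n h"
proof (induction n arbitrary: h)
  case 0
  then show ?case
    by (auto intro!: differentiable_imp_continuous_on simp: differentiable_on_def)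
qed auto

lemma Ck_mono: "m \<le> n \<Longrightarrow> Ck n h \<Longrightarrow> Ck m h"
  by (induction n rule: dec_induct) (auto dest: Ck_Suc_imp_Ck simp del: Ck.simps)

lemma Ck_differentiable: "Ck n h \<Longrightarrow> 0 < n \<Longrightarrow> h differentiable (at x)"
  by (cases n) auto

lemma Ck_continuous: "Ck n h \<Longrightarrow> continuous_on UNIV h"
  using Ck_mono[of 0 n h] by simp

lemma partial_lincomb:
  assumes "finite I" "\<And>j. j \<in> I \<Longrightarrow> h j differentiable (at x)"
  shows "partial i (\<lambda>x. \<Sum>j\<in>I. c j * h j x) x = (\<Sum>j\<in>I. c j * partial i (h j) x)"
proof -
  obtain D where D: "\<And>j. j \<in> I \<Longrightarrow> (h j has_derivative D j) (at x)"
    using assms(2) unfolding differentiable_def by metis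
  have "((\<lambda>x. \<Sum>j\<in>I. c j * h j x) has_derivative (\<lambda>v. \<Sum>j\<in>I. c j * D j v)) (at x)"
    by (intro has_derivative_sum has_derivative_mult_right D)
  from partial_eq_derivative[OF this] show ?thesis
    using partial_eq_derivative[OF D] by simp
qed

lemma Ck_lincomb:
  assumes "finite I" "\<And>j. j \<in> I \<Longrightarrow> Ck n (h j)"
  shows "Ck n (\<lambda>x. \<Sum>j\<in>I. c j * h j x)"
  using assms(2)
proof (induction n arbitrary: h)
  case 0
  then show ?case by (auto intro!: continuous_intros)
next
  case (Suc n)
  have eq: "partial i (\<lambda>x. \<Sum>j\<in>I. c j * h j x) = (\<lambda>x. \<Sum>j\<in>I. c j * partial i (h j) x)" for i
    by (rule ext, rule partial_lincomb[OF assms(1)]) (use Suc.prems in auto)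
  show ?case
    using Suc.prems Suc.IH[of "\<lambda>j. partial i (h j)" for i] assms(1) by (auto simp: eq intro!: derivative_intros)
qed

lemma DD_lincomb:
  assumes "finite I" "\<And>j x. j \<in> I \<Longrightarrow> h j differentiable (at x)"
  shows "DD v (\<lambda>x. \<Sum>j\<in>I. c j * h j x) = (\<lambda>x. \<Sum>j\<in>I. c j * DD v (h j) x)"
proof
  fix x
  have "DD v (\<lambda>x. \<Sum>j\<in>I. c j * h j x) x = (\<Sum>i\<in>UNIV. \<Sum>j\<in>I. c j * (v $ i * partial i (h j) x))"
    by (simp add: DD_def partial_lincomb[OF assms] sum_distrib_left mult.left_commute)
  also have "\<dots> = (\<Sum>j\<in>I. c j * DD v (h j) x)"
    by (subst sum.swap) (simp add: DD_def sum_distrib_left)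
  finally show "DD v (\<lambda>x. \<Sum>j\<in>I. c j * h j x) x = (\<Sum>j\<in>I. c j * DD v (h j) x)" .
qed

lemma Ck_DD: "Ck (Suc n) h \<Longrightarrow> Ck n (DD v h)"
  unfolding DD_def[abs_def] by (rule Ck_lincomb) auto

lemma Ck_foldr_DD: "Ck (length vs + n) h \<Longrightarrow> Ck n (foldr DD vs h)"
  by (induction vs arbitrary: n) (auto intro!: Ck_DD simp del: Ck.simps)

lemma Ck_foldr_partial: "Ck (length is + n) h \<Longrightarrow> Ck n (foldr partial is h)"
proof (induction "is" arbitrary: n)
  case (Cons i "is")
  then show ?case using Cons.IH[of "Suc n"] by auto
qed simp

lemma foldr_DD_lincomb:
  assumes "finite I" "\<And>j. j \<in> I \<Longrightarrow> Ck (length vs) (h j)"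
  shows "foldr DD vs (\<lambda>x. \<Sum>j\<in>I. c j * h j x) = (\<lambda>x. \<Sum>j\<in>I. c j * foldr DD vs (h j) x)"
  using assms(2)
proof (induction vs)
  case (Cons v vs)
  have "foldr DD vs (h j) differentiable (at x)" if "j \<in> I" for j x
    using Ck_foldr_DD[of vs 1 "h j"] Cons.prems[OF that] by (auto simp: add.commute)
  moreover have "foldr DD vs (\<lambda>x. \<Sum>j\<in>I. c j * h j x) = (\<lambda>x. \<Sum>j\<in>I. c j * foldr DD vs (h j) x)"
    by (rule Cons.IH) (use Cons.prems in \<open>auto intro: Ck_Suc_imp_Ck\<close>)
  ultimately show ?case by (simp add: DD_lincomb[OF assms(1)])
qed simp

text \<open>Two applications of the mean value theorem, first to the increment in the direction \<open>v\<close>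
  and then to that in the direction \<open>w\<close>. The left-hand side is symmetric in \<open>v\<close> and \<open>w\<close>.\<close>

lemma mixed_difference:
  assumes "Ck 2 h" "0 < s"
  obtains t1 t2 where "0 < t1" "t1 < s" "0 < t2" "t2 < s"
    "h (x + s *\<^sub>R v + s *\<^sub>R w) - h (x + s *\<^sub>R v) - h (x + s *\<^sub>R w) + h x
      = s\<^sup>2 * DD w (DD v h) (x + t1 *\<^sub>R v + t2 *\<^sub>R w)"
proof -
  have dh: "h differentiable (at y)" for y using assms(1) by (auto simp: numeral_2_eq_2)
  have dh1: "DD v h differentiable (at y)" for y
    using Ck_DD[of 1 h v] assms(1) by (auto simp: numeral_2_eq_2)
  let ?\<phi> = "\<lambda>t. h ((x + s *\<^sub>R w) + t *\<^sub>R v) - h (x + t *\<^sub>R v)"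
  have "\<exists>t1>0. t1 < s \<and>
    ?\<phi> s - ?\<phi> 0 = (s - 0) * (DD v h ((x + s *\<^sub>R w) + t1 *\<^sub>R v) - DD v h (x + t1 *\<^sub>R v))"
    by (rule MVT2[OF assms(2)]) (intro DERIV_diff DERIV_along_line dh)
  then obtain t1 where t1: "0 < t1" "t1 < s"
    "?\<phi> s - ?\<phi> 0 = (s - 0) * (DD v h ((x + s *\<^sub>R w) + t1 *\<^sub>R v) - DD v h (x + t1 *\<^sub>R v))" by blast
  let ?\<psi> = "\<lambda>t. DD v h ((x + t1 *\<^sub>R v) + t *\<^sub>R w)"
  have "\<exists>t2>0. t2 < s \<and>
    ?\<psi> s - ?\<psi> 0 = (s - 0) * DD w (DD v h) ((x + t1 *\<^sub>R v) + t2 *\<^sub>R w)"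
    by (rule MVT2[OF assms(2)]) (intro DERIV_along_line dh1)
  then obtain t2 where t2: "0 < t2" "t2 < s"
    "?\<psi> s - ?\<psi> 0 = (s - 0) * DD w (DD v h) ((x + t1 *\<^sub>R v) + t2 *\<^sub>R w)" by blast
  have "?\<phi> s - ?\<phi> 0 = s * (?\<psi> s - ?\<psi> 0)"
    using t1(3) by (simp add: add.commute add.left_commute)
  then have "h (x + s *\<^sub>R v + s *\<^sub>R w) - h (x + s *\<^sub>R v) - h (x + s *\<^sub>R w) + h x
      = s\<^sup>2 * DD w (DD v h) (x + t1 *\<^sub>R v + t2 *\<^sub>R w)"
    unfolding t2(3) by (simp add: power2_eq_square algebra_simps)
  then show thesis using that t1 t2 by blast
qed

text \<open>Clairaut's theorem: by the symmetry of the second difference, both mixed derivatives are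
  the limit of the same difference quotient.\<close>

lemma DD_commute:
  assumes "Ck 2 h"
  shows "DD v (DD w h) = DD w (DD v h)"
proof
  fix x
  have cont: "isCont (DD b (DD a h)) x" for a b
  proof -
    have "Ck 0 (DD b (DD a h))"
      using assms by (auto intro!: Ck_DD simp: numeral_2_eq_2 simp del: Ck.simps)
    then show ?thesis by (simp add: continuous_on_eq_continuous_at)
  qed
  have lim: "(\<lambda>n. DD b (DD a h) (y n)) \<longlonglongrightarrow> DD b (DD a h) x"
    if y: "\<And>n. \<exists>t1 t2. 0 < t1 \<and> t1 < 1 / real (Suc n) \<and> 0 < t2 \<and> t2 < 1 / real (Suc n) \<and> y n = x + t1 *\<^sub>R a + t2 *\<^sub>R b"
    for a b y
  proof (rule isCont_tendsto_compose[OF cont])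
    have "norm (y n - x) \<le> (norm a + norm b) * (1 / real (Suc n))" for n
    proof -
      obtain t1 t2 where t: "0 < t1" "t1 < 1 / real (Suc n)" "0 < t2" "t2 < 1 / real (Suc n)"
        "y n = x + t1 *\<^sub>R a + t2 *\<^sub>R b" using y by blast
      have "norm (y n - x) \<le> t1 * norm a + t2 * norm b"
        using norm_triangle_ineq[of "t1 *\<^sub>R a" "t2 *\<^sub>R b"] t by simp
      also have "\<dots> \<le> (1 / real (Suc n)) * norm a + (1 / real (Suc n)) * norm b"
        using t by (intro add_mono mult_right_mono) auto
      finally show ?thesis by (simp add: add_divide_distrib)
    qed
    moreover have "(\<lambda>n. (norm a + norm b) * (1 / real (Suc n))) \<longlonglongrightarrow> 0"
      using tendsto_mult_right_zero[OF LIMSEQ_inverse_real_of_nat] by (simp add: inverse_eq_divide)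
    ultimately have "(\<lambda>n. y n - x) \<longlonglongrightarrow> 0"
      by (intro Lim_null_comparison[of "\<lambda>n. y n - x"]) auto
    then show "y \<longlonglongrightarrow> x" by (simp add: LIM_zero_iff)
  qed
  let ?\<Delta> = "\<lambda>n a b. (h (x + (1 / real (Suc n)) *\<^sub>R a + (1 / real (Suc n)) *\<^sub>R b) - h (x + (1 / real (Suc n)) *\<^sub>R a)
    - h (x + (1 / real (Suc n)) *\<^sub>R b) + h x) / (1 / real (Suc n))\<^sup>2"
  have diff_lim: "(\<lambda>n. ?\<Delta> n a b) \<longlonglongrightarrow> DD b (DD a h) x" for a b
  proof -
    have "\<exists>z t1 t2. 0 < t1 \<and> t1 < 1 / real (Suc n) \<and> 0 < t2 \<and> t2 < 1 / real (Suc n)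
       \<and> z = x + t1 *\<^sub>R a + t2 *\<^sub>R b \<and> ?\<Delta> n a b = DD b (DD a h) z" for n
    proof -
      obtain t1 t2 where "0 < t1" "t1 < 1 / real (Suc n)" "0 < t2" "t2 < 1 / real (Suc n)"
        "h (x + (1 / real (Suc n)) *\<^sub>R a + (1 / real (Suc n)) *\<^sub>R b) - h (x + (1 / real (Suc n)) *\<^sub>R a)
          - h (x + (1 / real (Suc n)) *\<^sub>R b) + h x = (1 / real (Suc n))\<^sup>2 * DD b (DD a h) (x + t1 *\<^sub>R a + t2 *\<^sub>R b)"
        by (rule mixed_difference[OF assms, of "1 / real (Suc n)" x a b]) auto
      then show ?thesis by (intro exI[of _ "x + t1 *\<^sub>R a + t2 *\<^sub>R b"] exI[of _ t1] exI[of _ t2]) simp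
    qed
    then obtain z where z: "\<And>n. \<exists>t1 t2. 0 < t1 \<and> t1 < 1 / real (Suc n) \<and> 0 < t2 \<and> t2 < 1 / real (Suc n)
       \<and> z n = x + t1 *\<^sub>R a + t2 *\<^sub>R b \<and> ?\<Delta> n a b = DD b (DD a h) (z n)" by metis
    have "(\<lambda>n. DD b (DD a h) (z n)) \<longlonglongrightarrow> DD b (DD a h) x"
      by (rule lim) (use z in blast)
    moreover have "(\<lambda>n. DD b (DD a h) (z n)) = (\<lambda>n. ?\<Delta> n a b)" using z by metis
    ultimately show ?thesis by metis
  qed
  have "(\<lambda>n. ?\<Delta> n v w) = (\<lambda>n. ?\<Delta> n w v)" by (simp add: algebra_simps)
  then show "DD v (DD w h) x = DD w (DD v h) x"
    using LIMSEQ_unique[OF diff_lim[of v w]] diff_lim[of w v] by simp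
qed

lemma partial_commute: "Ck 2 h \<Longrightarrow> partial i (partial j h) = partial j (partial i h)"
  unfolding partial_eq_DD by (rule DD_commute)

lemma foldr_partial_middle:
  "Ck (length js1 + length js2 + 1) h \<Longrightarrow>
    foldr partial (js1 @ i # js2) h = partial i (foldr partial (js1 @ js2) h)"
proof (induction js1)
  case (Cons j js1)
  have "Ck 2 (foldr partial (js1 @ js2) h)"
    by (rule Ck_foldr_partial) (use Cons.prems in \<open>simp del: Ck.simps\<close>)
  moreover have "foldr partial (js1 @ i # js2) h = partial i (foldr partial (js1 @ js2) h)"
    by (rule Cons.IH) (use Cons.prems in \<open>auto intro: Ck_Suc_imp_Ck simp del: Ck.simps\<close>)
  ultimately show ?case using partial_commute by auto
qed simp

lemma foldr_partial_perm:
  "mset is = mset js \<Longrightarrow> Ck (length is) h \<Longrightarrow> foldr partial is h = foldr partial js h"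
proof (induction "is" arbitrary: js)
  case (Cons i "is")
  obtain js1 js2 where js: "js = js1 @ i # js2"
    using Cons.prems(1) by (metis list.set_intros(1) set_mset_mset split_list)
  have m: "mset is = mset (js1 @ js2)" using Cons.prems(1) js by simp
  have "length is = length js1 + length js2" using mset_eq_length[OF m] by simp
  moreover have "Ck (length is) h" using Cons.prems(2) by (simp add: Ck_Suc_imp_Ck del: Ck.simps)
  ultimately show ?case
    using Cons.IH[OF m] Cons.prems(2) foldr_partial_middle[of js1 js2 h i] js
    by (auto intro: Ck_Suc_imp_Ck simp del: Ck.simps)
qed simp

text \<open>The order of differentiation behind a multiindex is an arbitrary choice, so the
  interchange of partial derivatives is needed to compare it with any given order.\<close>

lemma foldr_partial_eq_multi_partial:
  assumes "Ck (length is) h"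
  shows "foldr partial is h = multi_partial (count_list is) h"
proof -
  define js where "js = (SOME js. \<forall>i. count_list js i = count_list is i)"
  have "\<forall>i. count_list js i = count_list is i"
    unfolding js_def by (rule someI[of _ "is"]) simp
  then have "mset is = mset js" by (intro multiset_eqI) (simp add: count_mset)
  then show ?thesis
    unfolding multi_partial_def js_def[symmetric] by (rule foldr_partial_perm[OF _ assms])
qed

lemma finite_multiindices: "finite {\<alpha> :: 'd::finite \<Rightarrow> nat. (\<Sum>i\<in>UNIV. \<alpha> i) = n}"
proof (rule finite_subset)
  show "{\<alpha> :: 'd \<Rightarrow> nat. (\<Sum>i\<in>UNIV. \<alpha> i) = n} \<subseteq> (\<Pi>\<^sub>E i\<in>UNIV. {..n})"
    by (auto simp: PiE_UNIV_domain intro: member_le_sum)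
qed (auto intro: finite_PiE)

lemma foldr_partial_le_norm_D:
  assumes "Ck (length is) h"
  shows "\<bar>foldr partial is h x\<bar> \<le> norm_D (length is) h x"
proof -
  have s: "(\<Sum>i\<in>UNIV. count_list is i) = length is"
    using sum_count_set[of "is" UNIV] by simp
  have "\<bar>multi_partial (count_list is) h x\<bar>\<^sup>2 \<le> (\<Sum>\<alpha> | (\<Sum>i\<in>UNIV. \<alpha> i) = length is. \<bar>multi_partial \<alpha> h x\<bar>\<^sup>2)"
    by (rule member_le_sum) (use s in \<open>auto intro: finite_multiindices\<close>)
  then have "\<bar>multi_partial (count_list is) h x\<bar> \<le> norm_D (length is) h x"
    unfolding norm_D_def by (rule real_le_rsqrt)
  then show ?thesis by (simp add: foldr_partial_eq_multi_partial[OF assms])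
qed

lemma foldr_DD_bound:
  assumes "Ck (length vs) h" "\<And>is. length is = length vs \<Longrightarrow> \<bar>foldr partial is h x\<bar> \<le> A"
  shows "\<bar>foldr DD vs h x\<bar> \<le> prod_list (map (\<lambda>v. \<Sum>i\<in>UNIV. \<bar>v $ i\<bar>) vs) * A"
  using assms
proof (induction vs arbitrary: h rule: rev_induct)
  case Nil then show ?case using Nil(2)[of "[]"] by simp
next
  case (snoc v vs)
  let ?P = "prod_list (map (\<lambda>v. \<Sum>i\<in>UNIV. \<bar>v $ i\<bar>) vs)"
  have C: "Ck (length vs) (partial i h)" for i using snoc.prems(1) by auto
  have "foldr DD (vs @ [v]) h x = foldr DD vs (\<lambda>x. \<Sum>i\<in>UNIV. v $ i * partial i h x) x"
    by (simp add: DD_def[abs_def])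
  also have "\<dots> = (\<Sum>i\<in>UNIV. v $ i * foldr DD vs (partial i h) x)"
    by (subst foldr_DD_lincomb) (use C in auto)
  finally have "\<bar>foldr DD (vs @ [v]) h x\<bar> \<le> (\<Sum>i\<in>UNIV. \<bar>v $ i * foldr DD vs (partial i h) x\<bar>)"
    by simp
  also have "\<dots> \<le> (\<Sum>i\<in>UNIV. \<bar>v $ i\<bar> * (?P * A))"
  proof (rule sum_mono)
    fix i
    have "\<bar>foldr DD vs (partial i h) x\<bar> \<le> ?P * A"
    proof (rule snoc.IH[OF C])
      fix "is" :: "'a list" assume "length is = length vs"
      then show "\<bar>foldr partial is (partial i h) x\<bar> \<le> A"
        using snoc.prems(2)[of "is @ [i]"] by simp
    qed
    then show "\<bar>v $ i * foldr DD vs (partial i h) x\<bar> \<le> \<bar>v $ i\<bar> * (?P * A)"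
      by (simp add: abs_mult mult_left_mono)
  qed
  also have "\<dots> = prod_list (map (\<lambda>v. \<Sum>i\<in>UNIV. \<bar>v $ i\<bar>) (vs @ [v])) * A"
    by (subst sum_distrib_right[symmetric]) (simp add: mult_ac)
  finally show ?case .
qed

lemma prod_list_l1_le:
  fixes vs :: "(real ^ 'd) list"
  shows "0 \<le> prod_list (map (\<lambda>v. \<Sum>i\<in>UNIV. \<bar>v $ i\<bar>) vs)"
   "prod_list (map (\<lambda>v. \<Sum>i\<in>UNIV. \<bar>v $ i\<bar>) vs) \<le> real CARD('d) ^ length vs * prod_list (map norm vs)"
proof (induction vs)
  case (Cons v vs)
  {
    case 1 show ?case using Cons(1) by (simp add: sum_nonneg)
  next
    case 2
    have "(\<Sum>i\<in>UNIV. \<bar>v $ i\<bar>) \<le> (\<Sum>i\<in>(UNIV::'d set). norm v)"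
      by (intro sum_mono component_le_norm_cart)
    then have "(\<Sum>i\<in>UNIV. \<bar>v $ i\<bar>) * prod_list (map (\<lambda>v. \<Sum>i\<in>UNIV. \<bar>v $ i\<bar>) vs)
       \<le> (real CARD('d) * norm v) * (real CARD('d) ^ length vs * prod_list (map norm vs))"
      using Cons by (intro mult_mono) auto
    then show ?case by (simp add: mult_ac)
  }
qed auto

text \<open>The bounds that define the class concern partial derivatives along the coordinate axes. By
  multilinearity they extend to arbitrary directions, with the factor \<open>CARD('d) ^ p\<close> from comparing
  the \<open>\<ell>\<^sup>1\<close> norm with the Euclidean norm.\<close>

lemma lyapunov_DD_bound:
  fixes V :: "real ^ 'd \<Rightarrow> real"
  assumes "V \<in> lyapunov_class p \<delta>"
  obtains c where "c > 0" "\<And>vs x. 1 \<le> length vs \<Longrightarrow> length vs \<le> p \<Longrightarrow>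
    \<bar>foldr DD vs V x\<bar> \<le> c * prod_list (map norm vs) * rpow (V x) (1 - real (length vs) * \<delta>)"
proof -
  obtain c where c: "c > 0" and b: "\<And>n x. n \<in> {1..p} \<Longrightarrow> norm_D n V x \<le> c * rpow (V x) (1 - real n * \<delta>)"
    and Ck: "Ck p V"
    using assms unfolding lyapunov_class_def by auto
  define N where "N = real CARD('d)"
  have N: "N \<ge> 1" unfolding N_def by (simp add: Suc_leI)
  show thesis
  proof (rule that[of "N ^ p * c"])
    show "N ^ p * c > 0" using N c by simp
    fix vs :: "(real ^ 'd) list" and x
    assume l: "1 \<le> length vs" "length vs \<le> p"
    let ?r = "rpow (V x) (1 - real (length vs) * \<delta>)"
    have r: "?r \<ge> 0" by (simp add: rpow_def)
    have Ckl: "Ck (length vs) V" using Ck_mono[OF l(2) Ck] .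
    have "\<bar>foldr DD vs V x\<bar> \<le> prod_list (map (\<lambda>v. \<Sum>i\<in>UNIV. \<bar>v $ i\<bar>) vs) * (c * ?r)"
    proof (rule foldr_DD_bound[OF Ckl])
      fix "is" :: "'d list" assume e: "length is = length vs"
      have "\<bar>foldr partial is V x\<bar> \<le> norm_D (length is) V x"
        by (rule foldr_partial_le_norm_D) (use Ckl e in simp)
      also have "\<dots> \<le> c * ?r" unfolding e by (rule b) (use l in auto)
      finally show "\<bar>foldr partial is V x\<bar> \<le> c * ?r" .
    qed
    also have "\<dots> \<le> (N ^ length vs * prod_list (map norm vs)) * (c * ?r)"
      using prod_list_l1_le(2)[of vs] c r unfolding N_def by (intro mult_right_mono) auto
    also have "\<dots> \<le> (N ^ p * prod_list (map norm vs)) * (c * ?r)"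
      using N l c r by (intro mult_right_mono power_increasing prod_list_nonneg) auto
    finally show "\<bar>foldr DD vs V x\<bar> \<le> N ^ p * c * prod_list (map norm vs) * ?r"
      by (simp add: mult_ac)
  qed
qed

section \<open>Local expansion of powers of a Lyapunov function\<close>

text \<open>Where \<open>V\<close> is positive, \<open>D1pow V \<rho> x v\<close> and \<open>D2pow V \<rho> x v\<close> are the first and second derivative of \<open>V\<^sup>\<rho>\<close> at \<open>x\<close> in the
  direction \<open>v\<close>.\<close>

definition D1pow :: "(real ^ 'd \<Rightarrow> real) \<Rightarrow> real \<Rightarrow> real ^ 'd \<Rightarrow> real ^ 'd \<Rightarrow> real" where
  "D1pow V \<rho> x v = \<rho> * V x powr (\<rho> - 1) * DD v V x"

definition D2pow :: "(real ^ 'd \<Rightarrow> real) \<Rightarrow> real \<Rightarrow> real ^ 'd \<Rightarrow> real ^ 'd \<Rightarrow> real" where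
  "D2pow V \<rho> x v = \<rho> * (\<rho> - 1) * V x powr (\<rho> - 2) * (DD v V x)\<^sup>2 + \<rho> * V x powr (\<rho> - 1) * DD v (DD v V) x"

text \<open>All estimates below are made for \<open>V / v0\<close> with \<open>v0\<close> the value of \<open>V\<close> at the current state;
  the two scaling rules carry them back to \<open>V\<close>.\<close>

lemma D1pow_scaled:
  assumes "V x > 0" "v0 > 0"
  shows "D1pow V \<rho> x v = v0 powr \<rho> * (\<rho> * (V x / v0) powr (\<rho> - 1) * (DD v V x / v0))"
proof -
  have "v0 powr \<rho> = v0 powr (\<rho> - 1) * v0" using assms by (simp add: powr_diff)
  then show ?thesis using assms by (simp add: D1pow_def powr_divide)
qed

lemma D2pow_scaled:
  assumes "V x > 0" "v0 > 0"
  shows "D2pow V \<rho> x v = v0 powr \<rho> * (\<rho> * (\<rho> - 1) * (V x / v0) powr (\<rho> - 2) * (DD v V x / v0)\<^sup>2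
    + \<rho> * (V x / v0) powr (\<rho> - 1) * (DD v (DD v V) x / v0))"
proof -
  have 1: "v0 powr \<rho> = v0 powr (\<rho> - 1) * v0" using assms by (simp add: powr_diff)
  have 2: "v0 powr \<rho> = v0 powr (\<rho> - 2) * v0\<^sup>2" using assms by (simp add: powr_diff powr_numeral)
  have "\<rho> * (\<rho> - 1) * V x powr (\<rho> - 2) * (DD v V x)\<^sup>2
      = v0 powr \<rho> * (\<rho> * (\<rho> - 1) * (V x / v0) powr (\<rho> - 2) * (DD v V x / v0)\<^sup>2)"
    unfolding 2 using assms by (simp add: powr_divide power_divide)
  moreover have "\<rho> * V x powr (\<rho> - 1) * DD v (DD v V) x
      = v0 powr \<rho> * (\<rho> * (V x / v0) powr (\<rho> - 1) * (DD v (DD v V) x / v0))"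
    unfolding 1 using assms by (simp add: powr_divide)
  ultimately show ?thesis by (simp only: D2pow_def distrib_left)
qed

text \<open>The properties of \<open>V\<close> that the expansion uses, with the derivative bounds in directional form.\<close>

locale lyapunov_bound =
  fixes V :: "real ^ 'd \<Rightarrow> real" and \<delta> c :: real
  assumes \<delta>_pos: "0 < \<delta>" and \<delta>_le: "\<delta> \<le> 1 / 4" and c_pos: "0 < c"
    and V_nonneg: "\<And>x. 0 \<le> V x" and V_zero: "\<And>x. V x = 0 \<longleftrightarrow> x = 0"
    and V_Ck: "Ck 4 V"
    and V_DD: "\<And>vs x. 1 \<le> length vs \<Longrightarrow> length vs \<le> 4 \<Longrightarrow>
      \<bar>foldr DD vs V x\<bar> \<le> c * prod_list (map norm vs) * rpow (V x) (1 - real (length vs) * \<delta>)"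
begin

definition "L = c * \<delta>"

lemma L_pos: "L > 0" unfolding L_def using c_pos \<delta>_pos by simp

lemma V_differentiable: "V differentiable (at x)"
  using Ck_differentiable[OF V_Ck] by simp

lemma foldr_DD_differentiable: "length vs \<le> 3 \<Longrightarrow> foldr DD vs V differentiable (at x)"
  using Ck_foldr_DD[of vs 1 V] Ck_mono[OF _ V_Ck, of "length vs + 1"] by simp

lemma V_pos: "x \<noteq> 0 \<Longrightarrow> V x > 0"
  using V_nonneg[of x] V_zero[of x] by linarith

text \<open>Adding \<open>e\<close> removes the singularity of \<open>V\<^sup>\<delta>\<close> at the origin, through which the segment
  from \<open>x\<close> to \<open>y\<close> may pass. The factors \<open>V\<^sup>\<delta>\<^sup>-\<^sup>1\<close> and \<open>V\<^sup>1\<^sup>-\<^sup>\<delta>\<close> then cancel, uniformly in \<open>e\<close>.\<close>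

lemma powr_regularized_lipschitz:
  assumes "0 < e"
  shows "\<bar>(V y + e) powr \<delta> - (V x + e) powr \<delta>\<bar> \<le> L * norm (y - x)"
proof -
  let ?v = "y - x"
  let ?u = "\<lambda>t. V (x + t *\<^sub>R ?v) + e"
  let ?u' = "\<lambda>t. \<delta> * ?u t powr (\<delta> - 1) * DD ?v V (x + t *\<^sub>R ?v)"
  have d: "((\<lambda>t. ?u t powr \<delta>) has_real_derivative ?u' t) (at t)" for t
  proof (rule DERIV_powr_fun)
    show "(?u has_real_derivative DD ?v V (x + t *\<^sub>R ?v)) (at t)"
      using DERIV_add[OF DERIV_along_line[OF V_differentiable] DERIV_const[of e]] by simp
    show "?u t > 0" using V_nonneg[of "x + t *\<^sub>R ?v"] assms by linarith
  qed
  obtain t where t: "?u 1 powr \<delta> - ?u 0 powr \<delta> = (1 - 0) * ?u' t"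
    using MVT2[of 0 1 "\<lambda>t. ?u t powr \<delta>" ?u'] d by auto
  have "\<bar>?u' t\<bar> \<le> L * norm ?v"
  proof -
    let ?z = "x + t *\<^sub>R ?v"
    have "\<bar>DD ?v V ?z\<bar> \<le> c * norm ?v * V ?z powr (1 - \<delta>)"
      using V_DD[of "[?v]" ?z] \<delta>_le by (simp add: rpow_def)
    also have "\<dots> \<le> c * norm ?v * (V ?z + e) powr (1 - \<delta>)"
      using c_pos V_nonneg[of ?z] assms \<delta>_le by (intro mult_left_mono powr_mono2) auto
    finally have "(V ?z + e) powr (\<delta> - 1) * \<bar>DD ?v V ?z\<bar>
        \<le> (V ?z + e) powr (\<delta> - 1) * (c * norm ?v * (V ?z + e) powr (1 - \<delta>))"
      by (intro mult_left_mono) auto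
    also have "\<dots> = c * norm ?v * ((V ?z + e) powr (\<delta> - 1) * (V ?z + e) powr (1 - \<delta>))" by simp
    also have "(V ?z + e) powr (\<delta> - 1) * (V ?z + e) powr (1 - \<delta>) = 1"
      using V_nonneg[of ?z] assms by (simp flip: powr_add)
    finally have "\<delta> * ((V ?z + e) powr (\<delta> - 1) * \<bar>DD ?v V ?z\<bar>) \<le> \<delta> * (c * norm ?v)"
      using \<delta>_pos by simp
    then show ?thesis using \<delta>_pos by (simp add: abs_mult L_def mult_ac)
  qed
  then show ?thesis using t by simp
qed

lemma V_powr_lipschitz: "\<bar>V y powr \<delta> - V x powr \<delta>\<bar> \<le> L * norm (y - x)"
proof -
  have lim: "((\<lambda>e. (V z + e) powr \<delta>) \<longlongrightarrow> V z powr \<delta>) (at_right 0)" for z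
  proof (rule tendsto_powr')
    show "((\<lambda>e. V z + e) \<longlongrightarrow> V z) (at_right 0)"
      by (auto intro!: tendsto_eq_intros)
    show "V z \<noteq> 0 \<or> 0 < \<delta> \<and> (\<forall>\<^sub>F x in at_right 0. 0 \<le> V z + x)"
      using \<delta>_pos V_nonneg[of z] by (auto simp: eventually_at_filter intro!: always_eventually add_nonneg_nonneg)
  qed auto
  have "((\<lambda>e. \<bar>(V y + e) powr \<delta> - (V x + e) powr \<delta>\<bar>) \<longlongrightarrow> \<bar>V y powr \<delta> - V x powr \<delta>\<bar>) (at_right 0)"
    by (intro tendsto_intros lim)
  then show ?thesis
    by (rule tendsto_upperbound)
      (auto intro!: powr_regularized_lipschitz always_eventually simp: eventually_at_filter)
qed

text \<open>Within the distance where \<open>V\<^sup>\<delta>\<close> varies by at most half of its value \<open>r\<close> at the centre, the ratio of the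
  values of \<open>V\<close> lies between \<open>lo\<close> and \<open>hi\<close>.\<close>

definition "lo = (1 / 2) powr (1 / \<delta>)"
definition "hi = (3 / 2) powr (1 / \<delta>)"

lemma lo_pos: "lo > 0" by (simp add: lo_def)
lemma hi_ge_1: "hi \<ge> 1" unfolding hi_def using \<delta>_pos by (simp add: ge_one_powr_ge_zero)

lemma V_comparable:
  assumes "x \<noteq> 0" "L * norm (z - x) \<le> V x powr \<delta> / 2"
  shows "lo \<le> V z / V x" "V z / V x \<le> hi"
proof -
  define r where "r = V x powr \<delta>"
  have r: "r > 0" unfolding r_def using V_pos[OF assms(1)] by simp
  have "r / 2 \<le> V z powr \<delta>" "V z powr \<delta> \<le> 3 / 2 * r"
    using V_powr_lipschitz[of z x] assms(2) unfolding r_def by linarith+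
  then have b: "1 / 2 \<le> V z powr \<delta> / r" "V z powr \<delta> / r \<le> 3 / 2"
    using r by (simp_all add: field_simps)
  have eq: "V z / V x = (V z powr \<delta> / r) powr (1 / \<delta>)"
    unfolding r_def using V_nonneg[of z] V_pos[OF assms(1)] \<delta>_pos
    by (simp add: powr_divide powr_powr)
  show "lo \<le> V z / V x" "V z / V x \<le> hi"
    unfolding eq lo_def hi_def using b \<delta>_pos r by (auto intro!: powr_mono2)
qed

lemma V_pos_near: "x \<noteq> 0 \<Longrightarrow> L * norm (z - x) \<le> V x powr \<delta> / 2 \<Longrightarrow> V z > 0"
  using V_comparable(1)[of x z] lo_pos V_pos[of x] V_nonneg[of z] by (cases "V z = 0") auto

text \<open>Near \<open>x\<close>, every derivative of \<open>V\<close> costs a factor \<open>1 / r\<close> with \<open>r = V(x)\<^sup>\<delta>\<close>. The exponent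
  \<open>1 - n \<delta>\<close> is nonnegative because \<open>n \<le> 4\<close> and \<open>\<delta> \<le> 1/4\<close>, so an upper bound on \<open>V\<close> is enough.\<close>

lemma DD_local_bound:
  assumes x: "x \<noteq> 0" and z: "L * norm (z - x) \<le> V x powr \<delta> / 2"
    and l: "1 \<le> length vs" "length vs \<le> 4"
  shows "\<bar>foldr DD vs V z / V x\<bar> \<le> c * hi * prod_list (map (\<lambda>v. norm v / V x powr \<delta>) vs)"
proof -
  let ?n = "real (length vs)"
  have v0: "V x > 0" using V_pos[OF x] .
  have Vz: "V z > 0" using V_pos_near[OF x z] .
  have n: "?n * \<delta> \<le> 1"
  proof -
    have "?n * \<delta> \<le> 4 * (1 / 4)" using l \<delta>_le \<delta>_pos by (intro mult_mono) auto
    then show ?thesis by simp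
  qed
  have "rpow (V z) (1 - ?n * \<delta>) = V z powr (1 - ?n * \<delta>)" using Vz by (simp add: rpow_def)
  also have "\<dots> \<le> (hi * V x) powr (1 - ?n * \<delta>)"
    using V_comparable(2)[OF x z] v0 V_nonneg n by (intro powr_mono2) (auto simp: field_simps)
  also have "\<dots> = hi powr (1 - ?n * \<delta>) * V x powr (1 - ?n * \<delta>)"
    using hi_ge_1 v0 by (simp add: powr_mult)
  also have "\<dots> \<le> hi powr 1 * V x powr (1 - ?n * \<delta>)"
    using hi_ge_1 \<delta>_pos by (intro mult_right_mono powr_mono) auto
  also have "\<dots> = hi * (V x / (V x powr \<delta>) ^ length vs)"
    using hi_ge_1 v0 by (simp add: powr_diff powr_powr mult.commute flip: powr_realpow)
  finally have r: "rpow (V z) (1 - ?n * \<delta>) \<le> hi * (V x / (V x powr \<delta>) ^ length vs)" .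
  have p: "prod_list (map (\<lambda>v. norm v / V x powr \<delta>) vs) = prod_list (map norm vs) / (V x powr \<delta>) ^ length vs"
    by (induction vs) auto
  have pn: "prod_list (map norm vs) \<ge> 0" by (rule prod_list_nonneg) auto
  have "\<bar>foldr DD vs V z\<bar> \<le> c * prod_list (map norm vs) * rpow (V z) (1 - ?n * \<delta>)"
    by (rule V_DD[OF l])
  also have "\<dots> \<le> c * prod_list (map norm vs) * (hi * (V x / (V x powr \<delta>) ^ length vs))"
    using c_pos pn by (intro mult_left_mono r) auto
  finally show ?thesis unfolding p using v0 by (simp add: field_simps)
qed

lemma DD_local_replicate:
  assumes "x \<noteq> 0" "L * norm (z - x) \<le> V x powr \<delta> / 2" "1 \<le> k" "k \<le> 4"
  shows "\<bar>foldr DD (replicate k s) V z / V x\<bar> \<le> c * hi * (norm s / V x powr \<delta>) ^ k"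
  using DD_local_bound[OF assms(1,2), of "replicate k s"] assms(3,4)
  by (simp add: prod_list_replicate)

text \<open>Two increments of relative size at most \<open>\<epsilon>0\<close> change \<open>V\<^sup>\<delta>\<close> by at most \<open>2 L \<epsilon>0 = 1/2\<close> of its value.\<close>

definition "\<epsilon>0 = 1 / (4 * L)"

lemma eps_pos: "\<epsilon>0 > 0" unfolding \<epsilon>0_def using L_pos by simp

lemma near:
  assumes "norm a \<le> \<epsilon>0 * r" "norm s \<le> \<epsilon>0 * r" "\<bar>t\<bar> \<le> 1" "\<bar>t'\<bar> \<le> 1"
  shows "L * norm ((x + t' *\<^sub>R a + t *\<^sub>R s) - x) \<le> r / 2"
proof -
  have "norm (t' *\<^sub>R a + t *\<^sub>R s) \<le> \<bar>t'\<bar> * norm a + \<bar>t\<bar> * norm s"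
    using norm_triangle_ineq[of "t' *\<^sub>R a" "t *\<^sub>R s"] by simp
  also have "\<dots> \<le> 1 * norm a + 1 * norm s" using assms(3,4) by (intro add_mono mult_right_mono) auto
  also have "\<dots> \<le> 2 * (\<epsilon>0 * r)" using assms(1,2) by simp
  finally have "L * norm (t' *\<^sub>R a + t *\<^sub>R s) \<le> L * (2 * (\<epsilon>0 * r))"
    using L_pos by (intro mult_left_mono) auto
  then show ?thesis using L_pos by (simp add: \<epsilon>0_def add.assoc)
qed

lemma DERIV_foldr_line:
  assumes "length vs \<le> 3"
  shows "((\<lambda>t. foldr DD vs V (x + t *\<^sub>R v) / v0) has_real_derivative
      foldr DD (v # vs) V (x + t *\<^sub>R v) / v0) (at t)"
  using DERIV_cdivide[OF DERIV_along_line[OF foldr_DD_differentiable[OF assms]], where c = v0] by simp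

lemma even_increment:
  obtains C where "C \<ge> 0" "\<And>x a s. x \<noteq> 0 \<Longrightarrow> norm a \<le> \<epsilon>0 * V x powr \<delta> \<Longrightarrow> norm s \<le> \<epsilon>0 * V x powr \<delta> \<Longrightarrow>
    \<bar>(V (x + a + s) powr \<rho> + V (x + a - s) powr \<rho>) / 2 - V (x + a) powr \<rho> - D2pow V \<rho> (x + a) s / 2\<bar>
      \<le> C * V x powr \<rho> * (norm s / V x powr \<delta>) ^ 4"
proof -
  have D: "c * hi \<ge> 0" using c_pos hi_ge_1 by simp
  obtain C where C0: "C \<ge> 0" and C: "\<And>U \<kappa>. 0 \<le> \<kappa> \<Longrightarrow>
      (\<And>k t. k \<le> 3 \<Longrightarrow> \<bar>t\<bar> \<le> 1 \<Longrightarrow> (U k has_real_derivative U (Suc k) t) (at t)) \<Longrightarrow>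
      (\<And>t. \<bar>t\<bar> \<le> 1 \<Longrightarrow> lo \<le> U 0 t \<and> U 0 t \<le> hi) \<Longrightarrow>
      (\<And>k t. 1 \<le> k \<Longrightarrow> k \<le> 4 \<Longrightarrow> \<bar>t\<bar> \<le> 1 \<Longrightarrow> \<bar>U k t\<bar> \<le> c * hi * \<kappa> ^ k) \<Longrightarrow>
      \<bar>(U 0 1 powr \<rho> + U 0 (- 1) powr \<rho>) / 2 - U 0 0 powr \<rho> - pow_jet \<rho> (\<lambda>k. U k 0) 2 / 2\<bar> \<le> C * \<kappa> ^ 4"
    using even_pow_taylor[OF lo_pos D] by metis
  show thesis
  proof (rule that[OF C0])
    fix x a s :: "real ^ 'd" assume x: "x \<noteq> 0" and a: "norm a \<le> \<epsilon>0 * V x powr \<delta>" and s: "norm s \<le> \<epsilon>0 * V x powr \<delta>"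
    let ?v = "V x" and ?m = "x + a"
    let ?U = "\<lambda>k t. foldr DD (replicate k s) V (?m + t *\<^sub>R s) / ?v"
    have v0: "?v > 0" using V_pos[OF x] .
    have nr: "L * norm (?m + t *\<^sub>R s - x) \<le> ?v powr \<delta> / 2" if "\<bar>t\<bar> \<le> 1" for t
      using near[OF a s that, of 1 x] by simp
    have "\<bar>(?U 0 1 powr \<rho> + ?U 0 (- 1) powr \<rho>) / 2 - ?U 0 0 powr \<rho> - pow_jet \<rho> (\<lambda>k. ?U k 0) 2 / 2\<bar>
        \<le> C * (norm s / ?v powr \<delta>) ^ 4" (is "?l \<le> _")
    proof (rule C)
      show "(?U k has_real_derivative ?U (Suc k) t) (at t)" if "k \<le> 3" for k t
        using DERIV_foldr_line[of "replicate k s" ?m s ?v t] that by simp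
      show "lo \<le> ?U 0 t \<and> ?U 0 t \<le> hi" if "\<bar>t\<bar> \<le> 1" for t
        using V_comparable[OF x nr[OF that]] by simp
      show "\<bar>?U k t\<bar> \<le> c * hi * (norm s / ?v powr \<delta>) ^ k" if "1 \<le> k" "k \<le> 4" "\<bar>t\<bar> \<le> 1" for k t
        by (rule DD_local_replicate[OF x nr[OF that(3)] that(1,2)])
    qed simp
    then have "?v powr \<rho> * ?l \<le> ?v powr \<rho> * (C * (norm s / ?v powr \<delta>) ^ 4)"
      by (intro mult_left_mono) auto
    moreover have Vm: "V ?m > 0" using V_pos_near[OF x nr[of 0]] by simp
    have "?v powr \<rho> * pow_jet \<rho> (\<lambda>k. ?U k 0) 2 = D2pow V \<rho> ?m s"
      unfolding D2pow_scaled[of V ?m ?v, OF Vm v0] by (simp add: pow_jet_def numeral_2_eq_2)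
    moreover have "?v powr \<rho> * (V z / ?v) powr \<rho> = V z powr \<rho>" for z
      using v0 V_nonneg by (simp add: powr_divide)
    ultimately have "?v powr \<rho> * ((?U 0 1 powr \<rho> + ?U 0 (- 1) powr \<rho>) / 2 - ?U 0 0 powr \<rho> - pow_jet \<rho> (\<lambda>k. ?U k 0) 2 / 2)
        = (V (?m + s) powr \<rho> + V (?m - s) powr \<rho>) / 2 - V ?m powr \<rho> - D2pow V \<rho> ?m s / 2"
      by (simp add: right_diff_distrib distrib_left add_divide_distrib)
    from arg_cong[OF this, of abs] have "?v powr \<rho> * ?l = \<bar>(V (?m + s) powr \<rho> + V (?m - s) powr \<rho>) / 2 - V ?m powr \<rho> - D2pow V \<rho> ?m s / 2\<bar>"
      by (simp only: abs_mult abs_of_nonneg[OF powr_ge_zero])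
    then show "\<bar>(V (?m + s) powr \<rho> + V (?m - s) powr \<rho>) / 2 - V ?m powr \<rho> - D2pow V \<rho> ?m s / 2\<bar>
      \<le> C * ?v powr \<rho> * (norm s / ?v powr \<delta>) ^ 4"
      using \<open>?v powr \<rho> * ?l \<le> _\<close> by (simp add: mult_ac)
  qed
qed

lemma drift_increment:
  obtains C where "C \<ge> 0" "\<And>x a. x \<noteq> 0 \<Longrightarrow> norm a \<le> \<epsilon>0 * V x powr \<delta> \<Longrightarrow>
    \<bar>V (x + a) powr \<rho> - V x powr \<rho> - D1pow V \<rho> x a\<bar> \<le> C * V x powr \<rho> * (norm a / V x powr \<delta>) ^ 2"
proof -
  have D: "c * hi \<ge> 0" using c_pos hi_ge_1 by simp
  obtain C where C0: "C \<ge> 0" and C: "\<And>U \<kappa>. 0 \<le> \<kappa> \<Longrightarrow>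
      (\<And>k t. k \<le> 1 \<Longrightarrow> \<bar>t\<bar> \<le> 1 \<Longrightarrow> (U k has_real_derivative U (Suc k) t) (at t)) \<Longrightarrow>
      (\<And>t. \<bar>t\<bar> \<le> 1 \<Longrightarrow> lo \<le> U 0 t \<and> U 0 t \<le> hi) \<Longrightarrow>
      (\<And>k t. 1 \<le> k \<Longrightarrow> k \<le> 2 \<Longrightarrow> \<bar>t\<bar> \<le> 1 \<Longrightarrow> \<bar>U k t\<bar> \<le> c * hi * \<kappa> ^ k) \<Longrightarrow>
      \<bar>U 0 1 powr \<rho> - U 0 0 powr \<rho> - pow_jet \<rho> (\<lambda>k. U k 0) 1\<bar> \<le> C * \<kappa> ^ 2"
    using pow_taylor2[OF lo_pos D] by metis
  show thesis
  proof (rule that[OF C0])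
    fix x a :: "real ^ 'd" assume x: "x \<noteq> 0" and a: "norm a \<le> \<epsilon>0 * V x powr \<delta>"
    let ?v = "V x"
    let ?U = "\<lambda>k t. foldr DD (replicate k a) V (x + t *\<^sub>R a) / ?v"
    have v0: "?v > 0" using V_pos[OF x] .
    have nr: "L * norm (x + t *\<^sub>R a - x) \<le> ?v powr \<delta> / 2" if "\<bar>t\<bar> \<le> 1" for t
      using near[OF a a that, of 0 x] by simp
    have "\<bar>?U 0 1 powr \<rho> - ?U 0 0 powr \<rho> - pow_jet \<rho> (\<lambda>k. ?U k 0) 1\<bar>
        \<le> C * (norm a / ?v powr \<delta>) ^ 2" (is "?l \<le> _")
    proof (rule C)
      show "(?U k has_real_derivative ?U (Suc k) t) (at t)" if "k \<le> 1" for k t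
        using DERIV_foldr_line[of "replicate k a" x a ?v t] that by simp
      show "lo \<le> ?U 0 t \<and> ?U 0 t \<le> hi" if "\<bar>t\<bar> \<le> 1" for t
        using V_comparable[OF x nr[OF that]] by simp
      show "\<bar>?U k t\<bar> \<le> c * hi * (norm a / ?v powr \<delta>) ^ k" if "1 \<le> k" "k \<le> 2" "\<bar>t\<bar> \<le> 1" for k t
        by (rule DD_local_replicate[OF x nr[OF that(3)] that(1)]) (use that in simp)
    qed simp
    then have "?v powr \<rho> * ?l \<le> ?v powr \<rho> * (C * (norm a / ?v powr \<delta>) ^ 2)"
      by (intro mult_left_mono) auto
    moreover have "?v powr \<rho> * pow_jet \<rho> (\<lambda>k. ?U k 0) 1 = D1pow V \<rho> x a"
      unfolding D1pow_scaled[of V x "V x", OF v0 v0] by (simp add: pow_jet_def)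
    moreover have "?v powr \<rho> * (V z / ?v) powr \<rho> = V z powr \<rho>" for z
      using v0 V_nonneg by (simp add: powr_divide)
    ultimately have "?v powr \<rho> * (?U 0 1 powr \<rho> - ?U 0 0 powr \<rho> - pow_jet \<rho> (\<lambda>k. ?U k 0) 1)
        = V (x + a) powr \<rho> - V x powr \<rho> - D1pow V \<rho> x a"
      by (simp add: right_diff_distrib)
    from arg_cong[OF this, of abs] have "?v powr \<rho> * ?l = \<bar>V (x + a) powr \<rho> - V x powr \<rho> - D1pow V \<rho> x a\<bar>"
      by (simp only: abs_mult abs_of_nonneg[OF powr_ge_zero])
    then show "\<bar>V (x + a) powr \<rho> - V x powr \<rho> - D1pow V \<rho> x a\<bar>
      \<le> C * ?v powr \<rho> * (norm a / ?v powr \<delta>) ^ 2"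
      using \<open>?v powr \<rho> * ?l \<le> _\<close> by (simp add: mult_ac)
  qed
qed

lemma D2pow_drift:
  obtains C where "C \<ge> 0" "\<And>x a s. x \<noteq> 0 \<Longrightarrow> norm a \<le> \<epsilon>0 * V x powr \<delta> \<Longrightarrow>
    \<bar>D2pow V \<rho> (x + a) s - D2pow V \<rho> x s\<bar>
      \<le> C * V x powr \<rho> * ((norm s / V x powr \<delta>)\<^sup>2 * (norm a / V x powr \<delta>))"
proof -
  have D: "c * hi \<ge> 0" using c_pos hi_ge_1 by simp
  obtain C where C0: "C \<ge> 0" and C: "\<And>u b k u' b' k' \<alpha> \<kappa>. 0 \<le> \<alpha> \<Longrightarrow> 0 \<le> \<kappa> \<Longrightarrow>
      (\<And>t. 0 \<le> t \<Longrightarrow> t \<le> 1 \<Longrightarrow> (u has_real_derivative u' t) (at t) \<and> (b has_real_derivative b' t) (at t)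
         \<and> (k has_real_derivative k' t) (at t) \<and> lo \<le> u t \<and> u t \<le> hi \<and> \<bar>b t\<bar> \<le> c * hi * \<kappa> \<and> \<bar>k t\<bar> \<le> c * hi * \<kappa>^2
         \<and> \<bar>u' t\<bar> \<le> c * hi * \<alpha> \<and> \<bar>b' t\<bar> \<le> c * hi * \<kappa> * \<alpha> \<and> \<bar>k' t\<bar> \<le> c * hi * \<kappa>^2 * \<alpha>) \<Longrightarrow>
      \<bar>(\<rho> * (\<rho> - 1) * u 1 powr (\<rho> - 2) * (b 1)^2 + \<rho> * u 1 powr (\<rho> - 1) * k 1)
        - (\<rho> * (\<rho> - 1) * u 0 powr (\<rho> - 2) * (b 0)^2 + \<rho> * u 0 powr (\<rho> - 1) * k 0)\<bar> \<le> C * \<kappa>^2 * \<alpha>"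
    using pow_jet2_drift[OF lo_pos D] by metis
  show thesis
  proof (rule that[OF C0])
    fix x a s :: "real ^ 'd" assume x: "x \<noteq> 0" and a: "norm a \<le> \<epsilon>0 * V x powr \<delta>"
    let ?v = "V x"
    have v0: "?v > 0" using V_pos[OF x] .
    have nr: "L * norm (x + t *\<^sub>R a - x) \<le> ?v powr \<delta> / 2" if "\<bar>t\<bar> \<le> 1" for t
      using near[OF a a that, of 0 x] by simp
    let ?f = "\<lambda>vs t. foldr DD vs V (x + t *\<^sub>R a) / ?v"
    let ?q = "\<lambda>t. \<rho> * (\<rho> - 1) * ?f [] t powr (\<rho> - 2) * (?f [s] t)^2 + \<rho> * ?f [] t powr (\<rho> - 1) * ?f [s, s] t"
    let ?k = "norm s / ?v powr \<delta>" and ?a = "norm a / ?v powr \<delta>"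
    have b: "\<bar>?q 1 - ?q 0\<bar> \<le> C * ?k^2 * ?a"
    proof (rule C[of ?a ?k _ "?f [a]" _ "?f [a, s]" _ "?f [a, s, s]"], goal_cases)
      case (3 t)
      then have t: "\<bar>t\<bar> \<le> 1" by simp
      note bd = DD_local_bound[OF x nr[OF t]]
      have "(?f [] has_real_derivative ?f [a] t) (at t)" "(?f [s] has_real_derivative ?f [a, s] t) (at t)"
        "(?f [s, s] has_real_derivative ?f [a, s, s] t) (at t)"
        by (rule DERIV_foldr_line; simp)+
      moreover have "lo \<le> ?f [] t \<and> ?f [] t \<le> hi" using V_comparable[OF x nr[OF t]] by simp
      moreover have "\<bar>?f [s] t\<bar> \<le> c * hi * ?k" "\<bar>?f [s, s] t\<bar> \<le> c * hi * ?k\<^sup>2" "\<bar>?f [a] t\<bar> \<le> c * hi * ?a"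
          "\<bar>?f [a, s] t\<bar> \<le> c * hi * ?k * ?a" "\<bar>?f [a, s, s] t\<bar> \<le> c * hi * ?k\<^sup>2 * ?a"
        using bd[of "[s]"] bd[of "[s, s]"] bd[of "[a]"] bd[of "[a, s]"] bd[of "[a, s, s]"]
        by (simp_all add: power2_eq_square mult_ac)
      ultimately show ?case by blast
    qed auto
    have V1: "V (x + a) > 0" using V_pos_near[OF x nr[of 1]] by simp
    have "D2pow V \<rho> (x + a) s - D2pow V \<rho> x s = ?v powr \<rho> * (?q 1 - ?q 0)"
      unfolding D2pow_scaled[of V "x + a" ?v, OF V1 v0] D2pow_scaled[of V x "V x", OF v0 v0] by (simp add: right_diff_distrib)
    then have "\<bar>D2pow V \<rho> (x + a) s - D2pow V \<rho> x s\<bar> = ?v powr \<rho> * \<bar>?q 1 - ?q 0\<bar>"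
      by (simp only: abs_mult) simp
    also have "\<dots> \<le> ?v powr \<rho> * (C * ?k^2 * ?a)" by (intro mult_left_mono b) auto
    finally show "\<bar>D2pow V \<rho> (x + a) s - D2pow V \<rho> x s\<bar> \<le> C * ?v powr \<rho> * (?k\<^sup>2 * ?a)"
      by (simp add: mult_ac)
  qed
qed

text \<open>At the centre itself the normalized value of the function is \<open>1\<close>, which is both the lower and the
  upper bound that \<open>pow_jet_bound\<close> asks for.\<close>

lemma D1pow_D2pow_bound:
  obtains C where "C \<ge> 0" "\<And>x a. x \<noteq> 0 \<Longrightarrow> \<bar>D1pow V \<rho> x a\<bar> \<le> C * V x powr \<rho> * (norm a / V x powr \<delta>)"
    "\<And>x s. x \<noteq> 0 \<Longrightarrow> \<bar>D2pow V \<rho> x s\<bar> \<le> C * V x powr \<rho> * (norm s / V x powr \<delta>)\<^sup>2"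
proof -
  have D: "c * hi \<ge> 0" using c_pos hi_ge_1 by simp
  obtain C where C0: "C \<ge> 0" and C: "\<And>y \<kappa> n. 1 \<le> y 0 \<Longrightarrow> y 0 \<le> 1 \<Longrightarrow> 0 \<le> \<kappa> \<Longrightarrow> n \<le> 4 \<Longrightarrow>
      (\<And>k. 1 \<le> k \<Longrightarrow> k \<le> n \<Longrightarrow> \<bar>y k\<bar> \<le> c * hi * \<kappa> ^ k) \<Longrightarrow> \<bar>pow_jet \<rho> y n\<bar> \<le> C * \<kappa> ^ n"
    using pow_jet_bound[OF zero_less_one D] by metis
  have b: "\<bar>V x powr \<rho> * pow_jet \<rho> (\<lambda>k. foldr DD (replicate k s) V x / V x) n\<bar>
      \<le> C * V x powr \<rho> * (norm s / V x powr \<delta>) ^ n" if x: "x \<noteq> 0" and n: "n \<le> 4" for x s n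
  proof -
    have "\<bar>pow_jet \<rho> (\<lambda>k. foldr DD (replicate k s) V x / V x) n\<bar> \<le> C * (norm s / V x powr \<delta>) ^ n"
      using V_pos[OF x] n DD_local_replicate[OF x, of x _ s] by (intro C) auto
    then have "V x powr \<rho> * \<bar>pow_jet \<rho> (\<lambda>k. foldr DD (replicate k s) V x / V x) n\<bar> \<le> V x powr \<rho> * (C * (norm s / V x powr \<delta>) ^ n)"
      by (intro mult_left_mono) auto
    then show ?thesis by (simp add: abs_mult mult_ac)
  qed
  show thesis
  proof (rule that[OF C0])
    fix x s :: "real ^ 'd" assume x: "x \<noteq> 0"
    note v0 = V_pos[OF x]
    show "\<bar>D1pow V \<rho> x s\<bar> \<le> C * V x powr \<rho> * (norm s / V x powr \<delta>)"
      using b[OF x, of 1 s] unfolding D1pow_scaled[of V x "V x", OF v0 v0] by (simp add: pow_jet_def)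
    show "\<bar>D2pow V \<rho> x s\<bar> \<le> C * V x powr \<rho> * (norm s / V x powr \<delta>)\<^sup>2"
      using b[OF x, of 2 s] unfolding D2pow_scaled[of V x "V x", OF v0 v0] by (simp add: pow_jet_def numeral_2_eq_2)
  qed
qed

text \<open>For \<open>|s| > \<epsilon>0 r\<close>, the numbers \<open>1\<close>, \<open>|a| / r\<close> and \<open>|s| / r\<close> are all at most a multiple of the
  last one, and the Lipschitz bound for \<open>V\<^sup>\<delta>\<close> gives growth of degree \<open>\<rho> / \<delta> \<le> N\<close>.\<close>

lemma large_increment:
  assumes x: "x \<noteq> 0" and a: "norm a \<le> \<epsilon>0 * V x powr \<delta>" and s: "norm s > \<epsilon>0 * V x powr \<delta>"
    and \<rho>: "\<rho> > 0" and N: "\<rho> / \<delta> \<le> real N"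
  shows "V (x + a + s) powr \<rho> \<le> ((3 / 2) powr (\<rho> / \<delta>) / \<epsilon>0 ^ N) * V x powr \<rho> * (norm s / V x powr \<delta>) ^ N"
proof -
  define r where "r = V x powr \<delta>"
  define \<kappa> where "\<kappa> = norm s / r"
  have r: "r > 0" unfolding r_def using V_pos[OF x] by simp
  have \<kappa>: "\<kappa> > \<epsilon>0" unfolding \<kappa>_def using s r by (simp add: r_def field_simps)
  have "V (x + a + s) powr \<delta> \<le> r + L * norm (a + s)"
    using V_powr_lipschitz[of "x + a + s" x] unfolding r_def by (simp add: add.assoc)
  also have "\<dots> \<le> r + L * (norm a + norm s)"
    using L_pos norm_triangle_ineq[of a s] by (intro add_left_mono mult_left_mono) auto
  also have "\<dots> \<le> r + L * (\<epsilon>0 * r + \<kappa> * r)"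
    using a r L_pos unfolding \<kappa>_def r_def by (intro add_left_mono mult_left_mono add_mono) auto
  also have "\<dots> = r * (1 + L * \<epsilon>0 + L * \<kappa>)" by (simp add: algebra_simps)
  also have "\<dots> \<le> r * (6 * (L * \<kappa>))"
  proof -
    have "L * \<epsilon>0 = 1 / 4" using L_pos by (simp add: \<epsilon>0_def)
    moreover have "L * \<epsilon>0 < L * \<kappa>" using \<kappa> L_pos by simp
    ultimately have "1 + L * \<epsilon>0 + L * \<kappa> \<le> 6 * (L * \<kappa>)" by linarith
    then show ?thesis using r by (intro mult_left_mono) auto
  qed
  also have "6 * (L * \<kappa>) = 3 / 2 * (\<kappa> / \<epsilon>0)" using L_pos by (simp add: \<epsilon>0_def)
  finally have "(V (x + a + s) powr \<delta>) powr (\<rho> / \<delta>) \<le> (r * (3 / 2 * (\<kappa> / \<epsilon>0))) powr (\<rho> / \<delta>)"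
    using \<rho> \<delta>_pos by (intro powr_mono2) auto
  also have "\<dots> = V x powr \<rho> * ((3 / 2) powr (\<rho> / \<delta>) * (\<kappa> / \<epsilon>0) powr (\<rho> / \<delta>))"
  proof -
    have "0 \<le> r" "0 \<le> \<kappa> / \<epsilon>0" "0 \<le> 3 / 2 * (\<kappa> / \<epsilon>0)" "(0::real) \<le> 3 / 2"
      using r \<kappa> eps_pos by auto
    then have "(r * (3 / 2 * (\<kappa> / \<epsilon>0))) powr (\<rho> / \<delta>)
        = r powr (\<rho> / \<delta>) * ((3 / 2) powr (\<rho> / \<delta>) * (\<kappa> / \<epsilon>0) powr (\<rho> / \<delta>))"
      by (simp only: powr_mult)
    then show ?thesis using \<delta>_pos by (simp add: r_def powr_powr)
  qed
  also have "\<dots> \<le> V x powr \<rho> * ((3 / 2) powr (\<rho> / \<delta>) * (\<kappa> / \<epsilon>0) powr (real N))"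
    using \<kappa> eps_pos N by (intro mult_left_mono powr_mono) auto
  also have "(\<kappa> / \<epsilon>0) powr (real N) = \<kappa> ^ N / \<epsilon>0 ^ N"
    using \<kappa> eps_pos by (simp add: powr_realpow power_divide)
  finally show ?thesis
    using \<delta>_pos by (simp add: powr_powr r_def \<kappa>_def field_simps)
qed

text \<open>If \<open>|s| \<le> \<epsilon>0 r\<close>, the three local estimates add up: fourth order along \<open>s\<close> at \<open>x + a\<close>, second
  order along \<open>a\<close>, and the change of the second derivative along \<open>s\<close> between \<open>x\<close> and \<open>x + a\<close>. If
  \<open>|s| > \<epsilon>0 r\<close>, the left-hand side is of order \<open>\<kappa>\<^sup>N\<close>, and the derivative terms on the right,
  which may be negative, are dominated by \<open>\<kappa>\<^sup>4\<close>.\<close>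

lemma symmetrized_increment:
  assumes \<rho>: "\<rho> > 0" and N: "\<rho> / \<delta> \<le> real N"
  obtains C where "C \<ge> 0" "\<And>x a s. x \<noteq> 0 \<Longrightarrow> norm a \<le> \<epsilon>0 * V x powr \<delta> \<Longrightarrow>
    (V (x + a + s) powr \<rho> + V (x + a - s) powr \<rho>) / 2
      \<le> V x powr \<rho> + D1pow V \<rho> x a + D2pow V \<rho> x s / 2
        + C * V x powr \<rho> * ((norm a / V x powr \<delta>)\<^sup>2 + (norm s / V x powr \<delta>)\<^sup>2 * (norm a / V x powr \<delta>)
            + (norm s / V x powr \<delta>) ^ 4 + (norm s / V x powr \<delta>) ^ N)"
proof -
  obtain C1 where C1: "C1 \<ge> 0" "\<And>x a s. x \<noteq> 0 \<Longrightarrow> norm a \<le> \<epsilon>0 * V x powr \<delta> \<Longrightarrow> norm s \<le> \<epsilon>0 * V x powr \<delta> \<Longrightarrow>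
    \<bar>(V (x + a + s) powr \<rho> + V (x + a - s) powr \<rho>) / 2 - V (x + a) powr \<rho> - D2pow V \<rho> (x + a) s / 2\<bar>
      \<le> C1 * V x powr \<rho> * (norm s / V x powr \<delta>) ^ 4"
    using even_increment[of \<rho>] by metis
  obtain C2 where C2: "C2 \<ge> 0" "\<And>x a. x \<noteq> 0 \<Longrightarrow> norm a \<le> \<epsilon>0 * V x powr \<delta> \<Longrightarrow>
    \<bar>V (x + a) powr \<rho> - V x powr \<rho> - D1pow V \<rho> x a\<bar> \<le> C2 * V x powr \<rho> * (norm a / V x powr \<delta>) ^ 2"
    using drift_increment[of \<rho>] by metis
  obtain C3 where C3: "C3 \<ge> 0" "\<And>x a s. x \<noteq> 0 \<Longrightarrow> norm a \<le> \<epsilon>0 * V x powr \<delta> \<Longrightarrow>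
    \<bar>D2pow V \<rho> (x + a) s - D2pow V \<rho> x s\<bar>
      \<le> C3 * V x powr \<rho> * ((norm s / V x powr \<delta>)\<^sup>2 * (norm a / V x powr \<delta>))"
    using D2pow_drift[of \<rho>] by metis
  obtain C4 where C4: "C4 \<ge> 0" "\<And>x a. x \<noteq> 0 \<Longrightarrow> \<bar>D1pow V \<rho> x a\<bar> \<le> C4 * V x powr \<rho> * (norm a / V x powr \<delta>)"
    "\<And>x s. x \<noteq> 0 \<Longrightarrow> \<bar>D2pow V \<rho> x s\<bar> \<le> C4 * V x powr \<rho> * (norm s / V x powr \<delta>)\<^sup>2"
    using D1pow_D2pow_bound[of \<rho>] by metis
  define C5 where "C5 = (3 / 2) powr (\<rho> / \<delta>) / \<epsilon>0 ^ N"
  define C6 where "C6 = C4 / \<epsilon>0 ^ 3 + C4 / \<epsilon>0\<^sup>2"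
  have C5: "C5 \<ge> 0" and C6: "C6 \<ge> 0" unfolding C5_def C6_def using eps_pos C4(1) by simp_all
  define C where "C = C1 + C2 + C3 + C5 + C6"
  have C: "C1 \<le> C" "C2 \<le> C" "C3 / 2 \<le> C" "C5 \<le> C" "C6 \<le> C" "C \<ge> 0"
    unfolding C_def using C1(1) C2(1) C3(1) C5 C6 by linarith+
  show thesis
  proof (rule that[OF C(6)])
    fix x a s :: "real ^ 'd" assume x: "x \<noteq> 0" and a: "norm a \<le> \<epsilon>0 * V x powr \<delta>"
    define \<alpha> where "\<alpha> = norm a / V x powr \<delta>"
    define \<kappa> where "\<kappa> = norm s / V x powr \<delta>"
    define w where "w = V x powr \<rho>"
    have r: "V x powr \<delta> > 0" using V_pos[OF x] by simp
    have \<alpha>: "0 \<le> \<alpha>" "\<alpha> \<le> \<epsilon>0" unfolding \<alpha>_def using a r by (auto simp: field_simps)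
    have \<kappa>: "0 \<le> \<kappa>" unfolding \<kappa>_def by simp
    have w: "w \<ge> 0" unfolding w_def by simp
    have scale: "C' * w * t \<le> C * w * t" if "C' \<le> C" "t \<ge> 0" for C' t
      using that w by (intro mult_right_mono) auto
    let ?T = "\<alpha>\<^sup>2 + \<kappa>\<^sup>2 * \<alpha> + \<kappa> ^ 4 + \<kappa> ^ N"
    have split: "C * w * ?T = C * w * \<alpha>\<^sup>2 + C * w * (\<kappa>\<^sup>2 * \<alpha>) + C * w * \<kappa> ^ 4 + C * w * \<kappa> ^ N"
      by (simp add: distrib_left)
    have nn: "C * w * \<alpha>\<^sup>2 \<ge> 0" "C * w * (\<kappa>\<^sup>2 * \<alpha>) \<ge> 0" "C * w * \<kappa> ^ 4 \<ge> 0" "C * w * \<kappa> ^ N \<ge> 0"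
      using C(6) w \<alpha> \<kappa> by simp_all
    have "(V (x + a + s) powr \<rho> + V (x + a - s) powr \<rho>) / 2 \<le> w + D1pow V \<rho> x a + D2pow V \<rho> x s / 2 + C * w * ?T"
    proof (cases "norm s \<le> \<epsilon>0 * V x powr \<delta>")
      case True
      have "\<bar>(V (x + a + s) powr \<rho> + V (x + a - s) powr \<rho>) / 2 - V (x + a) powr \<rho> - D2pow V \<rho> (x + a) s / 2\<bar> \<le> C * w * \<kappa> ^ 4"
        using C1(2)[OF x a True] scale[OF C(1), of "\<kappa> ^ 4"] \<kappa> unfolding w_def \<kappa>_def by simp
      note 1 = abs_le_D1[OF this]
      have "\<bar>V (x + a) powr \<rho> - w - D1pow V \<rho> x a\<bar> \<le> C * w * \<alpha>\<^sup>2"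
        using C2(2)[OF x a] scale[OF C(2), of "\<alpha>\<^sup>2"] unfolding w_def \<alpha>_def by simp
      note 2 = abs_le_D1[OF this]
      have "\<bar>D2pow V \<rho> (x + a) s - D2pow V \<rho> x s\<bar> \<le> C3 * w * (\<kappa>\<^sup>2 * \<alpha>)"
        unfolding w_def \<kappa>_def \<alpha>_def by (rule C3(2)[OF x a])
      note 3 = abs_le_D1[OF this]
      have 4: "C3 * w * (\<kappa>\<^sup>2 * \<alpha>) / 2 \<le> C * w * (\<kappa>\<^sup>2 * \<alpha>)"
        using scale[OF C(3), of "\<kappa>\<^sup>2 * \<alpha>"] \<alpha> \<kappa> by simp
      show ?thesis unfolding split using 1 2 3 4 nn(4) by argo
    next
      case False
      have lk: "\<epsilon>0 < \<kappa>" unfolding \<kappa>_def using False r by (simp add: field_simps)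
      have "V (x + a + s) powr \<rho> \<le> C5 * w * \<kappa> ^ N" "V (x + a + (- s)) powr \<rho> \<le> C5 * w * \<kappa> ^ N"
        unfolding C5_def w_def \<kappa>_def using large_increment[OF x a _ \<rho> N, of s] large_increment[OF x a _ \<rho> N, of "- s"] False
        by auto
      then have 1: "(V (x + a + s) powr \<rho> + V (x + a - s) powr \<rho>) / 2 \<le> C * w * \<kappa> ^ N"
        using scale[OF C(4), of "\<kappa> ^ N"] \<kappa> by simp
      \<comment> \<open>Since \<open>\<alpha> \<le> \<epsilon>0 < \<kappa>\<close>, the missing powers of \<open>\<kappa>\<close> can be supplied at the cost of powers of \<open>\<epsilon>0\<close>.\<close>
      have "\<alpha> \<le> \<kappa> ^ 4 / \<epsilon>0 ^ 3"
      proof -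
        have "\<alpha> * \<epsilon>0 ^ 3 \<le> \<epsilon>0 * \<epsilon>0 ^ 3" using \<alpha> eps_pos by (intro mult_right_mono) auto
        also have "\<dots> = \<epsilon>0 ^ 4" by (simp add: eval_nat_numeral)
        also have "\<dots> \<le> \<kappa> ^ 4" using lk eps_pos by (intro power_mono) auto
        finally show ?thesis using eps_pos by (simp add: field_simps)
      qed
      then have "C4 * w * \<alpha> \<le> C4 * w * (\<kappa> ^ 4 / \<epsilon>0 ^ 3)" using C4(1) w by (intro mult_left_mono) auto
      moreover have "\<kappa>\<^sup>2 \<le> \<kappa> ^ 4 / \<epsilon>0\<^sup>2"
      proof -
        have "\<kappa>\<^sup>2 * \<epsilon>0\<^sup>2 \<le> \<kappa>\<^sup>2 * \<kappa>\<^sup>2" using lk eps_pos by (intro mult_left_mono power_mono) auto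
        also have "\<dots> = \<kappa> ^ 4" by (simp flip: power_add)
        finally show ?thesis using eps_pos by (simp add: field_simps)
      qed
      then have "C4 * w * \<kappa>\<^sup>2 \<le> C4 * w * (\<kappa> ^ 4 / \<epsilon>0\<^sup>2)" using C4(1) w by (intro mult_left_mono) auto
      moreover have "0 \<le> C4 * w * \<kappa>\<^sup>2" using C4(1) w by simp
      ultimately have "C4 * w * \<alpha> + C4 * w * \<kappa>\<^sup>2 / 2 \<le> C6 * w * \<kappa> ^ 4"
        unfolding C6_def by (simp add: algebra_simps)
      also have "\<dots> \<le> C * w * \<kappa> ^ 4" by (rule scale[OF C(5)]) (use \<kappa> in simp)
      finally have "C4 * w * \<alpha> + C4 * w * \<kappa>\<^sup>2 / 2 \<le> C * w * \<kappa> ^ 4" .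
      moreover have "\<bar>D1pow V \<rho> x a\<bar> \<le> C4 * w * \<alpha>" "\<bar>D2pow V \<rho> x s\<bar> \<le> C4 * w * \<kappa>\<^sup>2"
        using C4(2)[OF x, of a] C4(3)[OF x, of s] unfolding w_def \<alpha>_def \<kappa>_def by auto
      ultimately show ?thesis unfolding split using 1 nn w by linarith
    qed
    then show "(V (x + a + s) powr \<rho> + V (x + a - s) powr \<rho>) / 2
      \<le> V x powr \<rho> + D1pow V \<rho> x a + D2pow V \<rho> x s / 2
        + C * V x powr \<rho> * ((norm a / V x powr \<delta>)\<^sup>2 + (norm s / V x powr \<delta>)\<^sup>2 * (norm a / V x powr \<delta>)
            + (norm s / V x powr \<delta>) ^ 4 + (norm s / V x powr \<delta>) ^ N)"
      unfolding w_def \<alpha>_def \<kappa>_def .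
  qed
qed

end

section \<open>Moments of the centred Gaussian law\<close>

definition gauss :: "real \<Rightarrow> (real ^ 'm) measure" where
  "gauss t = density lborel (\<lambda>y. ennreal (\<Prod>i\<in>UNIV. normal_density 0 (sqrt t) (y $ i)))"

lemma sets_gauss [simp, measurable_cong]: "sets (gauss t) = sets borel"
  and space_gauss [simp]: "space (gauss t) = UNIV"
  by (simp_all add: gauss_def)

lemma measurable_vec_nth' [measurable]: "(\<lambda>y :: real ^ 'm. y $ i) \<in> borel_measurable borel"
  by (intro borel_measurable_continuous_onI continuous_intros)

text \<open>The coordinates of a vector are its inner products with the standard basis, so the
  product formula over the basis becomes one over the index type.\<close>

lemma nn_integral_lborel_prod_vec:
  fixes h :: "'m::finite \<Rightarrow> real \<Rightarrow> ennreal"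
  assumes [measurable]: "\<And>i. h i \<in> borel_measurable borel"
  shows "(\<integral>\<^sup>+y. (\<Prod>i\<in>UNIV. h i (y $ i)) \<partial>(lborel :: (real ^ 'm) measure)) = (\<Prod>i\<in>UNIV. \<integral>\<^sup>+x. h i x \<partial>lborel)"
proof -
  let ?ax = "\<lambda>i. axis i 1 :: real ^ 'm"
  have bij: "bij_betw ?ax UNIV Basis"
    by (auto simp: bij_betw_def inj_on_def axis_eq_axis Basis_vec_def)
  define k where "k b = h (the_inv_into UNIV ?ax b)" for b
  have k: "k (?ax i) = h i" for i
    unfolding k_def using bij by (subst the_inv_into_f_f) (auto simp: bij_betw_def)
  have "(\<integral>\<^sup>+y. (\<Prod>b\<in>Basis. k b (y \<bullet> b)) \<partial>(lborel :: (real ^ 'm) measure)) = (\<Prod>b\<in>Basis. \<integral>\<^sup>+x. k b x \<partial>lborel)"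
    by (rule nn_integral_lborel_prod) (auto simp: k_def)
  then show ?thesis
    by (simp add: prod.reindex_bij_betw[OF bij, symmetric] k inner_axis)
qed

lemma nn_integral_gauss_prod:
  fixes h :: "'m::finite \<Rightarrow> real \<Rightarrow> ennreal"
  assumes [measurable]: "\<And>i. h i \<in> borel_measurable borel"
  shows "(\<integral>\<^sup>+y. (\<Prod>i\<in>UNIV. h i (y $ i)) \<partial>(gauss t :: (real ^ 'm) measure))
    = (\<Prod>i\<in>UNIV. \<integral>\<^sup>+x. ennreal (normal_density 0 (sqrt t) x) * h i x \<partial>lborel)"
proof -
  have "(\<integral>\<^sup>+y. (\<Prod>i\<in>UNIV. h i (y $ i)) \<partial>(gauss t :: (real ^ 'm) measure))
      = (\<integral>\<^sup>+y. (\<Prod>i\<in>UNIV. ennreal (normal_density 0 (sqrt t) (y $ i)) * h i (y $ i)) \<partial>lborel)"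
    unfolding gauss_def by (subst nn_integral_density) (auto simp: prod.distrib prod_ennreal intro!: nn_integral_cong)
  also have "\<dots> = (\<Prod>i\<in>UNIV. \<integral>\<^sup>+x. ennreal (normal_density 0 (sqrt t) x) * h i x \<partial>lborel)"
    by (rule nn_integral_lborel_prod_vec) simp
  finally show ?thesis .
qed

text \<open>The even moment \<open>\<E> X\<^sup>2\<^sup>n = (2n - 1)!!\<close> of a standard normal variable.\<close>

definition gmom :: "nat \<Rightarrow> real" where "gmom n = fact (2 * n) / (2 ^ n * fact n)"

lemma gmom_nonneg: "gmom n \<ge> 0" by (simp add: gmom_def)

lemma nn_integral_normal_even:
  assumes "t > 0"
  shows "(\<integral>\<^sup>+x. ennreal (normal_density 0 (sqrt t) x) * ennreal (x ^ (2 * n)) \<partial>lborel) = ennreal (gmom n * t ^ n)"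
proof -
  have "has_bochner_integral lborel (\<lambda>x. normal_density 0 (sqrt t) x * (x - 0) ^ (2 * n))
      (fact (2 * n) / ((2 / (sqrt t)\<^sup>2) ^ n * fact n))"
    by (rule normal_moment_even) (use assms in simp)
  then have "(\<integral>\<^sup>+x. ennreal (normal_density 0 (sqrt t) x * x ^ (2 * n)) \<partial>lborel)
      = ennreal (fact (2 * n) / ((2 / (sqrt t)\<^sup>2) ^ n * fact n))"
    by (intro nn_integral_eq_integral[THEN trans])
      (auto simp: has_bochner_integral_iff power_mult intro!: AE_I2 mult_nonneg_nonneg)
  then show ?thesis using assms
    by (simp add: ennreal_mult' gmom_def power_divide field_simps power_mult flip: ennreal_mult')
qed

lemma nn_integral_gauss_coord:
  assumes "t > 0"
  shows "(\<integral>\<^sup>+y. ennreal ((y $ k) ^ (2 * n)) \<partial>(gauss t :: (real ^ 'm) measure)) = ennreal (gmom n * t ^ n)"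
proof -
  let ?h = "\<lambda>i x. if i = k then ennreal (x ^ (2 * n)) else 1"
  have 1: "(\<integral>\<^sup>+x. ennreal (normal_density 0 (sqrt t) x) \<partial>lborel) = 1"
    using nn_integral_normal_even[OF assms, of 0] by (simp add: gmom_def)
  have "(\<integral>\<^sup>+y. ennreal ((y $ k) ^ (2 * n)) \<partial>(gauss t :: (real ^ 'm) measure))
      = (\<integral>\<^sup>+y. (\<Prod>i\<in>UNIV. ?h i (y $ i)) \<partial>gauss t)"
    by (intro nn_integral_cong) simp
  also have "\<dots> = (\<Prod>i\<in>UNIV. \<integral>\<^sup>+x. ennreal (normal_density 0 (sqrt t) x) * ?h i x \<partial>lborel)"
    by (rule nn_integral_gauss_prod) simp
  also have "\<dots> = (\<Prod>i\<in>(UNIV :: 'm set). if i = k then ennreal (gmom n * t ^ n) else 1)"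
    using nn_integral_normal_even[OF assms, of n] 1 by (intro prod.cong) auto
  finally show ?thesis by simp
qed

lemma prob_space_gauss: "t > 0 \<Longrightarrow> prob_space (gauss t :: (real ^ 'm) measure)"
  using nn_integral_gauss_coord[of t undefined 0]
  by (intro prob_spaceI) (simp add: gmom_def)

lemma gauss_coord_moment:
  assumes "t > 0"
  shows "integrable (gauss t :: (real ^ 'm) measure) (\<lambda>y. (y $ k) ^ (2 * n))"
    and "(\<integral>y. (y $ k) ^ (2 * n) \<partial>(gauss t :: (real ^ 'm) measure)) = gmom n * t ^ n"
proof -
  have nn: "0 \<le> (y $ k) ^ (2 * n)" for y :: "real ^ 'm" by (simp add: power_mult)
  note nn_integral_gauss_coord[OF assms, where 'm = 'm, of k n]
  moreover have "0 \<le> gmom n * t ^ n" using gmom_nonneg assms by simp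
  ultimately have "has_bochner_integral (gauss t :: (real ^ 'm) measure) (\<lambda>y. (y $ k) ^ (2 * n)) (gmom n * t ^ n)"
    using nn by (intro has_bochner_integral_nn_integral) auto
  then show "integrable (gauss t :: (real ^ 'm) measure) (\<lambda>y. (y $ k) ^ (2 * n))"
    and "(\<integral>y. (y $ k) ^ (2 * n) \<partial>(gauss t :: (real ^ 'm) measure)) = gmom n * t ^ n"
    by (auto simp: has_bochner_integral_iff)
qed

text \<open>Flipping all signs gives the symmetry of the law; flipping a single one makes the mixed second
  moments vanish.\<close>

lemma gauss_sign_flip:
  assumes c: "\<And>i. c i = 1 \<or> c i = -1"
  shows "distr (gauss t :: (real ^ 'm) measure) borel (\<lambda>y. \<chi> i. c i * y $ i) = gauss t"
proof -
  let ?T = "\<lambda>y :: real ^ 'm. \<chi> i. c i * y $ i"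
  let ?p = "\<lambda>y :: real ^ 'm. ennreal (\<Prod>i\<in>UNIV. normal_density 0 (sqrt t) (y $ i))"
  let ?ax = "\<lambda>i. axis i 1 :: real ^ 'm"
  have [measurable]: "?T \<in> borel_measurable borel"
    by (intro borel_measurable_continuous_onI continuous_intros)
  have inj: "inj ?ax" by (auto simp: inj_on_def axis_eq_axis)
  have bij: "bij_betw ?ax UNIV Basis"
    using inj by (auto simp: bij_betw_def Basis_vec_def)
  define d where "d b = c (the_inv_into UNIV ?ax b)" for b
  have d: "d (?ax i) = c i" for i
    unfolding d_def using inj by (subst the_inv_into_f_f) auto
  have T: "0 + (\<Sum>b\<in>Basis. (d b * (y \<bullet> b)) *\<^sub>R b) = ?T y" for y :: "real ^ 'm"
  proof -
    have "(\<Sum>b\<in>Basis. (d b * (y \<bullet> b)) *\<^sub>R b) = (\<Sum>i\<in>UNIV. (c i * y $ i) *\<^sub>R ?ax i)"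
      by (simp add: sum.reindex_bij_betw[OF bij, symmetric] d inner_axis)
    also have "\<dots> = ?T y"
      by (simp add: vec_eq_iff axis_def if_distrib[of "(*) _"] cong: if_cong)
    finally show ?thesis by simp
  qed
  have nz: "d b \<noteq> 0" for b unfolding d_def using c by (metis zero_neq_neg_one zero_neq_one)
  have abs1: "(\<Prod>b\<in>Basis. \<bar>d b\<bar>) = 1"
  proof (rule prod.neutral, safe)
    fix b show "\<bar>d b\<bar> = 1" unfolding d_def using c by (metis abs_minus_cancel abs_one)
  qed
  have "lborel = density (distr lborel borel (\<lambda>y :: real ^ 'm. 0 + (\<Sum>b\<in>Basis. (d b * (y \<bullet> b)) *\<^sub>R b)))
      (\<lambda>_. ennreal (\<Prod>b\<in>Basis. \<bar>d b\<bar>))"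
    by (rule lborel_affine_euclidean) (rule nz)
  \<comment> \<open>The flip is a linear map of determinant \<open>1\<close> or \<open>-1\<close>.\<close>
  note L = this[unfolded T abs1 ennreal_1 density_1]
  have pT: "?p (?T y) = ?p y" for y
  proof -
    have "normal_density 0 (sqrt t) (c i * y $ i) = normal_density 0 (sqrt t) (y $ i)" for i
      using c[of i] by (auto simp: normal_density_def)
    then show ?thesis by simp
  qed
  show ?thesis
  proof (rule measure_eqI)
    fix A assume "A \<in> sets (distr (gauss t :: (real ^ 'm) measure) borel ?T)"
    then have [measurable]: "A \<in> sets borel" by simp
    have "emeasure (distr (gauss t) borel ?T) A = (\<integral>\<^sup>+y. indicator A (?T y) \<partial>gauss t)"
      by (subst nn_integral_indicator[symmetric], simp, subst nn_integral_distr) auto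
    also have "\<dots> = (\<integral>\<^sup>+y. ?p (?T y) * indicator A (?T y) \<partial>lborel)"
      unfolding gauss_def pT by (rule nn_integral_density) auto
    also have "\<dots> = (\<integral>\<^sup>+y. ?p y * indicator A y \<partial>(distr lborel borel ?T))"
      by (subst nn_integral_distr) auto
    also have "\<dots> = (\<integral>\<^sup>+y. ?p y * indicator A y \<partial>lborel)" by (simp only: L[symmetric])
    also have "\<dots> = emeasure (gauss t) A"
      unfolding gauss_def by (subst emeasure_density) auto
    finally show "emeasure (distr (gauss t) borel ?T) A = emeasure (gauss t) A" .
  qed simp
qed

lemma gauss_mixed:
  assumes t: "t > 0"
  shows "integrable (gauss t :: (real ^ 'm) measure) (\<lambda>y. y $ k * y $ l)"
    and "(\<integral>y. y $ k * y $ l \<partial>(gauss t :: (real ^ 'm) measure)) = (if k = l then t else 0)"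
proof -
  have i2: "integrable (gauss t :: (real ^ 'm) measure) (\<lambda>y. (y $ i)\<^sup>2)" for i
    using gauss_coord_moment(1)[OF t, of i 1] by simp
  show "integrable (gauss t :: (real ^ 'm) measure) (\<lambda>y. y $ k * y $ l)"
  proof (rule Bochner_Integration.integrable_bound[OF Bochner_Integration.integrable_add[OF i2[of k] i2[of l]]])
    have "\<bar>a * b\<bar> \<le> a\<^sup>2 + b\<^sup>2" for a b :: real
    proof -
      have "2 * (\<bar>a\<bar> * \<bar>b\<bar>) \<le> a\<^sup>2 + b\<^sup>2" using sum_squares_bound[of "\<bar>a\<bar>" "\<bar>b\<bar>"] by simp
      moreover have "0 \<le> \<bar>a\<bar> * \<bar>b\<bar>" by simp
      ultimately show ?thesis unfolding abs_mult by linarith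
    qed
    then show "AE y in gauss t :: (real ^ 'm) measure. norm (y $ k * y $ l) \<le> norm ((y $ k)\<^sup>2 + (y $ l)\<^sup>2)"
      by (intro AE_I2) (simp only: real_norm_def, rule order_trans[OF _ abs_ge_self], simp only:)
  qed simp
  show "(\<integral>y. y $ k * y $ l \<partial>(gauss t :: (real ^ 'm) measure)) = (if k = l then t else 0)"
  proof (cases "k = l")
    case True
    then show ?thesis
      using gauss_coord_moment(2)[OF t, of k 1] by (simp add: gmom_def power2_eq_square)
  next
    case False
    let ?T = "\<lambda>y :: real ^ 'm. \<chi> i. (if i = k then -1 else 1) * y $ i"
    have [measurable]: "?T \<in> borel_measurable borel"
      by (intro borel_measurable_continuous_onI continuous_intros)
    have "(\<integral>y. y $ k * y $ l \<partial>(gauss t :: (real ^ 'm) measure)) = (\<integral>y. y $ k * y $ l \<partial>(distr (gauss t) borel ?T))"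
      by (subst gauss_sign_flip) auto
    also have "\<dots> = (\<integral>y. - (y $ k * y $ l) \<partial>(gauss t :: (real ^ 'm) measure))"
      by (subst integral_distr) (use False in auto)
    finally show ?thesis using False by simp
  qed
qed

lemma gauss_quadratic:
  fixes A :: "real ^ 'm ^ 'm"
  assumes t: "t > 0"
  shows "integrable (gauss t) (\<lambda>y. y \<bullet> (A *v y))"
    and "(\<integral>y. y \<bullet> (A *v y) \<partial>gauss t) = t * trace A"
proof -
  have eq: "y \<bullet> (A *v y) = (\<Sum>k\<in>UNIV. \<Sum>l\<in>UNIV. A $ k $ l * (y $ k * y $ l))" for y
    by (simp add: inner_vec_def matrix_vector_mult_def sum_distrib_left mult_ac)
  show "integrable (gauss t) (\<lambda>y. y \<bullet> (A *v y))"
    unfolding eq by (intro Bochner_Integration.integrable_sum integrable_mult_right gauss_mixed(1)[OF t])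
  have "(\<integral>y. y \<bullet> (A *v y) \<partial>gauss t) = (\<Sum>k\<in>UNIV. \<Sum>l\<in>UNIV. A $ k $ l * (if k = l then t else 0))"
    unfolding eq
    by (simp add: Bochner_Integration.integral_sum gauss_mixed[OF t] Bochner_Integration.integrable_sum)
  also have "\<dots> = (\<Sum>k\<in>UNIV. \<Sum>l\<in>UNIV. if k = l then t * A $ k $ l else 0)"
    by (intro sum.cong) auto
  also have "\<dots> = t * trace A"
    by (simp add: trace_def sum_distrib_left)
  finally show "(\<integral>y. y \<bullet> (A *v y) \<partial>gauss t) = t * trace A" .
qed

lemma gauss_square_inner:
  fixes w :: "real ^ 'm"
  assumes t: "t > 0"
  shows "integrable (gauss t) (\<lambda>y. (w \<bullet> y)\<^sup>2)" and "(\<integral>y. (w \<bullet> y)\<^sup>2 \<partial>gauss t) = t * (norm w)\<^sup>2"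
proof -
  let ?A = "\<chi> k l. w $ k * w $ l"
  have eq: "(w \<bullet> y)\<^sup>2 = y \<bullet> (?A *v y)" for y
    by (simp add: inner_vec_def matrix_vector_mult_def power2_eq_square sum_product sum_distrib_left mult_ac)
  have "trace ?A = (norm w)\<^sup>2"
    by (simp add: trace_def power2_norm_eq_inner inner_vec_def)
  then show "integrable (gauss t) (\<lambda>y. (w \<bullet> y)\<^sup>2)" "(\<integral>y. (w \<bullet> y)\<^sup>2 \<partial>gauss t) = t * (norm w)\<^sup>2"
    unfolding eq using gauss_quadratic[OF t, of ?A] by simp_all
qed

text \<open>The square of the norm is at most \<open>CARD('m)\<close> times the square of the largest coordinate.\<close>

lemma norm_power_le_coords:
  fixes y :: "real ^ 'm"
  shows "norm y ^ (2 * n) \<le> real CARD('m) ^ n * (\<Sum>i\<in>UNIV. (y $ i) ^ (2 * n))"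
proof -
  have "Max (range (\<lambda>i. (y $ i)\<^sup>2)) \<in> range (\<lambda>i. (y $ i)\<^sup>2)" by (intro Max_in) auto
  then obtain k where "Max (range (\<lambda>i. (y $ i)\<^sup>2)) = (y $ k)\<^sup>2" by (elim rangeE)
  then have k: "(y $ i)\<^sup>2 \<le> (y $ k)\<^sup>2" for i
    using Max_ge[of "range (\<lambda>i. (y $ i)\<^sup>2)" "(y $ i)\<^sup>2"] by simp
  have "(norm y)\<^sup>2 = (\<Sum>i\<in>UNIV. (y $ i)\<^sup>2)"
    unfolding power2_norm_eq_inner by (simp add: inner_vec_def power2_eq_square)
  also have "\<dots> \<le> real CARD('m) * (y $ k)\<^sup>2" using sum_bounded_above[of UNIV "\<lambda>i. (y $ i)\<^sup>2"] k by simp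
  finally have "((norm y)\<^sup>2) ^ n \<le> (real CARD('m) * (y $ k)\<^sup>2) ^ n" by (intro power_mono) auto
  also have "\<dots> = real CARD('m) ^ n * (y $ k) ^ (2 * n)" by (simp add: power_mult_distrib power_mult)
  also have "\<dots> \<le> real CARD('m) ^ n * (\<Sum>i\<in>UNIV. (y $ i) ^ (2 * n))"
    by (intro mult_left_mono member_le_sum) (auto simp: power_mult)
  finally show ?thesis by (simp add: power_mult)
qed

lemma gauss_norm_moment:
  assumes t: "t > 0"
  shows "integrable (gauss t :: (real ^ 'm) measure) (\<lambda>y. norm y ^ (2 * n))"
    and "(\<integral>y. norm y ^ (2 * n) \<partial>(gauss t :: (real ^ 'm) measure)) \<le> real CARD('m) ^ n * (real CARD('m) * gmom n) * t ^ n"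
proof -
  have i: "integrable (gauss t :: (real ^ 'm) measure) (\<lambda>y. real CARD('m) ^ n * (\<Sum>i\<in>UNIV. (y $ i) ^ (2 * n)))"
    by (intro integrable_mult_right Bochner_Integration.integrable_sum gauss_coord_moment(1)[OF t])
  show i2: "integrable (gauss t :: (real ^ 'm) measure) (\<lambda>y. norm y ^ (2 * n))"
  proof (rule Bochner_Integration.integrable_bound[OF i])
    show "AE y in gauss t :: (real ^ 'm) measure. norm (norm y ^ (2 * n))
        \<le> norm (real CARD('m) ^ n * (\<Sum>i\<in>UNIV. (y $ i) ^ (2 * n)))"
      using norm_power_le_coords[where 'm = 'm, of _ n] by (auto intro!: AE_I2 intro: order_trans[OF _ abs_ge_self])
  qed simp
  have "(\<integral>y. norm y ^ (2 * n) \<partial>(gauss t :: (real ^ 'm) measure))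
      \<le> (\<integral>y. real CARD('m) ^ n * (\<Sum>i\<in>UNIV. (y $ i) ^ (2 * n)) \<partial>(gauss t :: (real ^ 'm) measure))"
    by (rule integral_mono[OF i2 i norm_power_le_coords])
  also have "\<dots> = real CARD('m) ^ n * (\<Sum>i\<in>(UNIV::'m set). gmom n * t ^ n)"
    by (simp add: Bochner_Integration.integral_sum gauss_coord_moment[OF t])
  finally show "(\<integral>y. norm y ^ (2 * n) \<partial>(gauss t :: (real ^ 'm) measure)) \<le> real CARD('m) ^ n * (real CARD('m) * gmom n) * t ^ n"
    by (simp add: mult_ac)
qed

section \<open>Expected growth over one unconstrained Euler--Maruyama step\<close>

lemma norm_matrix_vector_le: "norm (A *v y) \<le> norm A * norm (y :: real ^ 'n)"
  for A :: "real ^ 'n ^ 'm"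
proof -
  have "(norm (A *v y))\<^sup>2 = (\<Sum>i\<in>UNIV. (A $ i \<bullet> y)\<^sup>2)"
    unfolding power2_norm_eq_inner by (simp add: inner_vec_def matrix_vector_mult_def power2_eq_square)
  also have "\<dots> \<le> (\<Sum>i\<in>UNIV. (norm (A $ i))\<^sup>2 * (norm y)\<^sup>2)"
  proof (rule sum_mono)
    fix i
    have "(A $ i \<bullet> y)\<^sup>2 \<le> (norm (A $ i) * norm y)\<^sup>2"
      using Cauchy_Schwarz_ineq2[of "A $ i" y] by (metis abs_ge_zero power2_abs power_mono)
    then show "(A $ i \<bullet> y)\<^sup>2 \<le> (norm (A $ i))\<^sup>2 * (norm y)\<^sup>2" by (simp add: power_mult_distrib)
  qed
  also have "\<dots> = (norm A * norm y)\<^sup>2"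
    by (simp add: sum_distrib_right[symmetric] power_mult_distrib norm_vec_def L2_set_def sum_nonneg)
  finally show ?thesis by (rule power2_le_imp_le) simp
qed

lemma DD_eq_gradient: "DD v V x = gradient V x \<bullet> v"
  by (simp add: DD_def gradient_def inner_vec_def mult.commute)

lemma DD_DD_eq_hessian:
  assumes "Ck 2 V"
  shows "DD v (DD v V) x = v \<bullet> (hessian V x *v v)"
proof -
  have d: "partial j V differentiable (at y)" for j y
    using assms by (simp add: numeral_2_eq_2)
  have "partial i (DD v V) x = (\<Sum>j\<in>UNIV. v $ j * partial i (partial j V) x)" for i
    unfolding DD_def[abs_def] by (rule partial_lincomb) (auto intro: d)
  then show ?thesis
    by (simp add: DD_def[of v "DD v V"] inner_vec_def matrix_vector_mult_def hessian_def mult.commute)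
qed

context lyapunov_bound begin

text \<open>Along the noise, the second derivative is a quadratic form in the increment, so its expectation
  needs only the covariance \<open>t I\<close>.\<close>

lemma D2pow_quadratic:
  "D2pow V \<rho> x (g *v y) = \<rho> * (\<rho> - 1) * V x powr (\<rho> - 2) * ((gradient V x v* g) \<bullet> y)\<^sup>2
    + \<rho> * V x powr (\<rho> - 1) * (y \<bullet> ((transpose g ** hessian V x ** g) *v y))"
proof -
  have "DD (g *v y) (DD (g *v y) V) x = (g *v y) \<bullet> (hessian V x *v (g *v y))"
    by (rule DD_DD_eq_hessian) (use Ck_mono[OF _ V_Ck] in simp)
  also have "\<dots> = (transpose g *v (hessian V x *v (g *v y))) \<bullet> y"
    by (subst inner_commute) (simp add: dot_lmul_matrix[symmetric])
  also have "\<dots> = y \<bullet> ((transpose g ** hessian V x ** g) *v y)"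
    by (simp add: matrix_vector_mul_assoc matrix_mul_assoc inner_commute del: transpose_matrix_vector)
  finally show ?thesis by (simp add: D2pow_def DD_eq_gradient dot_lmul_matrix)
qed

lemma generator_pow_eq:
  assumes "x \<noteq> 0"
  shows "generator_pow f g V \<rho> x = D1pow V \<rho> x (f x)
    + (\<rho> * (\<rho> - 1) * V x powr (\<rho> - 2) * (norm (gradient V x v* g x))\<^sup>2
      + \<rho> * V x powr (\<rho> - 1) * trace (transpose (g x) ** hessian V x ** g x)) / 2"
proof -
  have e: "V x powr (\<rho> - 1) = V x powr (\<rho> - 2) * V x"
    using powr_add[of "V x" "\<rho> - 2" 1] V_pos[OF assms] by simp
  show ?thesis using assms
    unfolding generator_pow_def generator_def D1pow_def DD_eq_gradient e by (simp add: field_simps)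
qed

lemma V_powr_measurable: "(\<lambda>x. V x powr \<rho>) \<in> borel_measurable borel"
  using borel_measurable_continuous_onI[OF Ck_continuous[OF V_Ck]] by measurable

text \<open>The law of \<open>y\<close> and that of \<open>-y\<close> agree.\<close>

lemma symmetrize_nn_integral:
  fixes g :: "real ^ 'm ^ 'd"
  shows "(\<integral>\<^sup>+y. ennreal (V (m + g *v y) powr \<rho>) \<partial>gauss t)
    = (\<integral>\<^sup>+y. ennreal ((V (m + g *v y) powr \<rho> + V (m - g *v y) powr \<rho>) / 2) \<partial>gauss t)"
proof -
  note [measurable] = V_powr_measurable
  have [measurable]: "(\<lambda>y. g *v y) \<in> borel_measurable borel"
    by (intro borel_measurable_continuous_onI linear_continuous_on bounded_linear_intros) simp
  have neg: "g *v (- y) = - (g *v y)" for y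
    by (rule linear_neg) (rule matrix_vector_mul_linear)
  have flip: "(\<integral>\<^sup>+y. ennreal (V (m + g *v y) powr \<rho> / 2) \<partial>gauss t)
      = (\<integral>\<^sup>+y. ennreal (V (m - g *v y) powr \<rho> / 2) \<partial>gauss t)"
  proof -
    let ?T = "\<lambda>y :: real ^ 'm. \<chi> i. (- 1) * y $ i"
    have T: "?T = uminus" by (auto simp: vec_eq_iff)
    have "distr (gauss t) borel ?T = gauss t" by (rule gauss_sign_flip) simp
    then have "(\<integral>\<^sup>+y. ennreal (V (m + g *v y) powr \<rho> / 2) \<partial>gauss t)
        = (\<integral>\<^sup>+y. ennreal (V (m + g *v y) powr \<rho> / 2) \<partial>(distr (gauss t) borel uminus))"
      unfolding T by simp
    also have "\<dots> = (\<integral>\<^sup>+y. ennreal (V (m - g *v y) powr \<rho> / 2) \<partial>gauss t)"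
      by (subst nn_integral_distr) (auto simp: neg intro!: nn_integral_cong)
    finally show ?thesis .
  qed
  have "(\<integral>\<^sup>+y. ennreal (V (m + g *v y) powr \<rho>) \<partial>gauss t)
      = (\<integral>\<^sup>+y. ennreal (V (m + g *v y) powr \<rho> / 2) + ennreal (V (m + g *v y) powr \<rho> / 2) \<partial>gauss t)"
    by (intro nn_integral_cong) (simp flip: ennreal_plus)
  also have "\<dots> = (\<integral>\<^sup>+y. ennreal (V (m + g *v y) powr \<rho> / 2) + ennreal (V (m - g *v y) powr \<rho> / 2) \<partial>gauss t)"
    by (simp add: nn_integral_add flip)
  also have "\<dots> = (\<integral>\<^sup>+y. ennreal ((V (m + g *v y) powr \<rho> + V (m - g *v y) powr \<rho>) / 2) \<partial>gauss t)"
    by (intro nn_integral_cong) (simp add: add_divide_distrib flip: ennreal_plus)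
  finally show ?thesis .
qed

text \<open>The main terms of the expansion have expectation \<open>V\<^sup>\<rho> + t \<L>V\<^sup>\<rho>\<close>. In the error terms,
  \<open>\<alpha> \<le> h t\<close> and \<open>\<kappa>\<^sup>2 \<le> h |y|\<^sup>2\<close>, and \<open>\<E> |y|\<^sup>2\<^sup>j\<close> is of order \<open>t\<^sup>j\<close>, so that each of them
  is of order \<open>(h t)\<^sup>2\<close> or, for the last one, \<open>(h t)\<^sup>n\<close> with \<open>n \<ge> 2\<close> and \<open>h t \<le> 1\<close>. The constant
  is uniform in \<open>f\<close>, \<open>g\<close>, \<open>x\<close>, \<open>h\<close> and \<open>t\<close>; this allows \<open>h\<close> to grow as \<open>t\<close> tends to zero.\<close>

lemma one_step_moment:
  assumes \<rho>: "\<rho> > 0"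
  obtains C where "C \<ge> 0"
    "\<And>(f :: real ^ 'd \<Rightarrow> real ^ 'd) (g :: real ^ 'd \<Rightarrow> real ^ 'm ^ 'd) x h t.
      x \<noteq> 0 \<Longrightarrow> norm (f x) \<le> h * V x powr \<delta> \<Longrightarrow> (norm (g x))\<^sup>2 \<le> h * (V x powr \<delta>)\<^sup>2 \<Longrightarrow>
      0 < t \<Longrightarrow> 0 \<le> h \<Longrightarrow> h * t \<le> \<epsilon>0 \<Longrightarrow> h * t \<le> 1 \<Longrightarrow>
      (\<integral>\<^sup>+y. ennreal (V (x + t *\<^sub>R f x + g x *v y) powr \<rho>) \<partial>gauss t)
        \<le> ennreal (V x powr \<rho> + t * generator_pow f g V \<rho> x + C * V x powr \<rho> * (h * t)\<^sup>2)"
proof -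
  \<comment> \<open>The exponent for large increments is taken even, as only even moments are at hand, and at least \<open>4\<close>,
    so that \<open>(h t) ^ n\<close> is of the order of the other errors.\<close>
  define n where "n = nat \<lceil>\<rho> / \<delta>\<rceil> + 2"
  have n2: "n \<ge> 2" and nN: "\<rho> / \<delta> \<le> real (2 * n)"
  proof -
    show "n \<ge> 2" unfolding n_def by simp
    have "\<rho> / \<delta> \<le> real (nat \<lceil>\<rho> / \<delta>\<rceil>)" by (rule real_nat_ceiling_ge)
    then show "\<rho> / \<delta> \<le> real (2 * n)" unfolding n_def by simp
  qed
  obtain C where C0: "C \<ge> 0" and C: "\<And>x a s. x \<noteq> 0 \<Longrightarrow> norm a \<le> \<epsilon>0 * V x powr \<delta> \<Longrightarrow>
    (V (x + a + s) powr \<rho> + V (x + a - s) powr \<rho>) / 2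
      \<le> V x powr \<rho> + D1pow V \<rho> x a + D2pow V \<rho> x s / 2
        + C * V x powr \<rho> * ((norm a / V x powr \<delta>)\<^sup>2 + (norm s / V x powr \<delta>)\<^sup>2 * (norm a / V x powr \<delta>)
            + (norm s / V x powr \<delta>) ^ 4 + (norm s / V x powr \<delta>) ^ (2 * n))"
    using symmetrized_increment[OF \<rho> nN] by metis
  define M where "M j = real CARD('m) ^ j * (real CARD('m) * gmom j)" for j
  have M0: "M j \<ge> 0" for j unfolding M_def using gmom_nonneg by simp
  show thesis
  proof (rule that[of "C * (1 + M 1 + M 2 + M n)"])
    show "0 \<le> C * (1 + M 1 + M 2 + M n)" using C0 M0 by simp
    fix f :: "real ^ 'd \<Rightarrow> real ^ 'd" and g :: "real ^ 'd \<Rightarrow> real ^ 'm ^ 'd" and x h t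
    assume x: "x \<noteq> 0" and f: "norm (f x) \<le> h * V x powr \<delta>" and g: "(norm (g x))\<^sup>2 \<le> h * (V x powr \<delta>)\<^sup>2"
      and t: "0 < t" and h: "0 \<le> h" and ht: "h * t \<le> \<epsilon>0" "h * t \<le> 1"
    define r where "r = V x powr \<delta>"
    define w where "w = V x powr \<rho>"
    define a where "a = t *\<^sub>R f x"
    have r: "r > 0" unfolding r_def using V_pos[OF x] by simp
    have w: "w \<ge> 0" unfolding w_def by simp
    have "norm a \<le> t * (h * r)" unfolding a_def using f t by (simp add: r_def mult_left_mono)
    then have a1: "norm a / r \<le> h * t" using r by (simp add: field_simps)
    have a2: "norm a \<le> \<epsilon>0 * r"
    proof -
      have "norm a = (norm a / r) * r" using r by simp
      also have "\<dots> \<le> \<epsilon>0 * r" using a1 ht(1) r by (intro mult_right_mono) auto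
      finally show ?thesis .
    qed
    have s2: "(norm (g x *v y) / r)\<^sup>2 \<le> h * (norm y)\<^sup>2" for y
    proof -
      have "(norm (g x *v y))\<^sup>2 \<le> (norm (g x) * norm y)\<^sup>2"
        by (intro power_mono norm_matrix_vector_le) simp
      also have "\<dots> \<le> (h * r\<^sup>2) * (norm y)\<^sup>2"
        unfolding power_mult_distrib using g by (intro mult_right_mono) (auto simp: r_def)
      finally show ?thesis using r by (simp add: power_divide field_simps)
    qed
    have s2j: "(norm (g x *v y) / r) ^ (2 * j) \<le> h ^ j * norm y ^ (2 * j)" for y j
    proof -
      have "((norm (g x *v y) / r)\<^sup>2) ^ j \<le> (h * (norm y)\<^sup>2) ^ j" by (intro power_mono s2) simp
      then show ?thesis by (simp add: power_mult power_mult_distrib)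
    qed
    let ?D1 = "D1pow V \<rho> x a"
    let ?E = "\<lambda>y :: real ^ 'm. (h * t)\<^sup>2 + h\<^sup>2 * t * norm y ^ (2 * 1) + h\<^sup>2 * norm y ^ (2 * 2) + h ^ n * norm y ^ (2 * n)"
    let ?P = "\<lambda>y. w + ?D1 + D2pow V \<rho> x (g x *v y) / 2 + C * w * ?E y"
    have P: "(V (x + a + g x *v y) powr \<rho> + V (x + a - g x *v y) powr \<rho>) / 2 \<le> ?P y" for y
    proof -
      let ?k = "norm (g x *v y) / r"
      have "(norm a / r)\<^sup>2 \<le> (h * t)\<^sup>2" using a1 r by (intro power_mono) auto
      moreover have "?k\<^sup>2 * (norm a / r) \<le> h\<^sup>2 * t * norm y ^ (2 * 1)"
      proof -
        have "?k\<^sup>2 * (norm a / r) \<le> (h * (norm y)\<^sup>2) * (h * t)"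
          using s2[of y] a1 r h by (intro mult_mono) auto
        then show ?thesis by (simp add: power2_eq_square mult_ac)
      qed
      moreover have "?k ^ 4 \<le> h\<^sup>2 * norm y ^ (2 * 2)" using s2j[of y 2] by simp
      moreover have "?k ^ (2 * n) \<le> h ^ n * norm y ^ (2 * n)" by (rule s2j)
      ultimately have "C * w * ((norm a / r)\<^sup>2 + ?k\<^sup>2 * (norm a / r) + ?k ^ 4 + ?k ^ (2 * n)) \<le> C * w * ?E y"
        using C0 w by (intro mult_left_mono add_mono) auto
      then show ?thesis
        using C[OF x, of a "g x *v y"] a2 unfolding r_def[symmetric] w_def[symmetric] by linarith
    qed
    let ?G = "gradient V x v* g x" and ?H = "transpose (g x) ** hessian V x ** g x"
    let ?T = "\<rho> * (\<rho> - 1) * V x powr (\<rho> - 2) * (norm ?G)\<^sup>2 + \<rho> * V x powr (\<rho> - 1) * trace ?H"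
    note int = gauss_quadratic[OF t, of ?H] gauss_square_inner[OF t, of ?G] gauss_norm_moment(1)[OF t, where 'm = 'm]
    interpret G: prob_space "gauss t :: (real ^ 'm) measure" by (rule prob_space_gauss[OF t])
    have pU: "G.prob UNIV = 1" using G.prob_space by simp
    have iD: "integrable (gauss t) (\<lambda>y. D2pow V \<rho> x (g x *v y))"
      unfolding D2pow_quadratic
      by (intro Bochner_Integration.integrable_add integrable_mult_right int)
    have ID: "(\<integral>y. D2pow V \<rho> x (g x *v y) \<partial>gauss t) = t * ?T"
      unfolding D2pow_quadratic using int by (simp add: algebra_simps)
    have iE: "integrable (gauss t :: (real ^ 'm) measure) ?E"
      by (intro Bochner_Integration.integrable_add integrable_mult_right int G.integrable_const)
    have IE: "(\<integral>y. ?E y \<partial>(gauss t :: (real ^ 'm) measure)) \<le> (1 + M 1 + M 2 + M n) * (h * t)\<^sup>2"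
    proof -
      have m: "(\<integral>y. norm y ^ (2 * j) \<partial>(gauss t :: (real ^ 'm) measure)) \<le> M j * t ^ j" for j
        unfolding M_def by (rule gauss_norm_moment(2)[OF t])
      have "(\<integral>y. ?E y \<partial>(gauss t :: (real ^ 'm) measure))
          = (h * t)\<^sup>2 + h\<^sup>2 * t * (\<integral>y. norm y ^ (2 * 1) \<partial>(gauss t :: (real ^ 'm) measure))
            + h\<^sup>2 * (\<integral>y. norm y ^ (2 * 2) \<partial>(gauss t :: (real ^ 'm) measure))
            + h ^ n * (\<integral>y. norm y ^ (2 * n) \<partial>(gauss t :: (real ^ 'm) measure))"
        using int(5)[of 1] int(5)[of 2] int(5)[of n]
        by (simp add: pU del: mult_1_right)
      also have "\<dots> \<le> (h * t)\<^sup>2 + h\<^sup>2 * t * (M 1 * t ^ 1) + h\<^sup>2 * (M 2 * t ^ 2) + h ^ n * (M n * t ^ n)"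
        using h t by (intro add_mono mult_left_mono m order_refl) auto
      also have "\<dots> = (h * t)\<^sup>2 + M 1 * (h * t)\<^sup>2 + M 2 * (h * t)\<^sup>2 + M n * (h * t) ^ n"
        by (simp add: power_mult_distrib power2_eq_square mult_ac)
      also have "\<dots> \<le> (h * t)\<^sup>2 + M 1 * (h * t)\<^sup>2 + M 2 * (h * t)\<^sup>2 + M n * (h * t)\<^sup>2"
        using h t ht(2) n2 M0 by (intro add_mono mult_left_mono power_decreasing order_refl) auto
      finally show ?thesis by (simp add: algebra_simps)
    qed
    have iP: "integrable (gauss t) ?P"
      by (intro Bochner_Integration.integrable_add integrable_mult_right iE G.integrable_const
          integrable_divide iD)
    have "(\<integral>y. ?P y \<partial>gauss t) = w + ?D1 + t * ?T / 2 + C * w * (\<integral>y. ?E y \<partial>(gauss t :: (real ^ 'm) measure))"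
    proof -
      have "(\<integral>y. ?P y \<partial>gauss t) = (\<integral>y. w + ?D1 + D2pow V \<rho> x (g x *v y) / 2 \<partial>gauss t) + (\<integral>y. C * w * ?E y \<partial>gauss t)"
        by (rule Bochner_Integration.integral_add)
          (intro Bochner_Integration.integrable_add integrable_mult_right iE G.integrable_const integrable_divide iD)+
      also have "(\<integral>y. w + ?D1 + D2pow V \<rho> x (g x *v y) / 2 \<partial>gauss t) = w + ?D1 + t * ?T / 2"
        using iD by (simp add: ID pU)
      finally show ?thesis by (simp only: integral_mult_right_zero)
    qed
    also have "\<dots> \<le> w + ?D1 + t * ?T / 2 + C * w * ((1 + M 1 + M 2 + M n) * (h * t)\<^sup>2)"
      using C0 w by (intro add_left_mono mult_left_mono IE) auto
    also have "\<dots> = w + t * generator_pow f g V \<rho> x + C * (1 + M 1 + M 2 + M n) * w * (h * t)\<^sup>2"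
    proof -
      have "?D1 = t * D1pow V \<rho> x (f x)" by (simp add: a_def D1pow_def DD_eq_gradient)
      then show ?thesis unfolding generator_pow_eq[OF x] by (simp add: algebra_simps add_divide_distrib)
    qed
    finally have IP: "(\<integral>y. ?P y \<partial>gauss t) \<le> w + t * generator_pow f g V \<rho> x + C * (1 + M 1 + M 2 + M n) * w * (h * t)\<^sup>2" .
    have "(\<integral>\<^sup>+y. ennreal (V (x + a + g x *v y) powr \<rho>) \<partial>gauss t)
        = (\<integral>\<^sup>+y. ennreal ((V (x + a + g x *v y) powr \<rho> + V (x + a - g x *v y) powr \<rho>) / 2) \<partial>gauss t)"
      by (rule symmetrize_nn_integral)
    also have "\<dots> \<le> (\<integral>\<^sup>+y. ennreal (?P y) \<partial>gauss t)"
      by (intro nn_integral_mono ennreal_leI P)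
    also have "\<dots> = ennreal (\<integral>y. ?P y \<partial>gauss t)"
    proof (rule nn_integral_eq_integral[OF iP], rule AE_I2)
      fix y
      have "0 \<le> (V (x + a + g x *v y) powr \<rho> + V (x + a - g x *v y) powr \<rho>) / 2" by simp
      also note P[of y]
      finally show "0 \<le> ?P y" .
    qed
    also have "\<dots> \<le> ennreal (w + t * generator_pow f g V \<rho> x + C * (1 + M 1 + M 2 + M n) * w * (h * t)\<^sup>2)"
      by (intro ennreal_leI IP)
    finally show "(\<integral>\<^sup>+y. ennreal (V (x + t *\<^sub>R f x + g x *v y) powr \<rho>) \<partial>gauss t)
        \<le> ennreal (V x powr \<rho> + t * generator_pow f g V \<rho> x + C * (1 + M 1 + M 2 + M n) * V x powr \<rho> * (h * t)\<^sup>2)"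
      unfolding a_def w_def .
  qed
qed

end

section \<open>Truncation and its radius\<close>

lemma truncation_norm_le:
  assumes "0 \<le> inv_into {0<..} \<phi> (K * \<Delta> powr (- \<theta>))"
  shows "norm (truncation \<phi> K \<theta> \<Delta> x) \<le> inv_into {0<..} \<phi> (K * \<Delta> powr (- \<theta>))"
  using assms by (cases "x = 0") (auto simp: truncation_def norm_sgn)

lemma truncation_0: "truncation \<phi> K \<theta> \<Delta> 0 = 0"
  by (simp add: truncation_def)

lemma truncation_decreases:
  fixes V :: "real ^ 'd \<Rightarrow> real"
  assumes "0 < inv_into {0<..} \<phi> (K * \<Delta> powr (- \<theta>))"
    and mono: "\<And>x \<epsilon>. 0 < \<epsilon> \<Longrightarrow> \<epsilon> \<le> 1 \<Longrightarrow> V (\<epsilon> *\<^sub>R x) \<le> V x"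
  shows "V (truncation \<phi> K \<theta> \<Delta> x) \<le> V x"
proof (cases "x = 0")
  case True
  then show ?thesis by (simp add: truncation_0)
next
  case False
  define R where "R = inv_into {0<..} \<phi> (K * \<Delta> powr (- \<theta>))"
  have "truncation \<phi> K \<theta> \<Delta> x = (min (norm x) R / norm x) *\<^sub>R x"
    by (simp add: truncation_def R_def sgn_div_norm divide_inverse)
  moreover have "0 < min (norm x) R / norm x" "min (norm x) R / norm x \<le> 1"
    using False assms(1) by (auto simp: R_def)
  ultimately show ?thesis using mono by simp
qed

lemma truncation_measurable [measurable]: "truncation \<phi> K \<theta> \<Delta> \<in> borel_measurable borel"
  unfolding truncation_def[abs_def] by measurable

text \<open>The value \<open>y\<close> is attained at or beyond \<open>m\<close>, by continuity and divergence, so the inverse is not a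
  default value.\<close>

lemma truncation_radius:
  fixes \<phi> :: "real \<Rightarrow> real"
  assumes mono: "strict_mono_on {0<..} \<phi>" and cont: "continuous_on {0<..} \<phi>"
    and top: "filterlim \<phi> at_top at_top" and m: "0 < m" and y: "\<phi> m \<le> y"
  shows "\<phi> (inv_into {0<..} \<phi> y) = y" "m \<le> inv_into {0<..} \<phi> y"
proof -
  obtain u where u: "u \<ge> m" "\<phi> u \<ge> y"
  proof -
    have "eventually (\<lambda>u. \<phi> u \<ge> y \<and> u \<ge> m) at_top"
      by (intro eventually_conj eventually_ge_at_top filterlim_at_top[THEN iffD1, rule_format, OF top])
    then obtain u where "\<phi> u \<ge> y \<and> u \<ge> m" using eventually_happens'[OF trivial_limit_at_top_linorder] by blast
    then show thesis using that by blast
  qed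
  have "continuous_on {m..u} \<phi>" by (rule continuous_on_subset[OF cont]) (use m in auto)
  then obtain v where v: "m \<le> v" "v \<le> u" "\<phi> v = y" using IVT'[of \<phi> m y u] y u by auto
  have "inv_into {0<..} \<phi> y = v"
    unfolding v(3)[symmetric] by (rule inv_into_f_f[OF strict_mono_on_imp_inj_on[OF mono]]) (use v m in simp)
  then show "\<phi> (inv_into {0<..} \<phi> y) = y" "m \<le> inv_into {0<..} \<phi> y" using v by auto
qed

section \<open>The moment recursion along the scheme\<close>

text \<open>Conditioning on \<open>\<F>\<^sub>s\<close>: the increment is independent of \<open>X\<close>, so the joint law is a product
  and the increment can be integrated out first.\<close>

lemma (in filtered_brownian_motion) nn_integral_increment:
  fixes X :: "'a \<Rightarrow> real ^ 'd" and H :: "real ^ 'd \<Rightarrow> real ^ 'm \<Rightarrow> ennreal"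
  assumes st: "0 \<le> s" "s < t" and X: "X \<in> borel_measurable (F s)"
    and H [measurable]: "case_prod H \<in> borel_measurable (borel \<Otimes>\<^sub>M borel)"
  shows "(\<integral>\<^sup>+\<omega>. H (X \<omega>) (B t \<omega> - B s \<omega>) \<partial>M) = (\<integral>\<^sup>+\<omega>. (\<integral>\<^sup>+y. H (X \<omega>) y \<partial>gauss (t - s)) \<partial>M)"
proof -
  let ?Y = "\<lambda>\<omega>. B t \<omega> - B s \<omega>"
  have sub: "subalgebra M (F s)" by (rule subalgebra_F[OF st(1)])
  have XM [measurable]: "X \<in> borel_measurable M" by (rule measurable_from_subalg[OF sub X])
  note D = B_increment_normal[OF st]
  have YM [measurable]: "?Y \<in> borel_measurable M" using distributed_measurable[OF D] by simp
  have dY: "distr M borel ?Y = gauss (t - s)"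
  proof -
    have "distr M borel ?Y = distr M lborel ?Y" by (rule distr_cong) auto
    also have "\<dots> = gauss (t - s)" using distributed_distr_eq_density[OF D] by (simp add: gauss_def)
    finally show ?thesis .
  qed
  interpret G: prob_space "gauss (t - s) :: (real ^ 'm) measure" by (rule prob_space_gauss) (use st in simp)
  interpret X: prob_space "distr M borel X" by (rule prob_space_distr) simp
  have joint: "distr M borel X \<Otimes>\<^sub>M gauss (t - s) = distr M (borel \<Otimes>\<^sub>M borel) (\<lambda>\<omega>. (X \<omega>, ?Y \<omega>))"
  proof (rule pair_measure_eqI)
    fix A C assume "A \<in> sets (distr M borel X)" "C \<in> sets (gauss (t - s) :: (real ^ 'm) measure)"
    then have [measurable]: "A \<in> sets borel" "C \<in> sets borel" by simp_all
    let ?a = "X -` A \<inter> space M" and ?b = "?Y -` C \<inter> space M"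
    have "?a \<in> sets (F s)" using measurable_sets[OF X, of A] sub by (simp add: subalgebra_def)
    moreover have "?b \<in> sets (vimage_algebra (space M) ?Y borel)" by (rule in_vimage_algebra) simp
    ultimately have p: "prob (?a \<inter> ?b) = prob ?a * prob ?b"
      by (rule indep_setD[OF B_increment_indep[OF st]])
    have "emeasure (distr M borel X) A * emeasure (gauss (t - s)) C = emeasure M ?a * emeasure M ?b"
      unfolding dY[symmetric] by (simp add: emeasure_distr)
    also have "\<dots> = emeasure M (?a \<inter> ?b)"
      by (simp add: emeasure_eq_measure p ennreal_mult')
    also have "?a \<inter> ?b = (\<lambda>\<omega>. (X \<omega>, ?Y \<omega>)) -` (A \<times> C) \<inter> space M" by auto
    also have "emeasure M \<dots> = emeasure (distr M (borel \<Otimes>\<^sub>M borel) (\<lambda>\<omega>. (X \<omega>, ?Y \<omega>))) (A \<times> C)"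
      by (subst emeasure_distr) auto
    finally show "emeasure (distr M borel X) A * emeasure (gauss (t - s)) C
      = emeasure (distr M (borel \<Otimes>\<^sub>M borel) (\<lambda>\<omega>. (X \<omega>, ?Y \<omega>))) (A \<times> C)" .
  qed (simp_all add: X.sigma_finite_measure_axioms G.sigma_finite_measure_axioms cong: sets_pair_measure_cong)
  have "(\<integral>\<^sup>+\<omega>. H (X \<omega>) (?Y \<omega>) \<partial>M) = (\<integral>\<^sup>+z. case_prod H z \<partial>distr M (borel \<Otimes>\<^sub>M borel) (\<lambda>\<omega>. (X \<omega>, ?Y \<omega>)))"
    by (subst nn_integral_distr) auto
  also have "distr M (borel \<Otimes>\<^sub>M borel) (\<lambda>\<omega>. (X \<omega>, ?Y \<omega>)) = distr M borel X \<Otimes>\<^sub>M gauss (t - s)"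
    by (rule joint[symmetric])
  also have "(\<integral>\<^sup>+z. case_prod H z \<partial>(distr M borel X \<Otimes>\<^sub>M gauss (t - s)))
      = (\<integral>\<^sup>+x. (\<integral>\<^sup>+y. H x y \<partial>gauss (t - s)) \<partial>distr M borel X)"
  proof -
    have "case_prod H \<in> borel_measurable (distr M borel X \<Otimes>\<^sub>M gauss (t - s))"
      by measurable
    from G.nn_integral_fst[OF this] show ?thesis by simp
  qed
  also have "\<dots> = (\<integral>\<^sup>+\<omega>. (\<integral>\<^sup>+y. H (X \<omega>) y \<partial>gauss (t - s)) \<partial>M)"
  proof (rule nn_integral_distr[OF XM])
    show "(\<lambda>x. \<integral>\<^sup>+y. H x y \<partial>gauss (t - s)) \<in> borel_measurable (distr M borel X)"
      by measurable
  qed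
  finally show ?thesis .
qed

lemma EM_step_measurable:
  fixes f :: "real ^ 'd \<Rightarrow> real ^ 'd" and g :: "real ^ 'd \<Rightarrow> real ^ 'm ^ 'd"
  assumes "continuous_on UNIV f" "continuous_on UNIV g"
  shows "(\<lambda>(z, b). z + \<Delta> *\<^sub>R f z + g z *v b) \<in> borel_measurable (borel \<Otimes>\<^sub>M borel)"
proof -
  have cf: "continuous_on UNIV (\<lambda>p :: (real ^ 'd) \<times> (real ^ 'm). f (fst p))"
    by (intro continuous_on_compose2[OF assms(1)] continuous_intros) auto
  have cg: "continuous_on UNIV (\<lambda>p :: (real ^ 'd) \<times> (real ^ 'm). g (fst p))"
    by (intro continuous_on_compose2[OF assms(2)] continuous_intros) auto
  have "continuous_on UNIV (\<lambda>p :: (real ^ 'd) \<times> (real ^ 'm). fst p + \<Delta> *\<^sub>R f (fst p) + g (fst p) *v snd p)"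
    unfolding matrix_vector_mult_def by (intro continuous_intros cf cg)
  then show ?thesis
    unfolding borel_prod case_prod_beta by (rule borel_measurable_continuous_onI)
qed

context filtered_brownian_motion begin

lemma truncated_EM_adapted:
  assumes "continuous_on UNIV f" "continuous_on UNIV g" and \<Delta>: "0 < \<Delta>"
  shows "truncated_EM f g B \<phi> K \<theta> x0 \<Delta> k \<in> borel_measurable (F (real k * \<Delta>))"
proof (induction k)
  case 0
  then show ?case by simp
next
  case (Suc k)
  let ?s = "real k * \<Delta>" and ?t = "real (Suc k) * \<Delta>"
  have st: "0 \<le> ?s" "?s \<le> ?t" "0 \<le> ?t" using \<Delta> by (auto simp: algebra_simps)
  have "space (F ?s) = space (F ?t)"
    using subalgebra_F[OF st(1)] subalgebra_F[OF st(3)] by (simp add: subalgebra_def)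
  then have "subalgebra (F ?t) (F ?s)"
    using F_mono[OF st(1,2)] by (simp add: subalgebra_def)
  note later = measurable_from_subalg[OF this]
  note [measurable] = later[OF Suc] later[OF B_adapted[OF st(1)]] B_adapted[OF st(3)]
  note [measurable] = EM_step_measurable[OF assms(1,2), of \<Delta>]
  have "(\<lambda>\<omega>. truncation \<phi> K \<theta> \<Delta> (case (truncated_EM f g B \<phi> K \<theta> x0 \<Delta> k \<omega>, B ?t \<omega> - B ?s \<omega>) of
      (z, b) \<Rightarrow> z + \<Delta> *\<^sub>R f z + g z *v b)) \<in> borel_measurable (F ?t)"
    by measurable
  then show ?case by (simp add: Let_def cong: measurable_cong)
qed

text \<open>A one-step contraction on the ball of the truncation radius is enough, since the scheme never leaves
  this ball.\<close>

lemma truncated_EM_moment_decay: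
  fixes f :: "real ^ 'd \<Rightarrow> real ^ 'd" and g :: "real ^ 'd \<Rightarrow> real ^ 'm ^ 'd" and W :: "real ^ 'd \<Rightarrow> real"
  assumes cont: "continuous_on UNIV f" "continuous_on UNIV g" and \<Delta>: "0 < \<Delta>"
    and W [measurable]: "W \<in> borel_measurable borel" and W0: "\<And>z. 0 \<le> W z" and q: "0 \<le> q"
    and x0: "norm x0 \<le> inv_into {0<..} \<phi> (K * \<Delta> powr (- \<theta>))"
    and step: "\<And>z. norm z \<le> inv_into {0<..} \<phi> (K * \<Delta> powr (- \<theta>)) \<Longrightarrow>
      (\<integral>\<^sup>+y. ennreal (W (truncation \<phi> K \<theta> \<Delta> (z + \<Delta> *\<^sub>R f z + g z *v y))) \<partial>gauss \<Delta>) \<le> ennreal (q * W z)"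
  shows "(\<integral>\<^sup>+\<omega>. ennreal (W (truncated_EM f g B \<phi> K \<theta> x0 \<Delta> k \<omega>)) \<partial>M) \<le> ennreal (q ^ k * W x0)"
proof (induction k)
  case 0
  then show ?case by (simp add: emeasure_space_1)
next
  case (Suc k)
  let ?Z = "truncated_EM f g B \<phi> K \<theta> x0 \<Delta>" and ?s = "real k * \<Delta>" and ?t = "real (Suc k) * \<Delta>"
  let ?H = "\<lambda>z y. ennreal (W (truncation \<phi> K \<theta> \<Delta> (z + \<Delta> *\<^sub>R f z + g z *v y)))"
  have st: "0 \<le> ?s" "?s < ?t" "?t - ?s = \<Delta>" using \<Delta> by (auto simp: algebra_simps)
  note adapted = truncated_EM_adapted[OF cont \<Delta>, of \<phi> K \<theta> x0 k]
  have [measurable]: "?Z k \<in> borel_measurable M"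
    by (rule measurable_from_subalg[OF subalgebra_F[OF st(1)] adapted])
  have range: "norm (?Z k \<omega>) \<le> inv_into {0<..} \<phi> (K * \<Delta> powr (- \<theta>))" for \<omega>
    using x0 truncation_norm_le[of \<phi> K \<Delta> \<theta>] order_trans[OF norm_ge_zero x0] by (cases k) (auto simp: Let_def)
  note [measurable] = EM_step_measurable[OF cont, of \<Delta>]
  have "case_prod ?H = (\<lambda>p. ennreal (W (truncation \<phi> K \<theta> \<Delta> (case p of (z, b) \<Rightarrow> z + \<Delta> *\<^sub>R f z + g z *v b))))"
    by (auto simp: fun_eq_iff)
  then have H: "case_prod ?H \<in> borel_measurable (borel \<Otimes>\<^sub>M borel)" by simp
  have "(\<integral>\<^sup>+\<omega>. ennreal (W (?Z (Suc k) \<omega>)) \<partial>M) = (\<integral>\<^sup>+\<omega>. ?H (?Z k \<omega>) (B ?t \<omega> - B ?s \<omega>) \<partial>M)"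
    by (simp add: Let_def)
  also have "\<dots> = (\<integral>\<^sup>+\<omega>. (\<integral>\<^sup>+y. ?H (?Z k \<omega>) y \<partial>gauss \<Delta>) \<partial>M)"
    using nn_integral_increment[OF st(1,2) adapted H] unfolding st(3) .
  also have "\<dots> \<le> (\<integral>\<^sup>+\<omega>. ennreal (q * W (?Z k \<omega>)) \<partial>M)"
    by (intro nn_integral_mono step range)
  also have "\<dots> = ennreal q * (\<integral>\<^sup>+\<omega>. ennreal (W (?Z k \<omega>)) \<partial>M)"
    using q by (simp add: ennreal_mult' nn_integral_cmult)
  also have "\<dots> \<le> ennreal q * ennreal (q ^ k * W x0)" by (intro mult_left_mono Suc.IH) simp
  also have "\<dots> = ennreal (q ^ Suc k * W x0)" using q by (simp add: ennreal_mult'[symmetric] mult.assoc)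
  finally show ?case .
qed

end

section \<open>From moment decay to growth rates\<close>

lemma elog_divide_pos: "0 < y \<Longrightarrow> 0 < z \<Longrightarrow> elog y / ereal z = ereal (ln y / z)"
  by (simp add: elog_def)

lemma elog_divide_nonpos: "y \<le> 0 \<Longrightarrow> 0 < z \<Longrightarrow> elog y / ereal z = - \<infinity>"
  by (simp add: elog_def)

lemma limsup_elog_le:
  assumes A: "A > 0" and d: "d > 0" and y: "\<And>k. y k \<le> A * exp (- b * (real k * d))"
  shows "limsup (\<lambda>k. elog (y k) / ereal (real k * d)) \<le> ereal (- b)"
proof -
  have "limsup (\<lambda>k. elog (y k) / ereal (real k * d)) \<le> limsup (\<lambda>k. ereal (ln A / (real k * d) - b))"
  proof (rule Limsup_mono, rule eventually_mono[OF eventually_gt_at_top[of 0]])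
    fix k :: nat assume k: "k > 0"
    then have kd: "real k * d > 0" using d by simp
    show "elog (y k) / ereal (real k * d) \<le> ereal (ln A / (real k * d) - b)"
    proof (cases "y k \<le> 0")
      case True
      then show ?thesis using elog_divide_nonpos[OF True kd] by simp
    next
      case False
      then have "ln (y k) \<le> ln (A * exp (- b * (real k * d)))" using y[of k] by simp
      also have "\<dots> = ln A - b * (real k * d)" using A by (simp add: ln_mult)
      finally have "ln (y k) / (real k * d) \<le> (ln A - b * (real k * d)) / (real k * d)"
        using kd by (intro divide_right_mono) auto
      also have "\<dots> = ln A / (real k * d) - b" using k d by (simp add: field_simps)
      finally show ?thesis using False elog_divide_pos[OF _ kd, of "y k"] by simp
    qed
  qed
  also have "\<dots> = ereal (- b)"
  proof (rule lim_imp_Limsup)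
    have "(\<lambda>k. ln A / d * (1 / real k) - b) \<longlonglongrightarrow> ln A / d * 0 - b"
      by (intro tendsto_intros lim_1_over_n)
    then have "(\<lambda>k. ln A / (real k * d) - b) \<longlonglongrightarrow> - b" by (simp add: mult.commute)
    then show "(\<lambda>k. ereal (ln A / (real k * d) - b)) \<longlonglongrightarrow> ereal (- b)" by simp
  qed simp
  finally show ?thesis .
qed

lemma limsup_elog_root_le:
  assumes d: "d > 0" and \<rho>: "\<rho> > 0" and v: "\<And>k. v k \<ge> 0"
    and ev: "eventually (\<lambda>k. v k powr \<rho> \<le> exp (- b * (real k * d))) sequentially"
  shows "limsup (\<lambda>k. elog (v k) / ereal (real k * d)) \<le> ereal (- (b / \<rho>))"
proof (rule Limsup_bounded, rule eventually_mono[OF eventually_conj[OF ev eventually_gt_at_top[of 0]]])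
  fix k assume k: "v k powr \<rho> \<le> exp (- b * (real k * d)) \<and> 0 < k"
  then have kd: "real k * d > 0" using d by simp
  show "elog (v k) / ereal (real k * d) \<le> ereal (- (b / \<rho>))"
  proof (cases "v k \<le> 0")
    case True
    then show ?thesis using elog_divide_nonpos[OF True kd] by simp
  next
    case False
    then have "ln (v k powr \<rho>) \<le> ln (exp (- b * (real k * d)))" using k by (subst ln_le_cancel_iff) auto
    then have "\<rho> * ln (v k) \<le> - b * (real k * d)" using False by (simp add: ln_powr)
    then have "ln (v k) \<le> - (b / \<rho>) * (real k * d)" using \<rho> by (simp add: field_simps)
    then have "ln (v k) / (real k * d) \<le> - (b / \<rho>)" by (simp only: pos_divide_le_eq[OF kd])
    then show ?thesis using False elog_divide_pos[OF _ kd, of "v k"] by simp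
  qed
qed

text \<open>The rescaled series \<open>\<Sum>\<^sub>k exp(c k d) W\<^sub>k\<close> has finite expectation, hence converges almost surely,
  and its terms are eventually smaller than one.\<close>

lemma AE_eventually_le_of_summable_decay:
  fixes W :: "nat \<Rightarrow> 'a \<Rightarrow> real"
  assumes [measurable]: "\<And>k. W k \<in> borel_measurable M" and d: "d > 0" and bc: "c < b" and A: "A \<ge> 0"
    and W: "\<And>k \<omega>. 0 \<le> W k \<omega>"
    and m: "\<And>k. (\<integral>\<^sup>+\<omega>. ennreal (W k \<omega>) \<partial>M) \<le> ennreal (A * exp (- b * (real k * d)))"
  shows "AE \<omega> in M. eventually (\<lambda>k. W k \<omega> \<le> exp (- c * (real k * d))) sequentially"
proof -
  let ?Y = "\<lambda>k \<omega>. exp (c * (real k * d)) * W k \<omega>"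
  let ?q = "exp (- (b - c) * d)"
  have "(b - c) * d > 0" using d bc by simp
  then have q: "0 \<le> ?q" "?q < 1" by (simp_all only: exp_ge_zero minus_mult_left[symmetric] exp_less_one_iff neg_less_0_iff_less)
  have tm: "(\<integral>\<^sup>+\<omega>. ennreal (?Y k \<omega>) \<partial>M) \<le> ennreal (A * ?q ^ k)" for k
  proof -
    have "(\<integral>\<^sup>+\<omega>. ennreal (?Y k \<omega>) \<partial>M) = ennreal (exp (c * (real k * d))) * (\<integral>\<^sup>+\<omega>. ennreal (W k \<omega>) \<partial>M)"
      using W by (subst nn_integral_cmult[symmetric]) (auto simp: ennreal_mult)
    also have "\<dots> \<le> ennreal (exp (c * (real k * d))) * ennreal (A * exp (- b * (real k * d)))"
      by (intro mult_left_mono m) simp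
    also have "\<dots> = ennreal (A * ?q ^ k)"
      by (simp add: ennreal_mult'[symmetric] exp_of_nat_mult[symmetric] exp_add[symmetric] algebra_simps)
    finally show ?thesis .
  qed
  have "(\<integral>\<^sup>+\<omega>. (\<Sum>k. ennreal (?Y k \<omega>)) \<partial>M) = (\<Sum>k. \<integral>\<^sup>+\<omega>. ennreal (?Y k \<omega>) \<partial>M)"
    by (rule nn_integral_suminf) simp
  also have "\<dots> \<le> (\<Sum>k. ennreal (A * ?q ^ k))" by (intro suminf_le tm) auto
  also have "\<dots> < \<infinity>"
  proof -
    have "summable (\<lambda>k. A * ?q ^ k)" using q by (intro summable_mult summable_geometric) auto
    then show ?thesis using A q by (subst suminf_ennreal2) auto
  qed
  finally have "AE \<omega> in M. (\<Sum>k. ennreal (?Y k \<omega>)) \<noteq> \<infinity>"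
    by (intro nn_integral_PInf_AE) auto
  then show ?thesis
  proof eventually_elim
    fix \<omega> assume s: "(\<Sum>k. ennreal (?Y k \<omega>)) \<noteq> \<infinity>"
    have "summable (\<lambda>k. ?Y k \<omega>)" by (rule summable_suminf_not_top) (use s W in auto)
    then have "(\<lambda>k. ?Y k \<omega>) \<longlonglongrightarrow> 0" by (rule summable_LIMSEQ_zero)
    then have "eventually (\<lambda>k. ?Y k \<omega> < 1) sequentially" by (rule order_tendstoD) simp
    then show "eventually (\<lambda>k. W k \<omega> \<le> exp (- c * (real k * d))) sequentially"
    proof eventually_elim
      fix k assume "?Y k \<omega> < 1"
      then show "W k \<omega> \<le> exp (- c * (real k * d))" by (simp add: exp_minus field_simps)
    qed
  qed
qed

section \<open>Exponential stability of the scheme\<close>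

text \<open>With \<open>h = K t\<^sup>-\<^sup>\<theta>\<close>, the product \<open>h t\<close> is of order \<open>t\<^sup>1\<^sup>-\<^sup>\<theta>\<close>, and \<open>(h t)\<^sup>2 / t\<close> is of order \<open>t\<^sup>1\<^sup>-\<^sup>2\<^sup>\<theta>\<close>; the
  latter tends to zero because \<open>\<theta> < 1/2\<close>.\<close>

lemma small_step_size:
  fixes C K \<theta> \<eta> e :: real
  assumes "0 < \<theta>" "\<theta> < 1 / 2" "0 < \<eta>" "0 < e"
  obtains d where "d > 0" "\<And>t. 0 < t \<Longrightarrow> t < d \<Longrightarrow>
    K * t powr (- \<theta>) * t \<le> e \<and> C * (K * t powr (- \<theta>) * t)\<^sup>2 \<le> \<eta> * t"
proof -
  have lim: "((\<lambda>t::real. c * t powr a) \<longlongrightarrow> 0) (at_right 0)" if "a > 0" for a c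
  proof -
    have "((\<lambda>t::real. t powr a) \<longlongrightarrow> 0 powr a) (at_right 0)"
      using that by (intro tendsto_powr') (auto simp: eventually_at_filter intro!: always_eventually)
    from tendsto_mult_left[OF this, of c] show ?thesis by simp
  qed
  have "eventually (\<lambda>t. K * t powr (1 - \<theta>) < e) (at_right 0)"
    using assms by (intro order_tendstoD(2)[OF lim]) auto
  moreover have "eventually (\<lambda>t. C * K\<^sup>2 * t powr (1 - 2 * \<theta>) < \<eta>) (at_right 0)"
    using assms by (intro order_tendstoD(2)[OF lim]) auto
  ultimately have "eventually (\<lambda>t. K * t powr (1 - \<theta>) < e \<and> C * K\<^sup>2 * t powr (1 - 2 * \<theta>) < \<eta>) (at_right 0)"
    by eventually_elim simp
  then obtain d where d: "d > 0" "\<And>t. 0 < t \<Longrightarrow> t < d \<Longrightarrow> K * t powr (1 - \<theta>) < e \<and> C * K\<^sup>2 * t powr (1 - 2 * \<theta>) < \<eta>"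
    unfolding eventually_at_right_field by auto
  show thesis
  proof (rule that[OF d(1)])
    fix t :: real assume t: "0 < t" "t < d"
    have 1: "t powr (- \<theta>) * t = t powr (1 - \<theta>)" using powr_add[of t "- \<theta>" 1] t by simp
    have 2: "(t powr (1 - \<theta>))\<^sup>2 = t powr (1 - 2 * \<theta>) * t"
    proof -
      have "(t powr (1 - \<theta>))\<^sup>2 = t powr ((1 - \<theta>) + (1 - \<theta>))" by (simp only: power2_eq_square powr_add)
      also have "\<dots> = t powr ((1 - 2 * \<theta>) + 1)" by simp
      also have "\<dots> = t powr (1 - 2 * \<theta>) * t" using t by (simp only: powr_add) simp
      finally show ?thesis .
    qed
    have "C * (K * t powr (- \<theta>) * t)\<^sup>2 = C * K\<^sup>2 * t powr (1 - 2 * \<theta>) * t"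
      by (simp only: mult.assoc 1 power_mult_distrib 2)
    also have "\<dots> \<le> \<eta> * t" using d(2)[OF t] t by (intro mult_right_mono) auto
    finally show "K * t powr (- \<theta>) * t \<le> e \<and> C * (K * t powr (- \<theta>) * t)\<^sup>2 \<le> \<eta> * t"
      using d(2)[OF t] by (simp add: mult.assoc 1)
  qed
qed

text \<open>The lower bound on \<open>w\<close> makes \<open>Lam\<close> positive, and \<open>Lam \<le> 1\<close> then allows to drop it from the
  denominators.\<close>

lemma growth_bound_of_Lam:
  assumes V: "V x > 0" and \<mu>: "\<mu> > 0" "\<mu> * V x powr \<rho> \<le> w x"
    and b: "max (norm (f x) / (sqrt (Lam V w \<rho> x) * V x powr \<delta>)) ((norm (g x))\<^sup>2 / (Lam V w \<rho> x * V x powr (2 * \<delta>))) \<le> h"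
  shows "norm (f x) \<le> h * V x powr \<delta>" "(norm (g x))\<^sup>2 \<le> h * (V x powr \<delta>)\<^sup>2"
proof -
  let ?l = "Lam V w \<rho> x" and ?r = "V x powr \<delta>"
  have p: "V x powr \<rho> > 0" "?r > 0" using V by auto
  have "\<mu> \<le> w x / V x powr \<rho>" using \<mu>(2) p by (simp add: field_simps)
  then have l: "0 < ?l" "?l \<le> 1" unfolding Lam_def using \<mu>(1) by auto
  then have sl: "0 < sqrt ?l" "sqrt ?l \<le> 1" by auto
  have b1: "norm (f x) / (sqrt ?l * ?r) \<le> h" and b2: "(norm (g x))\<^sup>2 / (?l * V x powr (2 * \<delta>)) \<le> h" using b by auto
  have h: "0 \<le> h"
    by (rule order_trans[OF _ b1]) (use sl p in simp)
  have r2: "V x powr (2 * \<delta>) = ?r\<^sup>2" by (simp add: power2_eq_square flip: powr_add)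
  have "norm (f x) \<le> h * (sqrt ?l * ?r)" using b1 sl p by (simp add: pos_divide_le_eq)
  also have "\<dots> \<le> h * (1 * ?r)" using sl p h by (intro mult_left_mono mult_right_mono) auto
  finally show "norm (f x) \<le> h * ?r" by simp
  have "(norm (g x))\<^sup>2 \<le> h * (?l * ?r\<^sup>2)" using b2 l p unfolding r2 by (simp add: pos_divide_le_eq)
  also have "\<dots> \<le> h * (1 * ?r\<^sup>2)" using l p h by (intro mult_left_mono mult_right_mono) auto
  finally show "(norm (g x))\<^sup>2 \<le> h * ?r\<^sup>2" by simp
qed

theorem corollary5p9:
  fixes M :: "'a measure" and F :: "real \<Rightarrow> 'a measure" and B :: "real \<Rightarrow> 'a \<Rightarrow> real ^ 'm"
    and f :: "real ^ 'd \<Rightarrow> real ^ 'd" and g :: "real ^ 'd \<Rightarrow> real ^ 'm ^ 'd"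
    and x0 :: "real ^ 'd" and V w :: "real ^ 'd \<Rightarrow> real"
    and \<rho> \<delta> \<mu> :: real and \<phi> :: "real \<Rightarrow> real" and \<theta> K \<Delta>s :: real
  assumes "filtered_brownian_motion M F B"
    and "local_lipschitz (UNIV :: real set) UNIV (\<lambda>_. f)" and "f 0 = 0"
    and "local_lipschitz (UNIV :: real set) UNIV (\<lambda>_. g)" and "g 0 = 0"
    and "\<rho> > 0"
    and "1 / \<delta> \<in> \<int>" and "4 \<le> 1 / \<delta>" and "V \<in> lyapunov_class 4 \<delta>"
    and "continuous_on UNIV w" and "\<And>x. 0 \<le> w x"
    and "\<And>x. generator_pow f g V \<rho> x \<le> - w x"
    and "\<And>x \<epsilon>. 0 < \<epsilon> \<Longrightarrow> \<epsilon> \<le> 1 \<Longrightarrow> V (\<epsilon> *\<^sub>R x) \<le> V x"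
    and "\<And>u. u > 0 \<Longrightarrow>
      (SUP x \<in> {x. 0 < norm x \<and> norm x \<le> u}.
        ereal (max ((norm (f x))\<^sup>2) ((norm (g x))\<^sup>2) / (Lam V w \<rho> x * V x powr (2 * \<delta>)))) < \<infinity>"
    and "\<mu> > 0" and "\<And>x. w x \<ge> \<mu> * V x powr \<rho>"
    and "\<And>u. u > 0 \<Longrightarrow> \<phi> u > 0" and "strict_mono_on {0<..} \<phi>"
    and "continuous_on {0<..} \<phi>" and "filterlim \<phi> at_top at_top"
    and "\<And>u. u \<ge> 1 \<Longrightarrow>
      (SUP x \<in> {x. 0 < norm x \<and> norm x \<le> u}.
        ereal (max (norm (f x) / (sqrt (Lam V w \<rho> x) * V x powr \<delta>))
                   ((norm (g x))\<^sup>2 / (Lam V w \<rho> x * V x powr (2 * \<delta>))))) \<le> ereal (\<phi> u)"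
    and "0 < \<theta>" and "\<theta> < 1 / 2"
    and "0 < \<Delta>s" and "\<Delta>s < 1" and "K > 0"
    and "K * \<Delta>s powr (- \<theta>) \<ge> \<phi> (max (norm x0) 1)"
  shows "\<forall>\<eta>. 0 < \<eta> \<and> \<eta> < \<mu> \<longrightarrow>
    (\<exists>\<Delta>ss. 0 < \<Delta>ss \<and> \<Delta>ss \<le> \<Delta>s \<and> (\<forall>\<Delta>. 0 < \<Delta> \<and> \<Delta> \<le> \<Delta>ss \<longrightarrow>
      (let Z = truncated_EM f g B \<phi> K \<theta> x0 \<Delta> in
        limsup (\<lambda>k. elog (\<integral>\<omega>. V (Z k \<omega>) powr \<rho> \<partial>M) / ereal (real k * \<Delta>))
          \<le> ereal (- (\<mu> - \<eta>)) \<and>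
        ereal (- (\<mu> - \<eta>)) < 0 \<and>
        (AE \<omega> in M. limsup (\<lambda>k. elog (V (Z k \<omega>)) / ereal (real k * \<Delta>))
          \<le> ereal (- ((\<mu> - \<eta>) / \<rho>))))))"
proof (intro allI impI)
  fix \<eta> assume "0 < \<eta> \<and> \<eta> < \<mu>"
  then have \<eta>: "0 < \<eta>" "\<eta> < \<mu>" by auto
  note fl = assms(2) and gl = assms(4) and \<rho> = assms(6) and gen = assms(12) and radial = assms(13)
    and \<mu> = assms(15) and w\<mu> = assms(16) and sup = assms(21)
  interpret filtered_brownian_motion M F B by (rule assms(1))
  have cont: "continuous_on UNIV f" "continuous_on UNIV g"
    using local_lipschitz_continuous_on[OF fl, of 0] local_lipschitz_continuous_on[OF gl, of 0] by auto
  have \<delta>: "0 < \<delta>" "\<delta> \<le> 1 / 4"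
  proof -
    show "0 < \<delta>" using assms(8) by (smt (verit) divide_nonneg_nonpos)
    then show "\<delta> \<le> 1 / 4" using assms(8) by (simp add: field_simps)
  qed
  obtain c where c: "c > 0" "\<And>vs x. 1 \<le> length vs \<Longrightarrow> length vs \<le> 4 \<Longrightarrow>
    \<bar>foldr DD vs V x\<bar> \<le> c * prod_list (map norm vs) * rpow (V x) (1 - real (length vs) * \<delta>)"
    using lyapunov_DD_bound[OF assms(9)] by metis
  have V0: "{x. V x = 0} = {0}" and Vnn: "\<And>x. 0 \<le> V x" and Ck: "Ck 4 V"
    using assms(9) by (simp_all add: lyapunov_class_def)
  interpret lyapunov_bound V \<delta> c
    by unfold_locales (use \<delta> c Vnn Ck V0 in blast)+
  obtain C where C0: "C \<ge> 0" and C: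
    "\<And>(f :: real ^ 'd \<Rightarrow> real ^ 'd) (g :: real ^ 'd \<Rightarrow> real ^ 'm ^ 'd) x h t.
      x \<noteq> 0 \<Longrightarrow> norm (f x) \<le> h * V x powr \<delta> \<Longrightarrow> (norm (g x))\<^sup>2 \<le> h * (V x powr \<delta>)\<^sup>2 \<Longrightarrow>
      0 < t \<Longrightarrow> 0 \<le> h \<Longrightarrow> h * t \<le> \<epsilon>0 \<Longrightarrow> h * t \<le> 1 \<Longrightarrow>
      (\<integral>\<^sup>+y. ennreal (V (x + t *\<^sub>R f x + g x *v y) powr \<rho>) \<partial>gauss t)
        \<le> ennreal (V x powr \<rho> + t * generator_pow f g V \<rho> x + C * V x powr \<rho> * (h * t)\<^sup>2)"
    using one_step_moment[OF \<rho>, where 'm = 'm] by metis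
  obtain d where d: "d > 0" "\<And>t. 0 < t \<Longrightarrow> t < d \<Longrightarrow>
      K * t powr (- \<theta>) * t \<le> min \<epsilon>0 1 \<and> C * (K * t powr (- \<theta>) * t)\<^sup>2 \<le> (\<eta> / 2) * t"
    using small_step_size[OF assms(22,23), of "\<eta> / 2" "min \<epsilon>0 1" K C] \<eta> eps_pos by auto
  \<comment> \<open>Half of the loss \<open>\<eta>\<close> pays for the discretization error, the other half for the almost sure rate,
    which has to be strictly smaller than the rate of the moments.\<close>
  define b where "b = \<mu> - \<eta> / 2"
  show "\<exists>\<Delta>ss. 0 < \<Delta>ss \<and> \<Delta>ss \<le> \<Delta>s \<and> (\<forall>\<Delta>. 0 < \<Delta> \<and> \<Delta> \<le> \<Delta>ss \<longrightarrow>
      (let Z = truncated_EM f g B \<phi> K \<theta> x0 \<Delta> in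
        limsup (\<lambda>k. elog (\<integral>\<omega>. V (Z k \<omega>) powr \<rho> \<partial>M) / ereal (real k * \<Delta>))
          \<le> ereal (- (\<mu> - \<eta>)) \<and>
        ereal (- (\<mu> - \<eta>)) < 0 \<and>
        (AE \<omega> in M. limsup (\<lambda>k. elog (V (Z k \<omega>)) / ereal (real k * \<Delta>))
          \<le> ereal (- ((\<mu> - \<eta>) / \<rho>)))))"
  proof (intro exI[of _ "min \<Delta>s (d / 2)"] conjI allI impI)
    show "0 < min \<Delta>s (d / 2)" "min \<Delta>s (d / 2) \<le> \<Delta>s" using d(1) assms(24) by auto
    fix \<Delta> assume "0 < \<Delta> \<and> \<Delta> \<le> min \<Delta>s (d / 2)"
    then have \<Delta>: "0 < \<Delta>" "\<Delta> \<le> \<Delta>s" "\<Delta> < d" using d(1) by auto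
    let ?Z = "truncated_EM f g B \<phi> K \<theta> x0 \<Delta>"
    define h where "h = K * \<Delta> powr (- \<theta>)"
    define R where "R = inv_into {0<..} \<phi> h"
    have h: "h \<ge> 0" unfolding h_def using assms(26) by simp
    have "\<phi> (max (norm x0) 1) \<le> h"
    proof -
      have "\<Delta>s powr (- \<theta>) \<le> \<Delta> powr (- \<theta>)" using \<Delta> assms(22) by (intro powr_mono2') auto
      then have "K * \<Delta>s powr (- \<theta>) \<le> h" unfolding h_def using assms(26) by simp
      then show ?thesis using assms(27) by simp
    qed
    from truncation_radius[OF assms(18-20) _ this]
    have R: "\<phi> R = h" "max (norm x0) 1 \<le> R"
      unfolding R_def by simp_all
    have growth: "norm (f z) \<le> h * V z powr \<delta>" "(norm (g z))\<^sup>2 \<le> h * (V z powr \<delta>)\<^sup>2"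
      if z: "z \<noteq> 0" "norm z \<le> R" for z
    proof -
      have "ereal (max (norm (f z) / (sqrt (Lam V w \<rho> z) * V z powr \<delta>))
                   ((norm (g z))\<^sup>2 / (Lam V w \<rho> z * V z powr (2 * \<delta>)))) \<le> ereal (\<phi> R)"
        by (rule order_trans[OF SUP_upper sup]) (use z R(2) in auto)
      then have b: "max (norm (f z) / (sqrt (Lam V w \<rho> z) * V z powr \<delta>))
                   ((norm (g z))\<^sup>2 / (Lam V w \<rho> z * V z powr (2 * \<delta>))) \<le> h"
        using R(1) by simp
      show "norm (f z) \<le> h * V z powr \<delta>" "(norm (g z))\<^sup>2 \<le> h * (V z powr \<delta>)\<^sup>2"
        by (fact growth_bound_of_Lam[where f = f and g = g, OF V_pos[OF z(1)] \<mu> w\<mu>[of z] b])+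
    qed
    have step: "(\<integral>\<^sup>+y. ennreal (V (truncation \<phi> K \<theta> \<Delta> (z + \<Delta> *\<^sub>R f z + g z *v y)) powr \<rho>) \<partial>gauss \<Delta>)
        \<le> ennreal (exp (- b * \<Delta>) * V z powr \<rho>)" if z: "norm z \<le> R" for z
    proof (cases "z = 0")
      case True
      have "V 0 = 0" using V_zero by blast
      then show ?thesis using True assms(3,5) by (simp add: truncation_0)
    next
      case False
      have "(\<integral>\<^sup>+y. ennreal (V (truncation \<phi> K \<theta> \<Delta> (z + \<Delta> *\<^sub>R f z + g z *v y)) powr \<rho>) \<partial>gauss \<Delta>)
          \<le> (\<integral>\<^sup>+y. ennreal (V (z + \<Delta> *\<^sub>R f z + g z *v y) powr \<rho>) \<partial>gauss \<Delta>)"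
        using R(2) \<rho> V_nonneg
        by (intro nn_integral_mono ennreal_leI powr_mono2 truncation_decreases radial) (auto simp: R_def h_def)
      also have "\<dots> \<le> ennreal (V z powr \<rho> + \<Delta> * generator_pow f g V \<rho> z + C * V z powr \<rho> * (h * \<Delta>)\<^sup>2)"
        using d(2)[OF \<Delta>(1,3)] by (intro C False growth z \<Delta>(1) h) (auto simp: h_def)
      also have "\<dots> \<le> ennreal (exp (- b * \<Delta>) * V z powr \<rho>)"
      proof (rule ennreal_leI)
        have "generator_pow f g V \<rho> z \<le> - (\<mu> * V z powr \<rho>)"
          using gen[of z] w\<mu>[of z] by linarith
        then have "\<Delta> * generator_pow f g V \<rho> z \<le> \<Delta> * - (\<mu> * V z powr \<rho>)"
          using \<Delta>(1) by (intro mult_left_mono) auto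
        moreover have "V z powr \<rho> * (C * (h * \<Delta>)\<^sup>2) \<le> V z powr \<rho> * ((\<eta> / 2) * \<Delta>)"
          using d(2)[OF \<Delta>(1,3)] by (intro mult_left_mono) (auto simp: h_def)
        ultimately have "V z powr \<rho> + \<Delta> * generator_pow f g V \<rho> z + C * V z powr \<rho> * (h * \<Delta>)\<^sup>2
            \<le> (1 + (- b * \<Delta>)) * V z powr \<rho>"
          unfolding b_def by (simp add: algebra_simps)
        also have "\<dots> \<le> exp (- b * \<Delta>) * V z powr \<rho>"
          by (intro mult_right_mono exp_ge_add_one_self) auto
        finally show "V z powr \<rho> + \<Delta> * generator_pow f g V \<rho> z + C * V z powr \<rho> * (h * \<Delta>)\<^sup>2
            \<le> exp (- b * \<Delta>) * V z powr \<rho>" .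
      qed
      finally show ?thesis .
    qed
    \<comment> \<open>The summand \<open>1\<close> keeps the logarithm of \<open>A\<close> finite when the scheme starts at the origin.\<close>
    define A where "A = V x0 powr \<rho> + 1"
    have A: "A > 0" unfolding A_def by (simp add: add_nonneg_pos)
    have moment: "(\<integral>\<^sup>+\<omega>. ennreal (V (?Z k \<omega>) powr \<rho>) \<partial>M) \<le> ennreal (A * exp (- b * (real k * \<Delta>)))" for k
    proof -
      have "(\<integral>\<^sup>+\<omega>. ennreal (V (?Z k \<omega>) powr \<rho>) \<partial>M) \<le> ennreal (exp (- b * \<Delta>) ^ k * V x0 powr \<rho>)"
        by (rule truncated_EM_moment_decay[OF cont \<Delta>(1) V_powr_measurable])
          (use R(2) step in \<open>auto simp: R_def h_def\<close>)
      also have "\<dots> \<le> ennreal (A * exp (- b * (real k * \<Delta>)))"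
      proof (rule ennreal_leI)
        have "exp (- b * \<Delta>) ^ k = exp (- b * (real k * \<Delta>))"
          by (simp add: exp_of_nat_mult[symmetric] algebra_simps)
        then show "exp (- b * \<Delta>) ^ k * V x0 powr \<rho> \<le> A * exp (- b * (real k * \<Delta>))"
          by (simp add: A_def)
      qed
      finally show ?thesis .
    qed
    have meas [measurable]: "(\<lambda>\<omega>. V (?Z k \<omega>) powr \<rho>) \<in> borel_measurable M" for k
    proof -
      have "?Z k \<in> borel_measurable M"
        by (rule measurable_from_subalg[OF subalgebra_F truncated_EM_adapted[OF cont \<Delta>(1)]]) (use \<Delta> in simp)
      from measurable_compose[OF this V_powr_measurable] show ?thesis .
    qed
    have b\<eta>: "\<mu> - \<eta> < b" unfolding b_def using \<eta> by simp
    have "(\<integral>\<omega>. V (?Z k \<omega>) powr \<rho> \<partial>M) \<le> A * exp (- b * (real k * \<Delta>))" for k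
      using moment[of k] A by (subst integral_eq_nn_integral) (auto intro!: enn2real_leI)
    from limsup_elog_le[OF A \<Delta>(1) this]
    have 1: "limsup (\<lambda>k. elog (\<integral>\<omega>. V (?Z k \<omega>) powr \<rho> \<partial>M) / ereal (real k * \<Delta>)) \<le> ereal (- (\<mu> - \<eta>))"
      by (rule order_trans) (use b\<eta> in simp)
    have "AE \<omega> in M. eventually (\<lambda>k. V (?Z k \<omega>) powr \<rho> \<le> exp (- (\<mu> - \<eta>) * (real k * \<Delta>))) sequentially"
      by (rule AE_eventually_le_of_summable_decay[OF meas \<Delta>(1) b\<eta> less_imp_le[OF A] _ moment]) simp
    then have 2: "AE \<omega> in M. limsup (\<lambda>k. elog (V (?Z k \<omega>)) / ereal (real k * \<Delta>)) \<le> ereal (- ((\<mu> - \<eta>) / \<rho>))"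
      by eventually_elim (rule limsup_elog_root_le[OF \<Delta>(1) \<rho> V_nonneg])
    show "let Z = ?Z in
        limsup (\<lambda>k. elog (\<integral>\<omega>. V (Z k \<omega>) powr \<rho> \<partial>M) / ereal (real k * \<Delta>)) \<le> ereal (- (\<mu> - \<eta>)) \<and>
        ereal (- (\<mu> - \<eta>)) < 0 \<and>
        (AE \<omega> in M. limsup (\<lambda>k. elog (V (Z k \<omega>)) / ereal (real k * \<Delta>)) \<le> ereal (- ((\<mu> - \<eta>) / \<rho>)))"
      unfolding Let_def using 1 2 \<eta> by simp
  qed
qed

end
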